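(* Let $L>0$, $T>0$, let $p\ge 2$ and $m\ge1$ be integers, and let $\Omega=(0,L)$. Suppose the unique $L$-periodic (in $x$) solution $u_e$ on $[0,T]$ of $$u_{tt}=-u_{xxxx}+u_{xx}+(u^p)_{xx}$$ with $L$-periodic initial data $u(x,0)=u^0(x)$, $u_t(x,0)=v^0(x)$ satisfies $$u_e\in H^4(0,T;L^2)\cap L^\infty(0,T;H^{m+4})\cap H^2(0,T;H^4).$$ For $N,K\in\mathbb N$ let $h=L/(2N+1)$, $\Delta t=T/K$, $t^n=n\Delta t$, and set $$U_N(x,t)=\mathcal P_N u_e(x,t),\qquad \Psi_N(x,t)=\partial_tU_N(x,t)-\frac{\Delta t^2}{12}\partial_t^3U_N(x,t),$$ with grid functions $U^n_i=U_N(x_i,t^n)$, $\Psi^n_i=\Psi_N(x_i,t^n)$. Then, for $1\le n\le K-1$, $$\frac{\Psi^{n+1}-\Psi^n}{\Delta t}=-D_N^4\Big(\frac{U^{n+1}+U^n}{2}\Big)+D_N^2\Big(\frac{U^{n+1}+U^n}{2}\Big)+D_N^2\Big(\frac32(U^n)^p-\frac12(U^{n-1})^p\Big)+\tau_1^n,$$ $$\frac{U^{n+1}-U^n}{\Delta t}=\frac{\Psi^{n+1}+\Psi^n}{2}+\Delta t\,\tau_2^n,$$ where the grid functions $\tau_1^n,\tau_2^n$ satisfy $$\|\tau_i\|_{\ell^2(0,T;\ell^2)}:=\Big(\Delta t\sum_{k=1}^{K-1}\|\tau_i^k\|_2^2\Big)^{1/2}\le M(\Delta t^2+h^m),\qquad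 i=1,2,$$ in which $M$ depends only on the regularity of the exact solution $u_e$.
   Context: All function spaces $L^2$, $H^r$ in space are over $\Omega=(0,L)$ with $L$-periodic boundary conditions. $\mathcal B^N$ is the space of trigonometric polynomials $\sum_{l=-N}^{N}c_l e^{2\pi i l x/L}$ of degree up to $N$, and $\mathcal P_N$ is the $L^2$-orthogonal projection onto $\mathcal B^N$ (truncation of the Fourier series in $x$). The numerical grid is $x_i=ih$, $0\le i\le 2N$. A grid function is a vector $f=(f_i)_{0\le i\le 2N}$; let $f_N\in\mathcal B^N$ be the unique trigonometric polynomial with $f_N(x_i)=f_i$. The discrete differentiation operator is $(D_Nf)_i=(\partial_xf_N)(x_i)$, with $D_N^2$, $D_N^4$ its powers. Powers $(U^n)^p$ of grid functions are pointwise. The discrete norm is $\|f\|_2=\big(\frac1{2N+1}\sum_{i=0}^{2N}f_i^2\big)^{1/2}$. "Depends only on the regularity of $u_e$" means that $M$ is determined by norms of $u_e$ in the stated spaces (and the fixed parameters $L,T,m,p$) and is independent of $\Delta t$ and $h$. *)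

theory Defs
  imports "HOL-Analysis.Analysis"
begin

text \<open>
  A function \<open>u t x\<close> of time and space is curried with time first. Elements of Lebesgue spaces are
  represented by Borel measurable functions; equality in these spaces is equality almost everywhere.
\<close>

section \<open>Periodic Sobolev spaces on \<open>(0,L)\<close>\<close>

definition periodic :: "real \<Rightarrow> (real \<Rightarrow> 'a) \<Rightarrow> bool" where
  "periodic L f \<longleftrightarrow> (\<forall>x. f (x + L) = f x)"

definition smooth :: "(real \<Rightarrow> real) \<Rightarrow> bool" where
  "smooth \<phi> \<longleftrightarrow> (\<forall>k x. (deriv ^^ k) \<phi> field_differentiable at x)"

definition L2 :: "real \<Rightarrow> (real \<Rightarrow> real) set" where
  "L2 L = {f. set_borel_measurable lborel {0<..<L} f \<and>
              set_integrable lborel {0<..<L} (\<lambda>x. (f x)\<^sup>2)}"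

definition L2_norm :: "real \<Rightarrow> (real \<Rightarrow> real) \<Rightarrow> real" where
  "L2_norm L f = sqrt (LINT x:{0<..<L}|lborel. (f x)\<^sup>2)"

text \<open>
  The test functions are smooth and \<open>L\<close>-periodic, not compactly supported in \<open>(0,L)\<close>. This is what
  encodes the periodic boundary conditions.
\<close>

definition weak_xderiv :: "real \<Rightarrow> nat \<Rightarrow> (real \<Rightarrow> real) \<Rightarrow> (real \<Rightarrow> real) \<Rightarrow> bool" where
  "weak_xderiv L j f g \<longleftrightarrow>
     (\<forall>\<phi>. smooth \<phi> \<and> periodic L \<phi> \<longrightarrow>
        (LINT x:{0<..<L}|lborel. f x * (deriv ^^ j) \<phi> x) =
        (-1) ^ j * (LINT x:{0<..<L}|lborel. g x * \<phi> x))"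

definition xderiv :: "real \<Rightarrow> nat \<Rightarrow> (real \<Rightarrow> real) \<Rightarrow> real \<Rightarrow> real" where
  "xderiv L j f = (SOME g. g \<in> L2 L \<and> weak_xderiv L j f g)"

definition H_per :: "real \<Rightarrow> nat \<Rightarrow> (real \<Rightarrow> real) set" where
  "H_per L r = {f \<in> L2 L. \<forall>j\<le>r. \<exists>g\<in>L2 L. weak_xderiv L j f g}"

definition H_per_norm :: "real \<Rightarrow> nat \<Rightarrow> (real \<Rightarrow> real) \<Rightarrow> real" where
  "H_per_norm L r f = sqrt (\<Sum>j\<le>r. (L2_norm L (xderiv L j f))\<^sup>2)"

section \<open>Bochner spaces on \<open>(0,T)\<close> with values in \<open>H_per L r\<close>\<close>

text \<open>
  Since the periodic Sobolev spaces are separable, strong measurability of the map from \<open>t\<close> to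
  \<open>u t\<close> is, up to the choice of a representative, joint measurability of \<open>u\<close>.
\<close>

definition jointly_measurable :: "real \<Rightarrow> real \<Rightarrow> (real \<Rightarrow> real \<Rightarrow> real) \<Rightarrow> bool" where
  "jointly_measurable L T u \<longleftrightarrow>
     set_borel_measurable lborel ({0<..<T} \<times> {0<..<L}) (\<lambda>(t, x). u t x)"

definition L2_time :: "real \<Rightarrow> real \<Rightarrow> nat \<Rightarrow> (real \<Rightarrow> real \<Rightarrow> real) set" where
  "L2_time L T r = {u. jointly_measurable L T u \<and>
     (AE t in lborel. t \<in> {0<..<T} \<longrightarrow> u t \<in> H_per L r) \<and>
     set_integrable lborel {0<..<T} (\<lambda>t. (H_per_norm L r (u t))\<^sup>2)}"

definition Linf_time :: "real \<Rightarrow> real \<Rightarrow> nat \<Rightarrow> (real \<Rightarrow> real \<Rightarrow> real) set" where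
  "Linf_time L T r = {u. jointly_measurable L T u \<and>
     (AE t in lborel. t \<in> {0<..<T} \<longrightarrow> u t \<in> H_per L r) \<and>
     (\<exists>C. AE t in lborel. t \<in> {0<..<T} \<longrightarrow> H_per_norm L r (u t) \<le> C)}"

definition Linf_time_norm :: "real \<Rightarrow> real \<Rightarrow> nat \<Rightarrow> (real \<Rightarrow> real \<Rightarrow> real) \<Rightarrow> real" where
  "Linf_time_norm L T r u =
     Inf {C. 0 \<le> C \<and> (AE t in lborel. t \<in> {0<..<T} \<longrightarrow> H_per_norm L r (u t) \<le> C)}"

definition time_test_fun :: "real \<Rightarrow> (real \<Rightarrow> real) \<Rightarrow> bool" where
  "time_test_fun T \<phi> \<longleftrightarrow> smooth \<phi> \<and> (\<exists>a b. 0 < a \<and> b < T \<and> (\<forall>t. t \<notin> {a..b} \<longrightarrow> \<phi> t = 0))"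

text \<open>
  The identity between the two vector-valued integrals over \<open>(0,T)\<close> is an identity in \<open>L\<^sup>2(0,L)\<close>. For
  jointly measurable functions these integrals may be evaluated separately at almost every \<open>x\<close>.
\<close>

definition weak_tderiv ::
    "real \<Rightarrow> real \<Rightarrow> nat \<Rightarrow> (real \<Rightarrow> real \<Rightarrow> real) \<Rightarrow> (real \<Rightarrow> real \<Rightarrow> real) \<Rightarrow> bool" where
  "weak_tderiv L T j u v \<longleftrightarrow>
     (\<forall>\<phi>. time_test_fun T \<phi> \<longrightarrow>
        (AE x in lborel. x \<in> {0<..<L} \<longrightarrow>
           (LINT t:{0<..<T}|lborel. (deriv ^^ j) \<phi> t * u t x) =
           (-1) ^ j * (LINT t:{0<..<T}|lborel. \<phi> t * v t x)))"

text \<open>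
  The weak time derivative is unique almost everywhere, so it does not matter that it is chosen in
  \<open>L\<^sup>2(0,T;L\<^sup>2)\<close> also where a derivative in \<open>L\<^sup>2(0,T;H\<^sup>r)\<close> exists.
\<close>

definition tderiv ::
    "real \<Rightarrow> real \<Rightarrow> nat \<Rightarrow> (real \<Rightarrow> real \<Rightarrow> real) \<Rightarrow> real \<Rightarrow> real \<Rightarrow> real" where
  "tderiv L T j u = (SOME v. v \<in> L2_time L T 0 \<and> weak_tderiv L T j u v)"

text \<open>\<open>H_time L T k r\<close> is \<open>H\<^sup>k(0,T;H\<^sup>r)\<close>; the case \<open>r = 0\<close> is \<open>H\<^sup>k(0,T;L\<^sup>2)\<close>.\<close>

definition H_time :: "real \<Rightarrow> real \<Rightarrow> nat \<Rightarrow> nat \<Rightarrow> (real \<Rightarrow> real \<Rightarrow> real) set" where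
  "H_time L T k r = {u \<in> L2_time L T r. \<forall>j\<le>k. \<exists>v\<in>L2_time L T r. weak_tderiv L T j u v}"

definition H_time_norm :: "real \<Rightarrow> real \<Rightarrow> nat \<Rightarrow> nat \<Rightarrow> (real \<Rightarrow> real \<Rightarrow> real) \<Rightarrow> real" where
  "H_time_norm L T k r u =
     sqrt (\<Sum>j\<le>k. LINT t:{0<..<T}|lborel. (H_per_norm L r (tderiv L T j u t))\<^sup>2)"

section \<open>The equation\<close>

text \<open>
  The equation holds almost everywhere, with weak derivatives. Continuity singles out the
  representative whose values at individual times are meant in the initial condition and on
  the temporal grid; it exists for every element of \<open>H\<^sup>2(0,T;H\<^sup>4)\<close>, which embeds into
  \<open>C\<^sup>1([0,T];C\<^sup>3)\<close>. Values of \<open>u t\<close> for \<open>t\<close> outside \<open>[0,T]\<close> are irrelevant.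
\<close>

definition boussinesq_solution ::
    "real \<Rightarrow> real \<Rightarrow> nat \<Rightarrow> (real \<Rightarrow> real) \<Rightarrow> (real \<Rightarrow> real) \<Rightarrow> (real \<Rightarrow> real \<Rightarrow> real) \<Rightarrow> bool" where
  "boussinesq_solution L T p u0 v0 u \<longleftrightarrow>
     continuous_on ({0..T} \<times> UNIV) (\<lambda>(t, x). u t x) \<and>
     (\<forall>t\<in>{0..T}. periodic L (u t)) \<and>
     u \<in> H_time L T 2 0 \<and>
     (AE t in lborel. t \<in> {0<..<T} \<longrightarrow>
        u t \<in> H_per L 4 \<and> (\<lambda>y. u t y ^ p) \<in> H_per L 2 \<and>
        (AE x in lborel. x \<in> {0<..<L} \<longrightarrow>
           tderiv L T 2 u t x =
             - xderiv L 4 (u t) x + xderiv L 2 (u t) x + xderiv L 2 (\<lambda>y. u t y ^ p) x)) \<and>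
     periodic L u0 \<and> periodic L v0 \<and>
     (\<forall>x. u 0 x = u0 x) \<and>
     (\<forall>x. ((\<lambda>t. u t x) has_real_derivative v0 x) (at 0 within {0..T}))"

section \<open>Fourier pseudospectral discretization\<close>

definition fourier_mode :: "real \<Rightarrow> int \<Rightarrow> real \<Rightarrow> complex" where
  "fourier_mode L l x = exp (2 * pi * \<i> * of_int l * of_real x / of_real L)"

text \<open>The real-valued members of the space of trigonometric polynomials of degree up to \<open>N\<close>.\<close>

definition trig_poly :: "real \<Rightarrow> nat \<Rightarrow> (real \<Rightarrow> real) set" where
  "trig_poly L N = {f. \<exists>c :: int \<Rightarrow> complex. \<forall>x.
     complex_of_real (f x) = (\<Sum>l = - int N..int N. c l * fourier_mode L l x)}"

definition fourier_coeff :: "real \<Rightarrow> (real \<Rightarrow> real) \<Rightarrow> int \<Rightarrow> complex" where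
  "fourier_coeff L f l =
     (CLINT x:{0<..<L}|lborel. complex_of_real (f x) * fourier_mode L (- l) x) / complex_of_real L"

text \<open>The truncated Fourier series of a real-valued function is real, so \<open>Re\<close> only adapts the type.\<close>

definition fourier_proj :: "real \<Rightarrow> nat \<Rightarrow> (real \<Rightarrow> real) \<Rightarrow> real \<Rightarrow> real" where
  "fourier_proj L N f x = Re (\<Sum>l = - int N..int N. fourier_coeff L f l * fourier_mode L l x)"

definition grid_point :: "real \<Rightarrow> nat \<Rightarrow> nat \<Rightarrow> real" where
  "grid_point L N i = real i * (L / (2 * real N + 1))"

text \<open>
  Grid functions are functions of type \<open>nat \<Rightarrow> real\<close> of which only the values at
  \<open>0, \<dots>, 2 * N\<close> matter.
\<close>

definition trig_interp :: "real \<Rightarrow> nat \<Rightarrow> (nat \<Rightarrow> real) \<Rightarrow> real \<Rightarrow> real" where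
  "trig_interp L N f = (THE g. g \<in> trig_poly L N \<and> (\<forall>i\<le>2 * N. g (grid_point L N i) = f i))"

definition discrete_deriv :: "real \<Rightarrow> nat \<Rightarrow> (nat \<Rightarrow> real) \<Rightarrow> nat \<Rightarrow> real" where
  "discrete_deriv L N f i = deriv (trig_interp L N f) (grid_point L N i)"

definition discrete_norm :: "nat \<Rightarrow> (nat \<Rightarrow> real) \<Rightarrow> real" where
  "discrete_norm N f = sqrt (1 / (2 * real N + 1) * (\<Sum>i = 0..2 * N. (f i)\<^sup>2))"

definition discrete_time_norm :: "nat \<Rightarrow> real \<Rightarrow> nat \<Rightarrow> (nat \<Rightarrow> nat \<Rightarrow> real) \<Rightarrow> real" where
  "discrete_time_norm N dt K \<tau> = sqrt (dt * (\<Sum>k = 1..K - 1. (discrete_norm N (\<tau> k))\<^sup>2))"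

text \<open>Classical time derivatives on \<open>[0,T]\<close>, one-sided at the end points.\<close>

definition time_deriv :: "real \<Rightarrow> (real \<Rightarrow> real) \<Rightarrow> real \<Rightarrow> real" where
  "time_deriv T f t = vector_derivative f (at t within {0..T})"

definition U_approx :: "real \<Rightarrow> nat \<Rightarrow> (real \<Rightarrow> real \<Rightarrow> real) \<Rightarrow> real \<Rightarrow> real \<Rightarrow> real" where
  "U_approx L N u t x = fourier_proj L N (u t) x"

definition Psi_approx ::
    "real \<Rightarrow> real \<Rightarrow> nat \<Rightarrow> real \<Rightarrow> (real \<Rightarrow> real \<Rightarrow> real) \<Rightarrow> real \<Rightarrow> real \<Rightarrow> real" where
  "Psi_approx L T N dt u t x =
     time_deriv T (\<lambda>s. U_approx L N u s x) t -
     dt\<^sup>2 / 12 * (time_deriv T ^^ 3) (\<lambda>s. U_approx L N u s x) t"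

end

theory Submission imports Defs
begin

text \<open>
  The Fourier coefficients \<open>c\<^sub>l(t)\<close> of \<open>u(t)\<close> are \<open>C\<^sup>3\<close> in time with absolutely continuous third derivative
  (du Bois-Reymond), and each satisfies the ordinary differential equation obtained from the
  Boussinesq equation. Linear terms of the scheme act on the modes of degree at most \<open>N\<close> exactly as
  their continuous counterparts, so the midpoint and trapezoidal residuals are Taylor remainders
  controlled by the fourth time derivative; the correction \<open>- dt\<^sup>2/12 \<partial>\<^sub>t\<^sup>3 U\<close> in \<open>\<Psi>\<close> cancels the
  \<open>dt\<^sup>2 \<partial>\<^sub>t\<^sup>3 U\<close> term of the midpoint residual.

  The residual of the nonlinearity is the sum of the projection to degree \<open>N\<close> of
  \<open>u\<^sup>p - U\<^sup>p\<close>, of half the second difference in time of \<open>U\<^sup>p\<close>, and of the aliasing error of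
  \<open>U\<^sup>p\<close>. Weighted \<open>\<ell>\<^sup>1\<close> sums of coefficients are submultiplicative and control the first and
  the third by \<open>h\<^sup>m\<close>. The second is estimated in a weighted \<open>\<ell>\<^sup>2\<close> norm, on which the \<open>\<ell>\<^sup>1\<close> algebra acts.

  The bounds on \<open>\<partial>\<^sub>t u\<close> and \<open>\<partial>\<^sub>t\<^sup>2 u\<close> needed for the second difference come from interpolating each mode
  in time between \<open>L\<^sup>\<infinity>(0,T;H\<^sup>5)\<close> and \<open>H\<^sup>4(0,T;L\<^sup>2)\<close> instead of from \<open>H\<^sup>2(0,T;H\<^sup>4)\<close>: the norm of
  \<open>H_time L T 2 4\<close> is taken of the representative chosen by \<open>tderiv\<close>, whose \<open>H\<^sup>4\<close> norm need not be
  measurable in time, so that the integral defining it may have the junk value 0.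
\<close>

section \<open>Smooth functions\<close>

text \<open>The bound has to be uniform over all solutions and both meshes, so a solution is reduced
  to two numbers: \<open>A\<close> bounds the time integrals of the squared coefficients of the
  fourth time derivative, \<open>B\<close> bounds the weighted squares of the coefficients at each
  time. The fourth time derivative is merely square integrable in time. A Taylor remainder is
  therefore kept as an integral over one time step; Cauchy-Schwarz and summation over the steps then
  recover \<open>A\<close> together with the full order \<open>dt^2\<close>. The exponents leave
  little room. Write \<open>w = 1 + |l|\<close> and \<open>c\<close> for the coefficient of mode
  \<open>l\<close>. The second difference of \<open>U^p\<close> needs the sum over the modes of
  \<open>w^2 sup |c'|\<close>, hence, by Cauchy-Schwarz over the modes, the weight
  \<open>w^6\<close> on \<open>sup |c'|^2\<close>; it also needs the weight \<open>w^4\<close> on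
  the time integral of \<open>|c''|^2\<close>. Interpolation between the weight \<open>w^10\<close>
  on \<open>|c|^2\<close> and the weight 1 on \<open>|c''''|^2\<close> offers
  \<open>w^(25/4)\<close> and \<open>w^5\<close>, so both are within reach. The weight
  \<open>w^10\<close> is the one of \<open>H^5\<close>, which \<open>m + 4 \<ge> 5\<close>
  provides.\<close>

lemma smoothI_closed:
  assumes "\<And>f. f \<in> C \<Longrightarrow> \<exists>g\<in>C. \<forall>x. (f has_real_derivative g x) (at x)" and "f \<in> C"
  shows "smooth f"
proof -
  have "(deriv ^^ k) f \<in> C" for k
  proof (induction k)
    case (Suc k)
    then obtain g where g: "g \<in> C" "\<forall>x. ((deriv ^^ k) f has_real_derivative g x) (at x)"
      using assms(1) by blast
    then have "deriv ((deriv ^^ k) f) = g" by (auto intro!: DERIV_imp_deriv)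
    then show ?case using g by simp
  qed (use assms in auto)
  then show ?thesis
    unfolding smooth_def using assms(1) by (meson field_differentiable_def)
qed

text \<open>Smoothness is a condition on all iterates of \<open>deriv\<close>. In an algebra
  generated by functions whose first derivatives lie in the algebra again, it follows from first
  derivatives alone, without a formula for higher derivatives of products.\<close>

inductive_set fun_alg :: "(real \<Rightarrow> real) set \<Rightarrow> (real \<Rightarrow> real) set" for B where
  base: "f \<in> B \<Longrightarrow> f \<in> fun_alg B"
| const: "(\<lambda>x. c) \<in> fun_alg B"
| add: "f \<in> fun_alg B \<Longrightarrow> g \<in> fun_alg B \<Longrightarrow> (\<lambda>x. f x + g x) \<in> fun_alg B"
| mult: "f \<in> fun_alg B \<Longrightarrow> g \<in> fun_alg B \<Longrightarrow> (\<lambda>x. f x * g x) \<in> fun_alg B"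

lemma smooth_fun_alg:
  assumes B: "\<And>f. f \<in> B \<Longrightarrow> \<exists>g\<in>fun_alg B. \<forall>x. (f has_real_derivative g x) (at x)"
    and "f \<in> fun_alg B"
  shows "smooth f"
proof (rule smoothI_closed[OF _ assms(2)])
  fix f assume "f \<in> fun_alg B"
  then show "\<exists>g\<in>fun_alg B. \<forall>x. (f has_real_derivative g x) (at x)"
  proof induction
    case (const c)
    show ?case by (rule bexI[of _ "\<lambda>x. 0"]) (auto intro: fun_alg.const)
  next
    case (add f g)
    then obtain f' g' where *: "f' \<in> fun_alg B" "g' \<in> fun_alg B"
      "\<forall>x. (f has_real_derivative f' x) (at x)" "\<forall>x. (g has_real_derivative g' x) (at x)" by blast
    show ?case
      by (rule bexI[of _ "\<lambda>x. f' x + g' x"]) (use * in \<open>auto intro!: fun_alg.add derivative_eq_intros\<close>)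
  next
    case (mult f g)
    then obtain f' g' where *: "f' \<in> fun_alg B" "g' \<in> fun_alg B"
      "\<forall>x. (f has_real_derivative f' x) (at x)" "\<forall>x. (g has_real_derivative g' x) (at x)" by blast
    show ?case
      by (rule bexI[of _ "\<lambda>x. f x * g' x + f' x * g x"])
        (use * mult in \<open>auto intro!: fun_alg.add fun_alg.mult DERIV_mult'\<close>)
  qed (use B in auto)
qed

lemma smooth_has_deriv: "smooth f \<Longrightarrow> (f has_real_derivative deriv f x) (at x)"
  unfolding smooth_def using field_differentiable_derivI[of f x] by (metis funpow_0)

lemma smooth_deriv: "smooth f \<Longrightarrow> smooth (deriv f)"
  unfolding smooth_def by (metis comp_apply funpow_Suc_right)

lemma smooth_antideriv:
  assumes g: "smooth g" and f: "\<And>x. (f has_real_derivative g x) (at x)"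
  shows "smooth f"
proof -
  let ?C = "{f. \<exists>g. smooth g \<and> (\<forall>x. (f has_real_derivative g x) (at x))}"
  show ?thesis
  proof (rule smoothI_closed[of ?C])
    fix f assume "f \<in> ?C"
    then obtain g where g: "smooth g" "\<forall>x. (f has_real_derivative g x) (at x)" by blast
    then have "g \<in> ?C" using smooth_deriv smooth_has_deriv by blast
    then show "\<exists>g\<in>?C. \<forall>x. (f has_real_derivative g x) (at x)" using g by blast
  qed (use g f in blast)
qed

lemma smooth_continuous: "smooth f \<Longrightarrow> continuous_on A f"
  by (meson DERIV_continuous_on has_field_derivative_at_within smooth_has_deriv)

lemma smooth_deriv_n_continuous: "smooth f \<Longrightarrow> continuous_on A ((deriv ^^ k) f)"
  by (induction k arbitrary: f) (simp_all add: smooth_continuous smooth_deriv funpow_Suc_right del: funpow.simps(2))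

text \<open>The factor \<open>(1 / x) ^ k\<close> closes the family under differentiation: the
  derivative of member \<open>k\<close> is a combination of members \<open>k + 1\<close> and
  \<open>k + 2\<close>. Member 0 is the classical smooth function that is flat at 0.\<close>

definition exp_cutoff :: "nat \<Rightarrow> real \<Rightarrow> real" where
  "exp_cutoff k x = (if 0 < x then (1 / x) ^ k * exp (- (1 / x)) else 0)"

lemma exp_cutoff_tendsto_0: "((\<lambda>x. exp_cutoff k x) \<longlongrightarrow> 0) (at 0)"
proof -
  have "((\<lambda>x::real. (1 / x) ^ k * exp (- (1 / x))) \<longlongrightarrow> 0) (at_right 0)"
    using tendsto_power_div_exp_0[of k]
    by (auto simp: filterlim_at_right_to_top exp_minus field_simps)
  then have "(exp_cutoff k \<longlongrightarrow> 0) (at_right 0)"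
    by (rule Lim_transform_eventually) (auto simp: exp_cutoff_def eventually_at_filter)
  moreover have "(exp_cutoff k \<longlongrightarrow> 0) (at_left 0)"
    by (rule Lim_transform_eventually[OF tendsto_const]) (auto simp: exp_cutoff_def eventually_at_filter)
  ultimately show ?thesis using filterlim_split_at by blast
qed

lemma exp_cutoff_deriv:
  "(exp_cutoff k has_real_derivative - real k * exp_cutoff (k + 1) x + exp_cutoff (k + 2) x) (at x)"
proof -
  consider "x < 0" | "x = 0" | "0 < x" by linarith
  then show ?thesis
  proof cases
    case 1
    have "((\<lambda>x. 0) has_real_derivative 0) (at x)" by simp
    then have "(exp_cutoff k has_real_derivative 0) (at x)"
      by (rule has_field_derivative_transform_within_open[where S="{..<0}"]) (use 1 in \<open>auto simp: exp_cutoff_def\<close>)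
    then show ?thesis using 1 by (simp add: exp_cutoff_def)
  next
    case 2
    \<comment> \<open>Dividing by \<open>h\<close> raises the power of \<open>1 / h\<close> by one,
      so the difference quotient at 0 is itself a member of the family.\<close>
    have "((\<lambda>h. exp_cutoff (Suc k) h) \<longlongrightarrow> 0) (at 0)" by (rule exp_cutoff_tendsto_0)
    moreover have "\<forall>\<^sub>F h in at 0. exp_cutoff (Suc k) h = (exp_cutoff k (0 + h) - exp_cutoff k 0) / h"
      by (auto simp: exp_cutoff_def eventually_at_filter field_simps)
    ultimately have "((\<lambda>h. (exp_cutoff k (0 + h) - exp_cutoff k 0) / h) \<longlongrightarrow> 0) (at 0)"
      by (rule Lim_transform_eventually)
    then show ?thesis using 2 by (simp add: DERIV_def exp_cutoff_def)
  next
    case 3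
    have "((\<lambda>x. (1 / x) ^ k * exp (- (1 / x))) has_real_derivative
        - real k * exp_cutoff (k + 1) x + exp_cutoff (k + 2) x) (at x)"
      using 3 by (auto intro!: derivative_eq_intros simp: exp_cutoff_def field_simps power2_eq_square)
        (cases k; simp add: field_simps)+
    then show ?thesis
      by (rule has_field_derivative_transform_within_open[where S="{0<..}"]) (use 3 in \<open>auto simp: exp_cutoff_def\<close>)
  qed
qed

text \<open>Smooth approximations of the indicator of \<open>(a, b)\<close> from inside: the support
  keeps the distance \<open>1 / n\<close> from both end points, which makes the bump a test
  function, and for growing \<open>n\<close> the bump tends to 1 at each point of the
  interval.\<close>

definition bump :: "real \<Rightarrow> real \<Rightarrow> nat \<Rightarrow> real \<Rightarrow> real" where
  "bump a b n x = exp_cutoff 0 (real n * (x - a) - 1) * exp_cutoff 0 (real n * (b - x) - 1)"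

lemma smooth_bump: "smooth (bump a b n)"
proof -
  let ?B = "range (\<lambda>k x. exp_cutoff k (real n * (x - a) - 1)) \<union> range (\<lambda>k x. exp_cutoff k (real n * (b - x) - 1))"
  have "(\<lambda>x. exp_cutoff k (real n * (x - a) - 1)) \<in> fun_alg ?B"
    "(\<lambda>x. exp_cutoff k (real n * (b - x) - 1)) \<in> fun_alg ?B" for k
    by (auto intro: fun_alg.base)
  note in_alg = this
  show ?thesis
  proof (rule smooth_fun_alg[of ?B])
    fix f assume "f \<in> ?B"
    then consider k where "f = (\<lambda>x. exp_cutoff k (real n * (x - a) - 1))"
      | k where "f = (\<lambda>x. exp_cutoff k (real n * (b - x) - 1))" by auto
    then show "\<exists>g\<in>fun_alg ?B. \<forall>x. (f has_real_derivative g x) (at x)"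
    proof cases
      case 1
      let ?y = "\<lambda>x. real n * (x - a) - 1"
      show ?thesis
      proof (rule bexI[of _ "\<lambda>x. (- real k * exp_cutoff (k+1) (?y x) + exp_cutoff (k+2) (?y x)) * real n"])
        show "\<forall>x. (f has_real_derivative (- real k * exp_cutoff (k+1) (?y x) + exp_cutoff (k+2) (?y x)) * real n) (at x)"
          unfolding 1 by (intro allI DERIV_chain2[OF exp_cutoff_deriv]) (auto intro!: derivative_eq_intros)
      qed (intro fun_alg.mult fun_alg.add fun_alg.const in_alg)
    next
      case 2
      let ?y = "\<lambda>x. real n * (b - x) - 1"
      show ?thesis
      proof (rule bexI[of _ "\<lambda>x. (- real k * exp_cutoff (k+1) (?y x) + exp_cutoff (k+2) (?y x)) * (- real n)"])
        show "\<forall>x. (f has_real_derivative (- real k * exp_cutoff (k+1) (?y x) + exp_cutoff (k+2) (?y x)) * (- real n)) (at x)"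
          unfolding 2 by (intro allI DERIV_chain2[OF exp_cutoff_deriv]) (auto intro!: derivative_eq_intros)
      qed (intro fun_alg.mult fun_alg.add fun_alg.const in_alg)
    qed
  next
    show "bump a b n \<in> fun_alg ?B" unfolding bump_def[abs_def] by (intro fun_alg.mult in_alg)
  qed
qed

lemma exp_cutoff_0_le: "0 \<le> exp_cutoff 0 x" "exp_cutoff 0 x \<le> 1"
  by (auto simp: exp_cutoff_def)

lemma bump_nonneg: "0 \<le> bump a b n x" and bump_le_1: "bump a b n x \<le> 1"
  unfolding bump_def using exp_cutoff_0_le by (auto intro!: mult_le_one)

lemma bump_eq_0: "0 < n \<Longrightarrow> x \<notin> {a + 1 / n..b - 1 / n} \<Longrightarrow> bump a b n x = 0"
  by (auto simp: bump_def exp_cutoff_def field_simps)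

lemma bump_test: "0 \<le> a \<Longrightarrow> b \<le> T \<Longrightarrow> 0 < n \<Longrightarrow> time_test_fun T (bump a b n)"
  unfolding time_test_fun_def using smooth_bump bump_eq_0[of n _ a b]
  by (intro conjI exI[of _ "a + 1 / real n"] exI[of _ "b - 1 / real n"])
    (auto simp: add_nonneg_pos intro: less_le_trans[of _ b])

lemma exp_cutoff_limit: "0 < y \<Longrightarrow> (\<lambda>n. exp_cutoff 0 (real n * y - 1)) \<longlonglongrightarrow> 1"
proof -
  assume y: "0 < y"
  have "(\<lambda>n. exp (- (1 / (real n * y - 1)))) \<longlonglongrightarrow> 1"
  proof -
    have "filterlim (\<lambda>n. real n * y - 1) at_top sequentially"
      using y filterlim_real_sequentially
      by (intro filterlim_tendsto_add_at_top[of "\<lambda>_. - 1" "-1" sequentially, simplified]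
          filterlim_at_top_mult_tendsto_pos[where c=y]) auto
    then have "(\<lambda>n. - (1 / (real n * y - 1))) \<longlonglongrightarrow> - 0"
      by (intro tendsto_minus real_tendsto_divide_at_top) auto
    then show ?thesis using tendsto_exp by fastforce
  qed
  moreover have "\<forall>\<^sub>F n in sequentially. exp (- (1 / (real n * y - 1))) = exp_cutoff 0 (real n * y - 1)"
  proof -
    obtain N where N: "1 / y < real N" using reals_Archimedean2 by blast
    show ?thesis
    proof (rule eventually_sequentiallyI[of N])
      fix n assume "N \<le> n"
      then have "1 / y < real n" using N by linarith
      then have "0 < real n * y - 1" using y by (simp add: field_simps)
      then show "exp (- (1 / (real n * y - 1))) = exp_cutoff 0 (real n * y - 1)" by (simp add: exp_cutoff_def)
    qed
  qed
  ultimately show ?thesis by (rule Lim_transform_eventually)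
qed

lemma bump_limit: "(\<lambda>n. bump a b n x) \<longlonglongrightarrow> indicator {a<..<b} x"
proof (cases "x \<in> {a<..<b}")
  case True
  then show ?thesis unfolding bump_def[abs_def]
    using tendsto_mult[OF exp_cutoff_limit exp_cutoff_limit, of "x - a" "b - x"] by simp
next
  case False
  then have "bump a b n x = 0" for n
    using mult_nonneg_nonpos[of "real n" "x - a"] mult_nonneg_nonpos[of "real n" "b - x"]
    by (cases "x \<le> a") (auto simp: bump_def exp_cutoff_def)
  then show ?thesis using False by simp
qed

section \<open>Weak derivatives of functions of one variable\<close>

text \<open>A Dynkin argument: the sets over which \<open>g\<close> integrates to zero are closed
  under complements and disjoint unions and contain the intersection-stable open intervals.
  Complements require the integral over the whole line, which is a limit over growing
  intervals.\<close>

lemma AE_eq_0_if_interval_integrals: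
  fixes g :: "real \<Rightarrow> real"
  assumes g: "integrable lborel g"
    and int: "\<And>a b. a < b \<Longrightarrow> (LINT x:{a<..<b}|lborel. g x) = 0"
  shows "AE x in lborel. g x = 0"
proof -
  note [measurable] = borel_measurable_integrable[OF g]
  have lim: "(\<lambda>n. LINT x:{- real n<..<real n}|lborel. g x) \<longlonglongrightarrow> (\<integral>x. g x \<partial>lborel)"
    unfolding set_lebesgue_integral_def
  proof (rule integral_dominated_convergence[where w="\<lambda>x. \<bar>g x\<bar>"])
    show "AE x in lborel. (\<lambda>n. indicat_real {- real n<..<real n} x *\<^sub>R g x) \<longlonglongrightarrow> g x"
    proof (rule AE_I2)
      fix x :: real
      obtain N where "\<bar>x\<bar> < real N" using reals_Archimedean2 by blast
      then show "(\<lambda>n. indicat_real {- real n<..<real n} x *\<^sub>R g x) \<longlonglongrightarrow> g x"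
        by (intro tendsto_eventually eventually_sequentiallyI[of N]) (auto simp: indicator_def)
    qed
  qed (use g in \<open>auto simp: indicator_def\<close>)
  have zero: "(LINT x:{- real n<..<real n}|lborel. g x) = 0" for n
    using int[of "- real n" "real n"] by (cases "n = 0") (auto simp: set_lebesgue_integral_def)
  have whole: "(\<integral>x. g x \<partial>lborel) = 0" using lim unfolding zero by (simp add: LIMSEQ_const_iff)
  show ?thesis
  proof (rule sigma_finite_measure.density_zero[OF sigma_finite_lborel g])
    fix A :: "real set" assume "A \<in> sets lborel"
    then have A: "A \<in> sigma_sets UNIV (range (\<lambda>(a, b). {a<..<b::real}))"
      by (simp add: borel_eq_box sets_measure_of)
    have stable: "Int_stable (range (\<lambda>(a, b). {a<..<b::real}))"
    proof (rule Int_stableI)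
      fix A B assume "A \<in> range (\<lambda>(a, b). {a<..<b::real})" "B \<in> range (\<lambda>(a, b). {a<..<b::real})"
      then obtain a b c d where "A = {a<..<b}" "B = {c<..<d}" by auto
      then have "A \<inter> B = (\<lambda>(a, b). {a<..<b}) (max a c, min b d)" by auto
      then show "A \<inter> B \<in> range (\<lambda>(a, b). {a<..<b::real})" by (rule range_eqI)
    qed
    from stable subset_Pow_Union[THEN subset_trans, OF Pow_mono[OF subset_UNIV]] A
    show "(LINT x:A|lborel. g x) = 0"
    proof (induction rule: sigma_sets_induct_disjoint)
      case (basic A)
      then obtain a b where "A = {a<..<b}" by auto
      then show ?case using int[of a b] by (cases "a < b") (auto simp: set_lebesgue_integral_def)
    next
      case (compl A)
      then have [measurable]: "A \<in> sets borel" by (simp add: borel_eq_box sets_measure_of)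
      have "(LINT x:UNIV - A|lborel. g x) = (\<integral>x. g x - indicator A x *\<^sub>R g x \<partial>lborel)"
        unfolding set_lebesgue_integral_def by (intro Bochner_Integration.integral_cong) (auto simp: indicator_def)
      also have "\<dots> = 0"
        using whole compl(2) integrable_mult_indicator[OF _ g, of A]
        by (subst Bochner_Integration.integral_diff[OF g]) (auto simp: set_lebesgue_integral_def)
      finally show ?case .
    next
      case (union A)
      then have [measurable]: "A i \<in> sets borel" for i by (auto simp: borel_eq_box sets_measure_of)
      have "(LINT x:(\<Union>i. A i)|lborel. g x) = (\<Sum>i. (LINT x:A i|lborel. g x))"
        using union(1) integrable_mult_indicator[OF _ g, of "\<Union>i. A i"]
        by (intro lebesgue_integral_countable_add) (auto simp: disjoint_family_on_def set_integrable_def)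
      then show ?case using union(3) by simp
    qed (auto simp: set_lebesgue_integral_def)
  qed
qed

text \<open>As a finite measure space of its own, \<open>(0, b)\<close> admits products, Fubini and
  dominated convergence without indicators in every integrand; the set integrals of the definitions
  are translated once below.\<close>

definition lebI :: "real \<Rightarrow> real measure" where
  "lebI b = restrict_space lborel {0<..<b}"

lemma space_lebI[simp]: "space (lebI b) = {0<..<b}"
  by (simp add: lebI_def space_restrict_space)

lemma measurable_lebI[measurable (raw)]: "f \<in> borel_measurable borel \<Longrightarrow> f \<in> borel_measurable (lebI b)"
  unfolding lebI_def by (simp add: measurable_restrict_space1)

lemma id_measurable_lebI[measurable]: "(\<lambda>x. x) \<in> lebI b \<rightarrow>\<^sub>M borel"
  by (rule measurable_lebI) simp

lemma finite_measure_lebI: "finite_measure (lebI b)"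
  unfolding lebI_def by (rule finite_measureI, cases "0 \<le> b") (auto simp: emeasure_restrict_space space_restrict_space)

lemma sigma_finite_lebI: "sigma_finite_measure (lebI b)"
  using finite_measure.axioms(1)[OF finite_measure_lebI] .

lemma pair_lebI: "pair_sigma_finite (lebI a) (lebI b)"
  by (simp add: pair_sigma_finite.intro sigma_finite_lebI)

lemma measure_lebI: "0 \<le> b \<Longrightarrow> measure (lebI b) {0<..<b} = b"
  unfolding lebI_def by (subst measure_restrict_space) auto

lemma AE_lebI: "(AE x in lebI b. P x) \<longleftrightarrow> (AE x in lborel. x \<in> {0<..<b} \<longrightarrow> P x)"
  unfolding lebI_def by (rule AE_restrict_space_iff) simp

lemma integrable_lebI:
  fixes f :: "real \<Rightarrow> 'a::{banach, second_countable_topology}"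
  shows "integrable (lebI b) f \<longleftrightarrow> set_integrable lborel {0<..<b} f"
  unfolding lebI_def set_integrable_def by (rule integrable_restrict_space) simp

lemma integral_lebI:
  fixes f :: "real \<Rightarrow> 'a::{banach, second_countable_topology}"
  shows "(\<integral>x. f x \<partial>lebI b) = (LINT x:{0<..<b}|lborel. f x)"
  unfolding lebI_def set_lebesgue_integral_def by (rule integral_restrict_space) simp

lemma measurable_lebI_iff:
  fixes f :: "real \<Rightarrow> 'a::real_normed_vector"
  shows "f \<in> borel_measurable (lebI b) \<longleftrightarrow> set_borel_measurable lborel {0<..<b} f"
  unfolding lebI_def set_borel_measurable_def by (rule borel_measurable_restrict_space_iff) simp

lemma continuous_measurable_lebI:
  fixes f :: "real \<Rightarrow> 'a::real_normed_vector"
  assumes "continuous_on {0..b} f"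
  shows "f \<in> borel_measurable (lebI b)"
proof -
  have "f \<in> borel_measurable (restrict_space borel {0<..<b})"
    by (rule borel_measurable_continuous_on_restrict, rule continuous_on_subset[OF assms]) auto
  then show ?thesis
    unfolding lebI_def using measurable_cong_sets[OF sets_restrict_space_cong[OF sets_lborel] refl] by blast
qed

lemma continuous_bounded_Icc:
  fixes f :: "real \<Rightarrow> 'a::real_normed_vector"
  assumes "continuous_on {0..b} f"
  obtains C where "0 \<le> C" "\<And>x. x \<in> {0..b} \<Longrightarrow> norm (f x) \<le> C"
proof -
  have "bounded (f ` {0..b})" using assms compact_continuous_image compact_imp_bounded by blast
  then obtain C where "\<And>x. x \<in> {0..b} \<Longrightarrow> norm (f x) \<le> C" unfolding bounded_iff by blast
  then have "\<And>x. x \<in> {0..b} \<Longrightarrow> norm (f x) \<le> max C 0" by (simp add: max.coboundedI1)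
  then show ?thesis by (intro that[of "max C 0"]) auto
qed

lemma integrable_lebI_mult_cont:
  fixes f :: "real \<Rightarrow> real" and g :: "real \<Rightarrow> 'a::{banach, second_countable_topology}"
  assumes "integrable (lebI b) g" "continuous_on {0..b} f"
  shows "integrable (lebI b) (\<lambda>x. f x *\<^sub>R g x)"
proof -
  obtain C where C: "0 \<le> C" "\<And>x. x \<in> {0..b} \<Longrightarrow> norm (f x) \<le> C" using continuous_bounded_Icc[OF assms(2)] by blast
  have [measurable]: "f \<in> borel_measurable (lebI b)" by (rule continuous_measurable_lebI[OF assms(2)])
  show ?thesis
    by (rule Bochner_Integration.integrable_bound[where f="\<lambda>x. C *\<^sub>R g x"])
      (use assms C in \<open>auto intro!: mult_right_mono\<close>)
qed

lemma integrable_lebI_cont: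
  fixes f :: "real \<Rightarrow> 'a::{banach, second_countable_topology}"
  assumes "continuous_on {0..b} f"
  shows "integrable (lebI b) f"
proof -
  obtain C where C: "\<And>x. x \<in> {0..b} \<Longrightarrow> norm (f x) \<le> C" using continuous_bounded_Icc[OF assms] by blast
  interpret finite_measure "lebI b" by (rule finite_measure_lebI)
  show ?thesis
  proof (rule integrable_const_bound[of _ C])
    show "AE x in lebI b. norm (f x) \<le> C" by (rule AE_I2) (simp add: C)
  qed (rule continuous_measurable_lebI[OF assms])
qed

lemma lebI_FTC:
  fixes f F :: "real \<Rightarrow> 'a::euclidean_space"
  assumes "0 \<le> b" "continuous_on {0..b} f" "\<And>x. x \<in> {0..b} \<Longrightarrow> (F has_vector_derivative f x) (at x within {0..b})"
  shows "(\<integral>x. f x \<partial>lebI b) = F b - F 0"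
  using interval_integral_FTC_finite[of 0 b f F] assms
  by (simp add: integral_lebI interval_lebesgue_integral_def)

lemma AE_eq_0_if_interval_integrals_lebI:
  fixes g :: "real \<Rightarrow> real"
  assumes g: "integrable (lebI T) g"
    and int: "\<And>a b. 0 \<le> a \<Longrightarrow> a < b \<Longrightarrow> b \<le> T \<Longrightarrow> (\<integral>x. indicator {a<..<b} x * g x \<partial>lebI T) = 0"
  shows "AE x in lebI T. g x = 0"
proof -
  have "AE x in lborel. indicator {0<..<T} x * g x = 0"
  proof (rule AE_eq_0_if_interval_integrals)
    show "integrable lborel (\<lambda>x. indicator {0<..<T} x * g x)"
      using g by (simp add: integrable_lebI set_integrable_def)
  next
    fix a b :: real assume "a < b"
    have "(LINT x:{a<..<b}|lborel. indicator {0<..<T} x * g x)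
        = (\<integral>x. indicator {max a 0<..<min b T} x * g x \<partial>lebI T)"
      unfolding integral_lebI set_lebesgue_integral_def
      by (intro Bochner_Integration.integral_cong) (auto simp: indicator_def)
    also have "\<dots> = 0"
      using int[of "max a 0" "min b T"] by (cases "max a 0 < min b T") auto
    finally show "(LINT x:{a<..<b}|lborel. indicator {0<..<T} x * g x) = 0" .
  qed
  then show ?thesis unfolding AE_lebI by eventually_elim (auto simp: indicator_def)
qed

text \<open>The primitive with base point 0 works for every \<open>x\<close>; the interval from
  \<open>- |x| - 1\<close> to \<open>|x| + 1\<close> contains both 0 and \<open>x\<close> in its
  interior.\<close>

lemma antiderivative_exists:
  fixes g :: "real \<Rightarrow> real"
  assumes g: "continuous_on UNIV g"
  obtains F where "\<And>x::real. (F has_real_derivative g x) (at x)"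
proof
  fix x :: real
  let ?a = "- \<bar>x\<bar> - 1" and ?b = "\<bar>x\<bar> + 1"
  have "((\<lambda>u. LBINT y=0..u. g y) has_vector_derivative g x) (at x within {?a..?b})"
    by (rule interval_integral_FTC2[where c=0, unfolded zero_ereal_def[symmetric]]) (use g continuous_on_subset in auto)
  moreover have "at x within {?a..?b} = at x" by (rule at_within_interior) auto
  ultimately show "((\<lambda>u. LBINT y=0..u. g y) has_real_derivative g x) (at x)"
    by (simp add: has_real_derivative_iff_has_vector_derivative)
qed

section \<open>Test functions in time and the lemma of du Bois-Reymond\<close>

lemma test_fun_D:
  assumes "time_test_fun T \<phi>"
  shows "smooth \<phi>" "\<And>t. t \<le> 0 \<Longrightarrow> \<phi> t = 0" "\<And>t. T \<le> t \<Longrightarrow> \<phi> t = 0"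
proof -
  obtain a b where ab: "smooth \<phi>" "0 < a" "b < T" "\<And>t. t \<notin> {a..b} \<Longrightarrow> \<phi> t = 0"
    using assms unfolding time_test_fun_def by blast
  show "smooth \<phi>" by (fact ab)
  show "\<phi> t = 0" if "t \<le> 0" for t using that ab by auto
  show "\<phi> t = 0" if "T \<le> t" for t using that ab by auto
qed

lemma test_fun_lincomb:
  assumes "time_test_fun T f" "time_test_fun T g"
  shows "time_test_fun T (\<lambda>t. f t + c * g t)"
proof -
  obtain a b where ab: "0 < a" "b < T" "\<And>t. t \<notin> {a..b} \<Longrightarrow> f t = 0" using assms(1) unfolding time_test_fun_def by blast
  obtain a' b' where ab': "0 < a'" "b' < T" "\<And>t. t \<notin> {a'..b'} \<Longrightarrow> g t = 0" using assms(2) unfolding time_test_fun_def by blast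
  let ?B = "{h. smooth h}"
  have "smooth (\<lambda>t. f t + c * g t)"
  proof (rule smooth_fun_alg[of ?B])
    show "(\<lambda>t. f t + c * g t) \<in> fun_alg ?B"
      using test_fun_D(1)[OF assms(1)] test_fun_D(1)[OF assms(2)]
      by (intro fun_alg.add fun_alg.mult fun_alg.const fun_alg.base) auto
    show "\<exists>g\<in>fun_alg ?B. \<forall>x. (f has_real_derivative g x) (at x)" if "f \<in> ?B" for f
      using that by (intro bexI[of _ "deriv f"]) (auto intro: smooth_has_deriv fun_alg.base smooth_deriv)
  qed
  moreover have "f t + c * g t = 0" if "t \<notin> {min a a'..max b b'}" for t
    using that ab(3)[of t] ab'(3)[of t] by (cases "t \<in> {a..b}"; cases "t \<in> {a'..b'}") auto
  moreover have "0 < min a a'" "max b b' < T" using ab ab' by auto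
  ultimately show ?thesis unfolding time_test_fun_def by blast
qed

lemma test_fun_deriv:
  assumes "time_test_fun T \<phi>" shows "time_test_fun T (deriv \<phi>)"
proof -
  obtain a b where ab: "0 < a" "b < T" "\<And>t. t \<notin> {a..b} \<Longrightarrow> \<phi> t = 0" using assms(1) unfolding time_test_fun_def by blast
  have "deriv \<phi> t = 0" if "t \<notin> {a..b}" for t
  proof (rule DERIV_imp_deriv)
    show "(\<phi> has_real_derivative 0) (at t)"
      by (rule has_field_derivative_transform_within_open[of "\<lambda>_. 0" _ _ "- {a..b}"]) (use that ab in auto)
  qed
  then show ?thesis using ab smooth_deriv test_fun_D(1)[OF assms] unfolding time_test_fun_def by blast
qed

text \<open>A primitive is constant on either side of the support of \<open>g\<close>, and the
  vanishing integral makes the two constants equal, so that subtracting one of them leaves a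
  compactly supported function.\<close>

lemma test_fun_antideriv:
  assumes "time_test_fun T g" and int: "(\<integral>t. g t \<partial>lebI T) = 0" and "0 < T"
  obtains \<phi> where "time_test_fun T \<phi>" "deriv \<phi> = g"
proof -
  obtain a b where ab: "0 < a" "b < T" "\<And>t. t \<notin> {a..b} \<Longrightarrow> g t = 0" using assms(1) unfolding time_test_fun_def by blast
  have sg: "smooth g" using test_fun_D(1)[OF assms(1)] .
  obtain F where F: "\<And>x. (F has_real_derivative g x) (at x)"
    using antiderivative_exists smooth_continuous[OF sg] by blast
  \<comment> \<open>The point 0 lies to the left of the support and \<open>T\<close> to the right,
    so this equates the two outer constants.\<close>
  have "F T - F 0 = 0"
    using int \<open>0 < T\<close> lebI_FTC[of T g F] smooth_continuous[OF sg] F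
    by (simp add: has_real_derivative_iff_has_vector_derivative has_vector_derivative_at_within)
  then have FT: "F T = F 0" by simp
  define \<phi> where "\<phi> = (\<lambda>x. F x - F 0)"
  have \<phi>: "(\<phi> has_real_derivative g x) (at x)" for x
    unfolding \<phi>_def by (auto intro!: derivative_eq_intros F)
  have left: "\<phi> t = 0" if "t < a" for t
  proof -
    have "(\<phi> has_real_derivative 0) (at x within {..<a})" if "x \<in> {..<a}" for x
      using that \<phi>[of x] ab(3)[of x] by (auto simp: has_field_derivative_at_within)
    then have "\<exists>c. \<forall>x\<in>{..<a}. \<phi> x = c"
      by (intro has_field_derivative_zero_constant) auto
    then show ?thesis using that ab(1) unfolding \<phi>_def by (metis diff_self lessThan_iff)
  qed
  have right: "\<phi> t = 0" if "b < t" for t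
  proof -
    have "(\<phi> has_real_derivative 0) (at x within {b<..})" if "x \<in> {b<..}" for x
      using that \<phi>[of x] ab(3)[of x] by (auto simp: has_field_derivative_at_within)
    then have "\<exists>c. \<forall>x\<in>{b<..}. \<phi> x = c"
      by (intro has_field_derivative_zero_constant) auto
    then show ?thesis using that ab(2) FT unfolding \<phi>_def by (metis diff_self greaterThan_iff)
  qed
  have "\<phi> t = 0" if "t \<notin> {a..b}" for t using that left right by fastforce
  then have "time_test_fun T \<phi>" unfolding time_test_fun_def
    using smooth_antideriv[OF sg \<phi>] ab by blast
  moreover have "deriv \<phi> = g" using \<phi> by (auto intro: DERIV_imp_deriv)
  ultimately show ?thesis by (rule that)
qed

lemma bump_integral_limit:
  fixes v :: "real \<Rightarrow> real"
  assumes "integrable (lebI T) v"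
  shows "(\<lambda>n. \<integral>t. bump a b n t * v t \<partial>lebI T) \<longlonglongrightarrow> (\<integral>t. indicator {a<..<b} t * v t \<partial>lebI T)"
proof -
  have [measurable]: "v \<in> borel_measurable (lebI T)" using assms by auto
  have [measurable]: "bump a b n \<in> borel_measurable borel" for n
    by (intro borel_measurable_continuous_onI smooth_continuous smooth_bump)
  show ?thesis
  proof (rule integral_dominated_convergence[where w="\<lambda>t. \<bar>v t\<bar>"])
    show "AE t in lebI T. (\<lambda>n. bump a b n t * v t) \<longlonglongrightarrow> indicator {a<..<b} t * v t"
      by (intro AE_I2 tendsto_mult bump_limit tendsto_const)
    show "AE t in lebI T. norm (bump a b n t * v t) \<le> \<bar>v t\<bar>" for n
      using bump_nonneg[of a b n] bump_le_1[of a b n] by (auto simp: abs_mult intro!: mult_left_le_one_le)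
  qed (use assms in auto)
qed

text \<open>Any bump becomes the derivative of a test function once a multiple of one fixed bump of
  positive integral is subtracted. Hence \<open>v - c\<close>, with \<open>c\<close> the average of
  \<open>v\<close> against the fixed bump, is orthogonal to all bumps, and in the limit to the
  indicators of all intervals.\<close>

lemma du_Bois_Reymond:
  fixes v :: "real \<Rightarrow> real"
  assumes T: "0 < T" and v: "integrable (lebI T) v"
    and weak: "\<And>\<phi>. time_test_fun T \<phi> \<Longrightarrow> (\<integral>t. deriv \<phi> t * v t \<partial>lebI T) = 0"
  shows "\<exists>c. AE t in lebI T. v t = c"
proof -
  interpret finite_measure "lebI T" by (rule finite_measure_lebI)
  have ibump: "integrable (lebI T) (\<lambda>t. bump a b n t * v t)" "integrable (lebI T) (bump a b n)" for a b n
    using integrable_lebI_mult_cont[OF v smooth_continuous[OF smooth_bump]]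
      integrable_lebI_cont[OF smooth_continuous[OF smooth_bump]] by auto
  have one: "integrable (lebI T) (\<lambda>_. 1 :: real)" by simp
  have "(\<lambda>n. \<integral>t. bump 0 T n t \<partial>lebI T) \<longlonglongrightarrow> (\<integral>t. indicator {0<..<T} t \<partial>lebI T)"
    using bump_integral_limit[OF one, of 0 T] by simp
  also have "(\<integral>t. indicator {0<..<T} t \<partial>lebI T) = (\<integral>t. (1::real) \<partial>lebI T)"
    by (intro Bochner_Integration.integral_cong) (auto simp: indicator_def)
  also have "\<dots> = T" using T by (simp add: measure_lebI)
  finally have "\<forall>\<^sub>F n in sequentially. 0 < (\<integral>t. bump 0 T n t \<partial>lebI T)"
    using T by (rule order_tendstoD(1))
  \<comment> \<open>For small \<open>n\<close> the bump on \<open>(0, T)\<close> vanishes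
    identically; a usable one exists because the integrals tend to \<open>T\<close>.\<close>
  then obtain k where k: "0 < (\<integral>t. bump 0 T k t \<partial>lebI T)" "0 < k"
    using eventually_conj[OF _ eventually_gt_at_top[of 0]] eventually_happens[OF eventually_conj[OF _ eventually_gt_at_top[of 0]]]
    by fastforce
  define I where "I = (\<integral>t. bump 0 T k t \<partial>lebI T)"
  define c where "c = (\<integral>t. bump 0 T k t * v t \<partial>lebI T) / I"
  have key: "(\<integral>t. indicator {a<..<b} t * (v t - c) \<partial>lebI T) = 0" if ab: "0 \<le> a" "a < b" "b \<le> T" for a b
  proof -
    have "(\<integral>t. bump a b n t * (v t - c) \<partial>lebI T) = 0" if n: "0 < n" for n
    proof -
      \<comment> \<open>The coefficient \<open>- J / I\<close> is chosen to give \<open>g\<close>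
        the integral zero.\<close>
      define J where "J = (\<integral>t. bump a b n t \<partial>lebI T)"
      define g where "g = (\<lambda>t. bump a b n t + (- J / I) * bump 0 T k t)"
      have "time_test_fun T g" unfolding g_def
        by (intro test_fun_lincomb bump_test) (use ab n k T in auto)
      moreover have "(\<integral>t. g t \<partial>lebI T) = 0"
        unfolding g_def using ibump(2) k(1)
        by (subst Bochner_Integration.integral_add) (auto simp: J_def I_def)
      ultimately obtain \<phi> where "time_test_fun T \<phi>" "deriv \<phi> = g" using test_fun_antideriv T by blast
      then have "(\<integral>t. g t * v t \<partial>lebI T) = 0" using weak by blast
      moreover have "(\<integral>t. g t * v t \<partial>lebI T)
          = (\<integral>t. bump a b n t * v t \<partial>lebI T) + (- J / I) * (\<integral>t. bump 0 T k t * v t \<partial>lebI T)"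
        unfolding g_def distrib_right mult.assoc using ibump
        by (subst Bochner_Integration.integral_add) auto
      moreover have "(\<integral>t. bump a b n t * (v t - c) \<partial>lebI T) = (\<integral>t. bump a b n t * v t \<partial>lebI T) - J * c"
        unfolding right_diff_distrib J_def using ibump
        by (subst Bochner_Integration.integral_diff) auto
      ultimately show ?thesis by (simp add: c_def)
    qed
    then have "\<forall>\<^sub>F n in sequentially. (\<integral>t. bump a b n t * (v t - c) \<partial>lebI T) = 0"
      by (intro eventually_sequentiallyI[of 1]) auto
    moreover have "(\<lambda>n. \<integral>t. bump a b n t * (v t - c) \<partial>lebI T) \<longlonglongrightarrow> (\<integral>t. indicator {a<..<b} t * (v t - c) \<partial>lebI T)"
      by (rule bump_integral_limit) (use v in auto)
    ultimately have "(\<lambda>n. 0) \<longlonglongrightarrow> (\<integral>t. indicator {a<..<b} t * (v t - c) \<partial>lebI T)"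
      by (blast intro: Lim_transform_eventually)
    then show ?thesis by (simp add: LIMSEQ_const_iff)
  qed
  have "AE t in lebI T. v t - c = 0"
    by (rule AE_eq_0_if_interval_integrals_lebI) (use v key in auto)
  then show ?thesis by (intro exI[of _ c]) auto
qed

lemma integrable_pair_mult_bounded:
  fixes f :: "'a \<Rightarrow> real" and k :: "'a \<times> 'b \<Rightarrow> real"
  assumes M: "sigma_finite_measure M1" "finite_measure M2"
    and f: "integrable M1 f" and k[measurable]: "k \<in> borel_measurable (M1 \<Otimes>\<^sub>M M2)"
    and C: "\<And>x y. x \<in> space M1 \<Longrightarrow> y \<in> space M2 \<Longrightarrow> \<bar>k (x, y)\<bar> \<le> C"
  shows "integrable (M1 \<Otimes>\<^sub>M M2) (\<lambda>(x, y). f x * k (x, y))"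
proof -
  interpret M1: sigma_finite_measure M1 by fact
  interpret M2: finite_measure M2 by fact
  interpret pair_sigma_finite M1 M2 ..
  note [measurable] = borel_measurable_integrable[OF f]
  have "integrable (M1 \<Otimes>\<^sub>M M2) (\<lambda>(x, y). C * f x)"
    by (rule Fubini_integrable) (use f in \<open>auto simp: abs_mult\<close>)
  then show ?thesis
  proof (rule Bochner_Integration.integrable_bound)
    show "AE p in M1 \<Otimes>\<^sub>M M2. norm (case p of (x, y) \<Rightarrow> f x * k (x, y)) \<le> norm (case p of (x, y) \<Rightarrow> C * f x)"
    proof (rule AE_I2)
      fix p assume "p \<in> space (M1 \<Otimes>\<^sub>M M2)"
      then obtain x y where p: "p = (x, y)" "x \<in> space M1" "y \<in> space M2" by (auto simp: space_pair_measure)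
      have "\<bar>f x\<bar> * \<bar>k (x, y)\<bar> \<le> \<bar>f x\<bar> * \<bar>C\<bar>"
        using C[OF p(2,3)] by (intro mult_left_mono) auto
      then show "norm (case p of (x, y) \<Rightarrow> f x * k (x, y)) \<le> norm (case p of (x, y) \<Rightarrow> C * f x)"
        by (simp add: p abs_mult mult.commute)
    qed
  qed measurable
qed

text \<open>The primitive \<open>G\<close> of \<open>a'\<close> is only absolutely continuous;
  Fubini over the triangle \<open>s < t\<close> replaces integration by parts and shows that
  \<open>a'\<close> is its weak derivative. Then \<open>a - G\<close> has weak derivative
  zero.\<close>

lemma weak_deriv_imp_antiderivative:
  fixes a a' :: "real \<Rightarrow> real"
  assumes T: "0 < T" and a: "integrable (lebI T) a" and a': "integrable (lebI T) a'"
    and weak: "\<And>\<phi>. time_test_fun T \<phi> \<Longrightarrow> (\<integral>t. deriv \<phi> t * a t \<partial>lebI T) = - (\<integral>t. \<phi> t * a' t \<partial>lebI T)"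
  shows "\<exists>c. AE t in lebI T. a t = c + (\<integral>s. indicator {0<..<t} s * a' s \<partial>lebI T)"
proof -
  interpret pair_sigma_finite "lebI T" "lebI T" by (rule pair_lebI)
  note [measurable] = borel_measurable_integrable[OF a] borel_measurable_integrable[OF a']
  define G where "G t = (\<integral>s. indicator {0<..<t} s * a' s \<partial>lebI T)" for t
  have [measurable]: "Measurable.pred (lebI T \<Otimes>\<^sub>M lebI T) (\<lambda>p. fst p < snd p)" by measurable
  have meas1: "(\<lambda>p. indicator {0<..<snd p} (fst p) :: real) \<in> borel_measurable (lebI T \<Otimes>\<^sub>M lebI T)"
    unfolding indicator_def greaterThanLessThan_iff by measurable
  have G1: "integrable (lebI T) G"
  proof -
    have "integrable (lebI T \<Otimes>\<^sub>M lebI T) (\<lambda>(s, t). a' s * indicator {0<..<t} s)"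
      using integrable_pair_mult_bounded[OF sigma_finite_lebI finite_measure_lebI a' meas1, where C=1]
      by (simp add: case_prod_beta' indicator_le_1)
    then have "integrable (lebI T) (\<lambda>t. \<integral>s. a' s * indicator {0<..<t} s \<partial>lebI T)" by (rule integrable_snd)
    then show ?thesis unfolding G_def[abs_def] by (simp add: mult.commute)
  qed
  have parts: "(\<integral>t. deriv \<phi> t * G t \<partial>lebI T) = - (\<integral>t. \<phi> t * a' t \<partial>lebI T)" if \<phi>: "time_test_fun T \<phi>" for \<phi>
  proof -
    have sm: "smooth \<phi>" using test_fun_D(1)[OF \<phi>] .
    have cont: "continuous_on UNIV (deriv \<phi>)" by (intro smooth_continuous smooth_deriv sm)
    have [measurable]: "deriv \<phi> \<in> borel_measurable borel" by (intro borel_measurable_continuous_onI cont)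
    obtain C where C: "0 \<le> C" "\<And>x. x \<in> {0..T} \<Longrightarrow> norm (deriv \<phi> x) \<le> C"
      using continuous_bounded_Icc[OF continuous_on_subset[OF cont]] by blast
    let ?f = "\<lambda>s t. a' s * (indicator {0<..<t} s * deriv \<phi> t)"
    have int: "integrable (lebI T \<Otimes>\<^sub>M lebI T) (\<lambda>(s, t). ?f s t)"
    proof -
      have m: "(\<lambda>p. indicator {0<..<snd p} (fst p) * deriv \<phi> (snd p)) \<in> borel_measurable (lebI T \<Otimes>\<^sub>M lebI T)"
        using meas1 by measurable
      show ?thesis
        using integrable_pair_mult_bounded[OF sigma_finite_lebI finite_measure_lebI a' m, where C=C] C
        by (auto simp: case_prod_beta' indicator_def)
    qed
    \<comment> \<open>The integral of \<open>deriv \<phi>\<close> from \<open>s\<close> to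
      \<open>T\<close>; the boundary term at \<open>T\<close> vanishes by the support of
      \<open>\<phi>\<close>.\<close>
    have inner: "(\<integral>t. indicator {0<..<t} s * deriv \<phi> t \<partial>lebI T) = - \<phi> s" if s: "s \<in> {0<..<T}" for s
    proof -
      have "(\<integral>t. indicator {0<..<t} s * deriv \<phi> t \<partial>lebI T) = (LINT t:{s<..<T}|lborel. deriv \<phi> t)"
        unfolding integral_lebI set_lebesgue_integral_def
        by (intro Bochner_Integration.integral_cong) (use s in \<open>auto simp: indicator_def\<close>)
      also have "\<dots> = (LBINT t=s..T. deriv \<phi> t)" using s by (simp add: interval_lebesgue_integral_def)
      also have "\<dots> = \<phi> T - \<phi> s"
        by (rule interval_integral_FTC_finite)
          (use smooth_has_deriv[OF sm] in \<open>auto intro: continuous_on_subset[OF cont] has_vector_derivative_at_within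
            simp: has_real_derivative_iff_has_vector_derivative\<close>)
      finally show ?thesis using test_fun_D(3)[OF \<phi>, of T] by simp
    qed
    have "(\<integral>t. deriv \<phi> t * G t \<partial>lebI T) = (\<integral>t. (\<integral>s. ?f s t \<partial>lebI T) \<partial>lebI T)"
      unfolding G_def integral_mult_right_zero[symmetric]
      by (intro Bochner_Integration.integral_cong refl) (simp add: mult_ac)
    also have "\<dots> = (\<integral>s. (\<integral>t. ?f s t \<partial>lebI T) \<partial>lebI T)" by (rule Fubini_integral[OF int])
    also have "\<dots> = (\<integral>s. - (\<phi> s * a' s) \<partial>lebI T)"
      using inner by (intro Bochner_Integration.integral_cong) auto
    finally show ?thesis by simp
  qed
  have "\<exists>c. AE t in lebI T. a t - G t = c"
  proof (rule du_Bois_Reymond[OF T])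
    fix \<phi> assume \<phi>: "time_test_fun T \<phi>"
    have cont: "continuous_on {0..T} (deriv \<phi>)" by (intro smooth_continuous smooth_deriv test_fun_D(1)[OF \<phi>])
    have "(\<integral>t. deriv \<phi> t * (a t - G t) \<partial>lebI T) = (\<integral>t. deriv \<phi> t * a t \<partial>lebI T) - (\<integral>t. deriv \<phi> t * G t \<partial>lebI T)"
      unfolding right_diff_distrib
      using integrable_lebI_mult_cont[OF a cont] integrable_lebI_mult_cont[OF G1 cont]
      by (subst Bochner_Integration.integral_diff) auto
    then show "(\<integral>t. deriv \<phi> t * (a t - G t) \<partial>lebI T) = 0" using weak[OF \<phi>] parts[OF \<phi>] by simp
  qed (use a G1 in auto)
  then obtain c where "AE t in lebI T. a t - G t = c" by blast
  then show ?thesis unfolding G_def by (intro exI[of _ c]) (auto elim: eventually_mono)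
qed

text \<open>The passage from Bochner integrals, in which the weak formulation lives, to gauge
  integrals over \<open>{0..t}\<close>, in which the rules for indefinite integrals and subintervals
  are used.\<close>

lemma integral_lebI_indicator:
  fixes g :: "real \<Rightarrow> 'a::euclidean_space"
  assumes g: "integrable (lebI T) g" and t: "t \<le> T"
  shows "(\<integral>s. indicator {0<..<t} s *\<^sub>R g s \<partial>lebI T) = integral {0..t} g" "g integrable_on {0..t}"
proof -
  have si: "set_integrable lborel {0<..<t} g"
    by (rule set_integrable_subset[of _ "{0<..<T}"]) (use g t in \<open>auto simp: integrable_lebI\<close>)
  have "(\<integral>s. indicator {0<..<t} s *\<^sub>R g s \<partial>lebI T) = (LINT s:{0<..<t}|lborel. g s)"
    unfolding integral_lebI set_lebesgue_integral_def
    by (intro Bochner_Integration.integral_cong) (use t in \<open>auto simp: indicator_def\<close>)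
  also have "\<dots> = integral {0<..<t} g" using set_borel_integral_eq_integral(2)[OF si] .
  also have "\<dots> = integral {0..t} g" by (simp add: integral_open_interval_real)
  finally show "(\<integral>s. indicator {0<..<t} s *\<^sub>R g s \<partial>lebI T) = integral {0..t} g" .
  show "g integrable_on {0..t}"
    using set_borel_integral_eq_integral(1)[OF si] by (simp add: integrable_on_open_interval_real)
qed

lemma AE_lebI_imp_integral_cong:
  fixes f g :: "real \<Rightarrow> 'a::euclidean_space"
  assumes "integrable (lebI T) f" "integrable (lebI T) g" "AE t in lebI T. f t = g t" "t \<le> T"
  shows "integral {0..t} f = integral {0..t} g"
  unfolding integral_lebI_indicator(1)[OF assms(1,4), symmetric] integral_lebI_indicator(1)[OF assms(2,4), symmetric]
proof (rule integral_cong_AE)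
  have [measurable]: "f \<in> borel_measurable (lebI T)" "g \<in> borel_measurable (lebI T)" using assms by auto
  show "(\<lambda>s. indicat_real {0<..<t} s *\<^sub>R f s) \<in> borel_measurable (lebI T)"
    "(\<lambda>s. indicat_real {0<..<t} s *\<^sub>R g s) \<in> borel_measurable (lebI T)" by measurable
qed (use assms(3) in auto)

lemma weak_deriv_imp_antiderivative_complex:
  fixes a a' :: "real \<Rightarrow> complex"
  assumes T: "0 < T" and a: "integrable (lebI T) a" and a': "integrable (lebI T) a'"
    and weak: "\<And>\<phi>. time_test_fun T \<phi> \<Longrightarrow> (\<integral>t. deriv \<phi> t *\<^sub>R a t \<partial>lebI T) = - (\<integral>t. \<phi> t *\<^sub>R a' t \<partial>lebI T)"
  shows "\<exists>c. AE t in lebI T. a t = c + integral {0..t} a'"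
proof -
  have int: "integrable (lebI T) (\<lambda>t. deriv \<phi> t *\<^sub>R a t)" "integrable (lebI T) (\<lambda>t. \<phi> t *\<^sub>R a' t)"
    if "time_test_fun T \<phi>" for \<phi>
    using test_fun_D(1)[OF that]
    by (auto intro!: integrable_lebI_mult_cont[OF a] integrable_lebI_mult_cont[OF a'] smooth_continuous smooth_deriv)
  have "\<exists>c. AE t in lebI T. Re (a t) = c + (\<integral>s. indicator {0<..<t} s * Re (a' s) \<partial>lebI T)"
  proof (rule weak_deriv_imp_antiderivative[OF T])
    fix \<phi> assume \<phi>: "time_test_fun T \<phi>"
    show "(\<integral>t. deriv \<phi> t * Re (a t) \<partial>lebI T) = - (\<integral>t. \<phi> t * Re (a' t) \<partial>lebI T)"
      using arg_cong[OF weak[OF \<phi>], of Re] integral_Re[OF int(1)[OF \<phi>]] integral_Re[OF int(2)[OF \<phi>]] by simp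
  qed (use a a' in auto)
  then obtain c where c: "AE t in lebI T. Re (a t) = c + (\<integral>s. indicator {0<..<t} s * Re (a' s) \<partial>lebI T)" by blast
  have "\<exists>c. AE t in lebI T. Im (a t) = c + (\<integral>s. indicator {0<..<t} s * Im (a' s) \<partial>lebI T)"
  proof (rule weak_deriv_imp_antiderivative[OF T])
    fix \<phi> assume \<phi>: "time_test_fun T \<phi>"
    show "(\<integral>t. deriv \<phi> t * Im (a t) \<partial>lebI T) = - (\<integral>t. \<phi> t * Im (a' t) \<partial>lebI T)"
      using arg_cong[OF weak[OF \<phi>], of Im] integral_Im[OF int(1)[OF \<phi>]] integral_Im[OF int(2)[OF \<phi>]] by simp
  qed (use a a' in auto)
  then obtain d where d: "AE t in lebI T. Im (a t) = d + (\<integral>s. indicator {0<..<t} s * Im (a' s) \<partial>lebI T)" by blast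
  have sp: "AE t in lebI T. t \<in> {0<..<T}" by (rule AE_I2) simp
  have "AE t in lebI T. a t = Complex c d + integral {0..t} a'"
    using c d sp
  proof eventually_elim
    case (elim t)
    then have t: "t \<le> T" by simp
    have "integral {0..t} a' = (\<integral>s. indicator {0<..<t} s *\<^sub>R a' s \<partial>lebI T)"
      using integral_lebI_indicator(1)[OF a' t] by simp
    moreover have "integrable (lebI T) (\<lambda>s. indicat_real {0<..<t} s *\<^sub>R a' s)"
      by (rule Bochner_Integration.integrable_bound[OF a']) (use a' in \<open>auto simp: indicator_def\<close>)
    ultimately show ?case using elim integral_Re[of "lebI T" "\<lambda>s. indicat_real {0<..<t} s *\<^sub>R a' s"]
        integral_Im[of "lebI T" "\<lambda>s. indicat_real {0<..<t} s *\<^sub>R a' s"] by (simp add: complex_eq_iff)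
  qed
  then show ?thesis by blast
qed

text \<open>Each \<open>a j\<close> has as representative \<open>f j\<close> a primitive of
  \<open>a (Suc j)\<close>. Below the top level the integrand agrees almost everywhere with the
  continuous \<open>f (Suc j)\<close>, so that the primitive is differentiable everywhere. The last
  function \<open>f (n - 1)\<close> remains just a primitive of the integrable
  \<open>a n\<close>.\<close>

lemma weak_derivs_imp_classical:
  fixes a :: "nat \<Rightarrow> real \<Rightarrow> complex"
  assumes T: "0 < T" and a: "\<And>j. j \<le> n \<Longrightarrow> integrable (lebI T) (a j)"
    and weak: "\<And>j \<phi>. j < n \<Longrightarrow> time_test_fun T \<phi> \<Longrightarrow>
      (\<integral>t. deriv \<phi> t *\<^sub>R a j t \<partial>lebI T) = - (\<integral>t. \<phi> t *\<^sub>R a (Suc j) t \<partial>lebI T)"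
  obtains f :: "nat \<Rightarrow> real \<Rightarrow> complex" where
    "\<And>j. j < n \<Longrightarrow> AE t in lebI T. a j t = f j t"
    "\<And>j. j < n \<Longrightarrow> continuous_on {0..T} (f j)"
    "\<And>j t. Suc j < n \<Longrightarrow> t \<in> {0..T} \<Longrightarrow> (f j has_vector_derivative f (Suc j) t) (at t within {0..T})"
    "\<And>j t. j < n \<Longrightarrow> t \<in> {0..T} \<Longrightarrow> f j t = f j 0 + integral {0..t} (a (Suc j))"
proof -
  have "\<forall>j\<in>{..<n}. \<exists>c. AE t in lebI T. a j t = c + integral {0..t} (a (Suc j))"
    using weak_deriv_imp_antiderivative_complex[OF T] a weak by simp
  then obtain c where c: "\<And>j. j < n \<Longrightarrow> AE t in lebI T. a j t = c j + integral {0..t} (a (Suc j))"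
    by (metis lessThan_iff)
  define f where "f j t = c j + integral {0..t} (a (Suc j))" for j t
  have cont: "continuous_on {0..T} (f j)" if "j < n" for j
    unfolding f_def[abs_def]
    by (intro continuous_intros indefinite_integral_continuous_1 integral_lebI_indicator(2)[of T]) (use a that in auto)
  have AE: "AE t in lebI T. a j t = f j t" if "j < n" for j using c[OF that] by (simp add: f_def)
  have f0: "f j 0 = c j" for j by (simp add: f_def)
  have der: "(f j has_vector_derivative f (Suc j) t) (at t within {0..T})" if j: "Suc j < n" and t: "t \<in> {0..T}" for j t
  proof -
    have eq: "f j s = c j + integral {0..s} (f (Suc j))" if s: "s \<in> {0..T}" for s
    proof -
      have "integral {0..s} (a (Suc j)) = integral {0..s} (f (Suc j))"
        by (rule AE_lebI_imp_integral_cong[OF a integrable_lebI_cont[OF cont] AE]) (use j s in auto)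
      then show ?thesis by (simp add: f_def[of j s])
    qed
    have "((\<lambda>s. integral {0..s} (f (Suc j))) has_vector_derivative f (Suc j) t) (at t within {0..T})"
      by (rule integral_has_vector_derivative[OF cont[OF j] t])
    then have "((\<lambda>s. c j + integral {0..s} (f (Suc j))) has_vector_derivative f (Suc j) t) (at t within {0..T})"
      by (auto intro!: derivative_eq_intros)
    then show ?thesis
      by (rule has_vector_derivative_transform[rotated 2]) (use t eq in auto)
  qed
  show ?thesis using that[of f] AE cont der f0 by (auto simp: f_def)
qed

text \<open>The set of agreement is closed, and dense because no null set contains an interval. This
  upgrades almost-everywhere identities in time to all grid times, end points included.\<close>

lemma AE_lebI_continuous_imp_eq:
  fixes f g :: "real \<Rightarrow> 'a::real_normed_vector"
  assumes T: "0 < T" and f: "continuous_on {0..T} f" and g: "continuous_on {0..T} g"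
    and AE: "AE t in lebI T. f t = g t" and t: "t \<in> {0..T}"
  shows "f t = g t"
proof -
  have dense: "\<exists>s\<in>{a<..<b}. f s = g s" if ab: "0 \<le> a" "a < b" "b \<le> T" for a b
  proof (rule ccontr)
    assume *: "\<not> ?thesis"
    have "AE s in lborel. s \<notin> {a<..<b}"
      using AE unfolding AE_lebI by eventually_elim (use * ab in auto)
    then have "{a<..<b} \<in> null_sets lborel" by (simp add: AE_iff_null_sets)
    then show False using ab by (auto simp: null_sets_def)
  qed
  have "closedin (top_of_set {0..T}) {t \<in> {0..T}. f t - g t = 0}"
    by (rule continuous_closedin_preimage_constant) (intro continuous_intros f g)
  then have "closed {t \<in> {0..T}. f t - g t = 0}" by (rule closedin_closed_trans) simp
  moreover have "t \<in> closure {t \<in> {0..T}. f t - g t = 0}"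
  proof (subst closure_approachable, intro allI impI)
    fix e :: real assume e: "0 < e"
    define a b where "a = max 0 (t - e)" and "b = min T (t + e)"
    have "0 \<le> a" "a < b" "b \<le> T" using t T e by (auto simp: a_def b_def)
    then obtain s where "s \<in> {a<..<b}" "f s = g s" using dense by blast
    then show "\<exists>s\<in>{t \<in> {0..T}. f t - g t = 0}. dist s t < e"
      by (intro bexI[of _ s]) (auto simp: a_def b_def dist_real_def)
  qed
  ultimately show ?thesis by (simp add: closure_closed)
qed

section \<open>Trigonometric polynomials and weighted absolute sums of coefficients\<close>

lemma mode_add: "fourier_mode L (k + l) x = fourier_mode L k x * fourier_mode L l x"
  by (simp add: fourier_mode_def exp_add[symmetric] distrib_left distrib_right add_divide_distrib)

lemma mode_0[simp]: "fourier_mode L 0 x = 1"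
  by (simp add: fourier_mode_def)

lemma mode_eq_cis: "fourier_mode L l x = cis (2 * pi * of_int l * x / L)"
  unfolding fourier_mode_def cis_conv_exp by (simp add: mult_ac)

lemma norm_mode[simp]: "norm (fourier_mode L l x) = 1"
  by (simp add: mode_eq_cis)

lemma cnj_mode[simp]: "cnj (fourier_mode L l x) = fourier_mode L (- l) x"
  by (simp add: mode_eq_cis cis_cnj)

lemma continuous_on_mode[continuous_intros]: "continuous_on A (fourier_mode L l)"
  unfolding fourier_mode_def[abs_def] divide_inverse by (intro continuous_intros)

lemma mode_deriv:
  "(fourier_mode L l has_vector_derivative (\<i> * of_real (2 * pi * of_int l / L)) * fourier_mode L l x) (at x within A)"
proof -
  have "((\<lambda>z. exp (2 * pi * \<i> * of_int l * z / of_real L)) has_field_derivative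
      (\<i> * of_real (2 * pi * of_int l / L)) * fourier_mode L l x) (at (of_real x))"
    unfolding fourier_mode_def divide_inverse by (auto intro!: derivative_eq_intros simp: mult_ac)
  then show ?thesis
    unfolding fourier_mode_def[abs_def]
    by (rule has_vector_derivative_real_field[THEN has_vector_derivative_at_within])
qed

lemma mode_periodic: "L \<noteq> 0 \<Longrightarrow> fourier_mode L l (x + L) = fourier_mode L l x"
proof -
  assume L: "L \<noteq> 0"
  have "2 * pi * of_int l * (x + L) / L = 2 * pi * of_int l * x / L + 2 * pi * of_int l"
    using L by (simp add: field_simps)
  then show ?thesis unfolding mode_eq_cis
    by (simp add: cis_mult[symmetric] cis_multiple_2pi)
qed

definition freq :: "real \<Rightarrow> int \<Rightarrow> real" where
  "freq L l = 2 * pi * of_int l / L"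

lemma integral_mode:
  assumes "0 < L"
  shows "(\<integral>x. fourier_mode L l x \<partial>lebI L) = (if l = 0 then of_real L else 0)"
proof (cases "l = 0")
  case True
  have "(\<integral>x. (1::complex) \<partial>lebI L) = of_real L"
    using assms by (simp add: measure_lebI scaleR_conv_of_real)
  then show ?thesis using True by simp
next
  case False
  let ?c = "\<i> * of_real (2 * pi * of_int l / L) :: complex"
  have c: "?c \<noteq> 0" using False assms by simp
  have "(\<integral>x. fourier_mode L l x \<partial>lebI L) = fourier_mode L l L / ?c - fourier_mode L l 0 / ?c"
  proof (rule lebI_FTC)
    show "((\<lambda>x. fourier_mode L l x / ?c) has_vector_derivative fourier_mode L l x) (at x within {0..L})" for x
      using has_vector_derivative_divide[OF mode_deriv[of L l x "{0..L}"], of ?c] c by simp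
  qed (use assms in \<open>auto intro: continuous_on_mode\<close>)
  also have "fourier_mode L l L = fourier_mode L l 0" using mode_periodic[of L l 0] assms by simp
  finally show ?thesis using False by simp
qed

text \<open>\<open>wiener L s B f\<close>: \<open>f\<close> is a trigonometric polynomial whose coefficients have a weighted \<open>\<ell>\<^sup>1\<close> norm
  of at most \<open>B\<close>.\<close>

inductive wiener :: "real \<Rightarrow> nat \<Rightarrow> real \<Rightarrow> (real \<Rightarrow> complex) \<Rightarrow> bool" for L s where
  zero: "wiener L s 0 (\<lambda>x. 0)"
| add_mode: "wiener L s B f \<Longrightarrow> wiener L s (B + norm c * (1 + \<bar>of_int l\<bar>) ^ s) (\<lambda>x. f x + c * fourier_mode L l x)"
| mono: "wiener L s B f \<Longrightarrow> B \<le> C \<Longrightarrow> wiener L s C f"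

lemma wiener_nonneg: "wiener L s B f \<Longrightarrow> 0 \<le> B"
  by (induction rule: wiener.induct) auto

lemma wiener_continuous: "wiener L s B f \<Longrightarrow> continuous_on A f"
  by (induction rule: wiener.induct) (auto intro!: continuous_intros)

lemma wiener_norm_le: "wiener L s B f \<Longrightarrow> norm (f x) \<le> B"
proof (induction rule: wiener.induct)
  case (add_mode B f c l)
  have "norm (f x + c * fourier_mode L l x) \<le> norm (f x) + norm c * 1"
    by (rule norm_triangle_le) (simp add: norm_mult)
  also have "\<dots> \<le> B + norm c * (1 + \<bar>of_int l\<bar>) ^ s"
    by (intro add_mono add_mode.IH mult_left_mono one_le_power) auto
  finally show ?case .
qed auto

lemma wiener_order_mono:
  assumes "wiener L s B f" "r \<le> s"
  shows "wiener L r B f"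
  using assms(1)
proof (induction rule: wiener.induct)
  case (add_mode B f c l)
  show ?case
    by (rule wiener.mono[OF wiener.add_mode[OF add_mode.IH, of c l]])
      (use assms(2) in \<open>auto intro!: mult_left_mono power_increasing\<close>)
qed (auto intro: wiener.zero wiener.mono)

lemma wiener_add:
  assumes "wiener L s B f" "wiener L s C g"
  shows "wiener L s (B + C) (\<lambda>x. f x + g x)"
  using assms(2)
proof (induction rule: wiener.induct)
  case (add_mode C g c l)
  then show ?case using wiener.add_mode[OF add_mode.IH, of c l] by (simp add: add.assoc)
next
  case (mono C g D)
  then show ?case using wiener.mono[OF mono.IH, of "B + D"] by simp
qed (use assms in simp)

lemma weight_submult: "(1 + \<bar>real_of_int (l + k)\<bar>) ^ s \<le> (1 + \<bar>of_int l\<bar>) ^ s * (1 + \<bar>of_int k\<bar>) ^ s"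
  unfolding power_mult_distrib[symmetric]
proof (rule power_mono)
  have "\<bar>of_int (l + k)\<bar> \<le> \<bar>of_int l :: real\<bar> + \<bar>of_int k\<bar>" by simp
  moreover have "0 \<le> \<bar>of_int l :: real\<bar> * \<bar>of_int k\<bar>" by simp
  ultimately show "(1 + \<bar>of_int (l + k)\<bar> :: real) \<le> (1 + \<bar>of_int l\<bar>) * (1 + \<bar>of_int k\<bar>)"
    unfolding distrib_left distrib_right mult_1_right mult_1_left by linarith
qed simp

lemma wiener_mult_mode:
  assumes "wiener L s B f"
  shows "wiener L s (norm c * (1 + \<bar>of_int l\<bar>) ^ s * B) (\<lambda>x. c * fourier_mode L l x * f x)"
  using assms
proof (induction rule: wiener.induct)
  case zero
  show ?case using wiener.zero by simp
next
  case (add_mode B f d k)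
  note w = weight_submult[of l k s]
  have "norm (c * d) * (1 + \<bar>of_int (l + k)\<bar>) ^ s
      \<le> norm c * norm d * ((1 + \<bar>of_int l\<bar>) ^ s * (1 + \<bar>of_int k\<bar>) ^ s)"
    unfolding norm_mult by (intro mult_left_mono w) auto
  then have "norm c * (1 + \<bar>of_int l\<bar>) ^ s * B + norm (c * d) * (1 + \<bar>of_int (l + k)\<bar>) ^ s
      \<le> norm c * (1 + \<bar>of_int l\<bar>) ^ s * (B + norm d * (1 + \<bar>of_int k\<bar>) ^ s)"
    by (simp add: algebra_simps)
  from wiener.mono[OF wiener.add_mode[OF add_mode.IH, of "c * d" "l + k"] this]
  show ?case by (simp add: mode_add algebra_simps)
next
  case (mono B f C)
  show ?case by (rule wiener.mono[OF mono.IH]) (use mono in \<open>auto intro!: mult_left_mono\<close>)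
qed

lemma wiener_mode: "wiener L s (norm c * (1 + \<bar>of_int l\<bar>) ^ s) (\<lambda>x. c * fourier_mode L l x)"
  using wiener.add_mode[OF wiener.zero, of L s c l] by simp

lemma wiener_const: "wiener L s (norm c) (\<lambda>x. c)"
  using wiener_mode[of L s c 0] by simp

text \<open>Multiplication by a single mode shifts the coefficients and, as the weight is
  submultiplicative, costs at most the weight of that mode; the induction sums these costs over the
  modes of \<open>f\<close>.\<close>

lemma wiener_mult:
  assumes "wiener L s B f" "wiener L s C g"
  shows "wiener L s (B * C) (\<lambda>x. f x * g x)"
  using assms(1)
proof (induction rule: wiener.induct)
  case zero
  show ?case using wiener.zero by simp
next
  case (add_mode B f c l)
  show ?case
    using wiener_add[OF add_mode.IH wiener_mult_mode[OF assms(2), of c l]] by (simp add: algebra_simps)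
next
  case (mono B f D)
  show ?case
    by (rule wiener.mono[OF mono.IH]) (use mono wiener_nonneg[OF assms(2)] in \<open>auto intro!: mult_right_mono\<close>)
qed

lemma wiener_scale: "wiener L s B f \<Longrightarrow> wiener L s (norm c * B) (\<lambda>x. c * f x)"
  using wiener_mult[OF wiener_const] .

lemma wiener_diff:
  assumes "wiener L s B f" "wiener L s C g"
  shows "wiener L s (B + C) (\<lambda>x. f x - g x)"
  using wiener_add[OF assms(1) wiener_scale[OF assms(2), of "- 1"]] by simp

lemma wiener_power: "wiener L s B f \<Longrightarrow> wiener L s (B ^ n) (\<lambda>x. f x ^ n)"
proof (induction n)
  case 0
  show ?case using wiener_const[of L s 1] by simp
next
  case (Suc n)
  then show ?case using wiener_mult[of L s B f "B ^ n"] by simp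
qed

lemma wiener_sum:
  "finite S \<Longrightarrow> wiener L s (\<Sum>l\<in>S. norm (c l) * (1 + \<bar>of_int l\<bar>) ^ s) (\<lambda>x. \<Sum>l\<in>S. c l * fourier_mode L l x)"
proof (induction rule: finite_induct)
  case empty
  show ?case using wiener.zero by simp
next
  case (insert l S)
  then show ?case using wiener.add_mode[OF insert.IH, of "c l" l] by (simp add: add.commute)
qed

text \<open>Estimates for projection and interpolation are thereby reduced to one exponential at a
  time. Additivity is demanded only for adding a mode to a continuous function, a form in which
  integrability is automatic.\<close>

lemma wiener_functional_bound:
  fixes \<Lambda> :: "(real \<Rightarrow> complex) \<Rightarrow> complex"
  assumes "wiener L s B f"
    and add: "\<And>f c l. continuous_on UNIV f \<Longrightarrow>
      \<Lambda> (\<lambda>x. f x + c * fourier_mode L l x) = \<Lambda> f + c * \<Lambda> (fourier_mode L l)"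
    and mode: "\<And>l. norm (\<Lambda> (fourier_mode L l)) \<le> C * (1 + \<bar>of_int l\<bar>) ^ s"
  shows "norm (\<Lambda> f) \<le> C * B"
proof -
  have C: "0 \<le> C" using norm_ge_zero order_trans[OF _ mode[of 0]] by fastforce
  show ?thesis using assms(1)
  proof (induction rule: wiener.induct)
    case zero
    \<comment> \<open>The value at the zero function comes from writing it as a mode minus
      itself.\<close>
    have "\<Lambda> (\<lambda>x. fourier_mode L 0 x + (- 1) * fourier_mode L 0 x) = \<Lambda> (fourier_mode L 0) + (- 1) * \<Lambda> (fourier_mode L 0)"
      by (rule add) (rule continuous_on_mode)
    then have "\<Lambda> (\<lambda>x. 0) = 0" by simp
    then show ?case by simp
  next
    case (add_mode B f c l)
    have "norm (\<Lambda> (\<lambda>x. f x + c * fourier_mode L l x)) \<le> norm (\<Lambda> f) + norm c * norm (\<Lambda> (fourier_mode L l))"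
      by (simp only: add wiener_continuous[OF add_mode.hyps] norm_mult[symmetric] norm_triangle_ineq)
    also have "\<dots> \<le> C * B + norm c * (C * (1 + \<bar>of_int l\<bar>) ^ s)"
      by (intro add_mono add_mode.IH mult_left_mono mode) simp
    finally show ?case by (simp add: algebra_simps)
  next
    case (mono B f D)
    then show ?case using C by (meson mult_left_mono order_trans)
  qed
qed

text \<open>Induction on \<open>X^(n+1) - Y^(n+1) = X (X^n - Y^n) + (X - Y) Y^n\<close>; since
  \<open>1 \<le> R\<close>, lower powers of \<open>R\<close> are absorbed into the highest.\<close>

lemma wiener_power_diff:
  assumes X: "wiener L s R X" and Y: "wiener L s R Y" and D: "wiener L s D (\<lambda>x. X x - Y x)" and R: "1 \<le> R"
  shows "wiener L s (real n * R ^ n * D) (\<lambda>x. X x ^ n - Y x ^ n)"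
proof (induction n)
  case 0
  show ?case using wiener.zero by simp
next
  case (Suc n)
  have "wiener L s (R * (real n * R ^ n * D) + D * R ^ n) (\<lambda>x. X x * (X x ^ n - Y x ^ n) + (X x - Y x) * Y x ^ n)"
    by (intro wiener_add wiener_mult X D Suc wiener_power Y)
  moreover have "R * (real n * R ^ n * D) + D * R ^ n \<le> real (Suc n) * R ^ Suc n * D"
    using R wiener_nonneg[OF D] mult_right_mono[of 1 R "D * R ^ n"] by (simp add: algebra_simps)
  ultimately show ?case by (auto intro: wiener.mono simp: algebra_simps)
qed

section \<open>Trigonometric interpolation\<close>

lemma mode_grid_power:
  assumes "L \<noteq> 0"
  shows "fourier_mode L l (grid_point L N j) = cis (2 * pi * of_int l / (2 * real N + 1)) ^ j"
proof -
  define M where "M = 2 * real N + 1"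
  have "M > 0" by (simp add: M_def)
  then have "2 * pi * of_int l * (real j * (L / M)) / L = real j * (2 * pi * of_int l / M)"
    using assms by (simp add: field_simps)
  then show ?thesis unfolding mode_eq_cis grid_point_def Complex.DeMoivre M_def by simp
qed

text \<open>A geometric series in a root of unity of order dividing \<open>2 N + 1\<close>, which
  equals 1 exactly when \<open>2 N + 1\<close> divides \<open>l\<close>. This is the source of
  aliasing.\<close>

lemma sum_mode_grid:
  assumes L: "L \<noteq> 0"
  shows "(\<Sum>j\<le>2 * N. fourier_mode L l (grid_point L N j)) = (if (2 * int N + 1) dvd l then of_nat (2 * N + 1) else 0)"
proof -
  let ?M = "2 * real N + 1"
  define z where "z = cis (2 * pi * of_int l / ?M)"
  have M: "?M > 0" by simp
  have zM: "z ^ (2 * N + 1) = 1"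
  proof -
    have "real (2 * N + 1) * (2 * pi * of_int l / ?M) = 2 * pi * of_int l" by (simp add: field_simps)
    then have "z ^ (2 * N + 1) = cis (2 * pi * of_int l)" unfolding z_def Complex.DeMoivre by (rule arg_cong)
    then show ?thesis by (simp add: cis_multiple_2pi)
  qed
  have z1: "z = 1 \<longleftrightarrow> (2 * int N + 1) dvd l"
  proof
    assume "z = 1"
    then have "cos (2 * pi * of_int l / ?M) = 1" unfolding z_def by (simp add: complex_eq_iff)
    then obtain k :: int where "2 * pi * of_int l / ?M = of_int k * 2 * pi"
      using cos_one_2pi_int by blast
    then have "2 * pi * of_int l = 2 * pi * (of_int k * ?M)" using M by (simp add: field_simps)
    then have "real_of_int l = of_int k * ?M" by (simp only: mult_cancel_left) simp
    then have "real_of_int l = of_int (k * (2 * int N + 1))" by simp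
    then have "l = k * (2 * int N + 1)" by (simp only: of_int_eq_iff)
    then show "(2 * int N + 1) dvd l" by simp
  next
    assume "(2 * int N + 1) dvd l"
    then obtain k where "l = (2 * int N + 1) * k" by (auto elim: dvdE)
    then have "2 * pi * of_int l / ?M = 2 * pi * of_int k" using M by simp
    then show "z = 1" unfolding z_def by (simp add: cis_multiple_2pi)
  qed
  have "(\<Sum>j\<le>2 * N. fourier_mode L l (grid_point L N j)) = (\<Sum>j<2 * N + 1. z ^ j)"
    by (simp add: mode_grid_power[OF L] z_def lessThan_Suc_atMost)
  also have "\<dots> = (if (2 * int N + 1) dvd l then of_nat (2 * N + 1) else 0)"
  proof -
    have "(\<Sum>j<n. z ^ j) = (if z = 1 then of_nat n else (z ^ n - 1) / (z - 1))" for n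
      by (simp add: geometric_sum)
    from this[of "2 * N + 1"] show ?thesis unfolding zM z1 by simp
  qed
  finally show ?thesis .
qed

text \<open>The dual orthogonality, summed over frequencies instead of grid points. Shifting the
  frequency by \<open>N\<close> turns it, up to a factor of modulus one, into a grid sum of the mode
  \<open>i - j\<close>.\<close>

lemma sum_mode_grid_diff:
  assumes "L \<noteq> 0" "i \<le> 2 * N" "j \<le> 2 * N"
  shows "(\<Sum>l = - int N..int N. fourier_mode L l (grid_point L N i) * fourier_mode L (- l) (grid_point L N j))
    = (if i = j then of_nat (2 * N + 1) else 0)"
proof -
  let ?d = "int i - int j"
  define M where "M = 2 * real N + 1"
  have M: "M > 0" by (simp add: M_def)
  have "2 * pi * of_int l * (real i * (L / M)) / L + 2 * pi * of_int (- l) * (real j * (L / M)) / L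
      = 2 * pi * of_int l * of_int ?d / M" for l
    using assms(1) M by (simp add: field_simps)
  then have "(\<Sum>l = - int N..int N. fourier_mode L l (grid_point L N i) * fourier_mode L (- l) (grid_point L N j))
    = (\<Sum>l = - int N..int N. cis (2 * pi * of_int l * of_int ?d / M))"
    unfolding mode_eq_cis cis_mult grid_point_def M_def by simp
  also have "\<dots> = (\<Sum>k\<le>2 * N. cis (2 * pi * of_int (int k - int N) * of_int ?d / M))"
    by (rule sum.reindex_bij_witness[of _ "\<lambda>k. int k - int N" "\<lambda>l. nat (l + int N)"]) auto
  also have "\<dots> = (\<Sum>k\<le>2 * N. cis (- 2 * pi * real N * of_int ?d / M) * fourier_mode L ?d (grid_point L N k))"
  proof (intro sum.cong refl)
    fix k
    have "2 * pi * of_int (int k - int N) * of_int ?d / M = - 2 * pi * real N * of_int ?d / M + 2 * pi * of_int ?d * (real k * (L / M)) / L"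
      using assms(1) M by (simp add: field_simps)
    then show "cis (2 * pi * of_int (int k - int N) * of_int ?d / M) = cis (- 2 * pi * real N * of_int ?d / M) * fourier_mode L ?d (grid_point L N k)"
      unfolding mode_eq_cis cis_mult grid_point_def M_def by simp
  qed
  also have "\<dots> = cis (- 2 * pi * real N * of_int ?d / M) * (if (2 * int N + 1) dvd ?d then of_nat (2 * N + 1) else 0)"
    unfolding sum_distrib_left[symmetric] sum_mode_grid[OF assms(1)] ..
  also have "\<dots> = (if i = j then of_nat (2 * N + 1) else 0)"
  proof (cases "i = j")
    case False
    then have "\<not> (2 * int N + 1) dvd ?d" using assms(2,3) zdvd_not_zless[of "\<bar>?d\<bar>" "2 * int N + 1"] by auto
    then show ?thesis using False by simp
  qed simp
  finally show ?thesis .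
qed

section \<open>The discrete Fourier transform on the grid\<close>

definition discrete_coeff :: "real \<Rightarrow> nat \<Rightarrow> (nat \<Rightarrow> complex) \<Rightarrow> int \<Rightarrow> complex" where
  "discrete_coeff L N f l = (\<Sum>j\<le>2 * N. f j * fourier_mode L (- l) (grid_point L N j)) / of_nat (2 * N + 1)"

lemma discrete_coeff_cong:
  "(\<And>j. j \<le> 2 * N \<Longrightarrow> f j = g j) \<Longrightarrow> discrete_coeff L N f l = discrete_coeff L N g l"
  unfolding discrete_coeff_def by simp

lemma discrete_coeff_add:
  "discrete_coeff L N (\<lambda>j. f j + g j) l = discrete_coeff L N f l + discrete_coeff L N g l"
  by (simp add: discrete_coeff_def sum.distrib distrib_right add_divide_distrib)

lemma discrete_coeff_mult: "discrete_coeff L N (\<lambda>j. c * f j) l = c * discrete_coeff L N f l"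
  by (simp add: discrete_coeff_def sum_distrib_left mult.assoc)

lemma discrete_coeff_sum:
  "discrete_coeff L N (\<lambda>j. \<Sum>k\<in>S. f k j) l = (\<Sum>k\<in>S. discrete_coeff L N (f k) l)"
  unfolding discrete_coeff_def sum_distrib_right sum_divide_distrib by (rule sum.swap)

lemma discrete_coeff_mode:
  assumes "L \<noteq> 0"
  shows "discrete_coeff L N (\<lambda>j. fourier_mode L k (grid_point L N j)) l = (if (2 * int N + 1) dvd (k - l) then 1 else 0)"
proof -
  have "(of_nat (2 * N + 1) :: complex) \<noteq> 0" unfolding of_nat_eq_0_iff by simp
  then show ?thesis
    unfolding discrete_coeff_def mode_add[symmetric] diff_conv_add_uminus[symmetric] sum_mode_grid[OF assms] by simp
qed

text \<open>Two degrees of modulus at most \<open>N\<close> differ by less than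
  \<open>2 N + 1\<close>, so distinct ones are told apart by the grid.\<close>

lemma dvd_mode_diff_iff:
  "\<bar>k\<bar> \<le> int N \<Longrightarrow> \<bar>l\<bar> \<le> int N \<Longrightarrow> (2 * int N + 1) dvd (k - l) \<longleftrightarrow> k = l"
  using zdvd_not_zless[of "\<bar>k - l\<bar>" "2 * int N + 1"] by (cases "k = l") auto

lemma discrete_coeff_trig:
  assumes "L \<noteq> 0" "\<bar>l\<bar> \<le> int N"
  shows "discrete_coeff L N (\<lambda>j. \<Sum>k = - int N..int N. c k * fourier_mode L k (grid_point L N j)) l = c l"
proof -
  have "discrete_coeff L N (\<lambda>j. \<Sum>k = - int N..int N. c k * fourier_mode L k (grid_point L N j)) l
    = (\<Sum>k = - int N..int N. c k * (if (2 * int N + 1) dvd (k - l) then 1 else 0))"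
    unfolding discrete_coeff_sum discrete_coeff_mult discrete_coeff_mode[OF assms(1)] ..
  also have "\<dots> = (\<Sum>k = - int N..int N. if k = l then c k else 0)"
    by (intro sum.cong refl) (use assms(2) dvd_mode_diff_iff[of _ N l] in auto)
  also have "\<dots> = c l" using assms(2) by (simp add: abs_le_iff)
  finally show ?thesis .
qed

lemma discrete_inversion:
  assumes "L \<noteq> 0" "i \<le> 2 * N"
  shows "(\<Sum>l = - int N..int N. discrete_coeff L N f l * fourier_mode L l (grid_point L N i)) = f i"
proof -
  have n: "(of_nat (2 * N + 1) :: complex) \<noteq> 0" unfolding of_nat_eq_0_iff by simp
  have "(\<Sum>l = - int N..int N. discrete_coeff L N f l * fourier_mode L l (grid_point L N i))
    = (\<Sum>l = - int N..int N. \<Sum>j\<le>2 * N. f j * (fourier_mode L l (grid_point L N i) * fourier_mode L (- l) (grid_point L N j)) / of_nat (2 * N + 1))"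
    unfolding discrete_coeff_def sum_divide_distrib sum_distrib_right
    by (intro sum.cong refl) (simp only: times_divide_eq_left times_divide_eq_right mult_ac)
  also have "\<dots> = (\<Sum>j\<le>2 * N. \<Sum>l = - int N..int N. f j * (fourier_mode L l (grid_point L N i) * fourier_mode L (- l) (grid_point L N j)) / of_nat (2 * N + 1))"
    by (rule sum.swap)
  also have "\<dots> = (\<Sum>j\<le>2 * N. f j * (if i = j then of_nat (2 * N + 1) else 0) / of_nat (2 * N + 1))"
    by (intro sum.cong refl) (simp only: sum_divide_distrib[symmetric] sum_distrib_left[symmetric] sum_mode_grid_diff[OF assms] atMost_iff)
  also have "\<dots> = (\<Sum>j\<le>2 * N. if i = j then f j else 0)"
    by (intro sum.cong refl) (use n in auto)
  also have "\<dots> = f i" using assms(2) by simp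
  finally show ?thesis .
qed

text \<open>Expanding only the conjugated factor leaves, for each mode, the discrete coefficient of
  the other factor, which is exact for polynomials of degree \<open>N\<close>. The left side has the
  shape of the squared discrete norm.\<close>

lemma discrete_Parseval:
  assumes L: "L \<noteq> 0"
  shows "(\<Sum>j\<le>2 * N. (norm (\<Sum>l = - int N..int N. c l * fourier_mode L l (grid_point L N j)))\<^sup>2) / real (2 * N + 1)
    = (\<Sum>l = - int N..int N. (norm (c l))\<^sup>2)"
proof -
  let ?g = "\<lambda>j. \<Sum>l = - int N..int N. c l * fourier_mode L l (grid_point L N j)"
  have "complex_of_real ((\<Sum>j\<le>2 * N. (norm (?g j))\<^sup>2) / real (2 * N + 1))
     = (\<Sum>j\<le>2 * N. ?g j * (\<Sum>l = - int N..int N. cnj (c l) * fourier_mode L (- l) (grid_point L N j))) / of_nat (2 * N + 1)"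
    by (simp add: complex_norm_square del: of_nat_add of_nat_mult of_nat_Suc of_real_power)
  also have "\<dots> = (\<Sum>l = - int N..int N. cnj (c l) * discrete_coeff L N ?g l)"
    unfolding discrete_coeff_def sum_divide_distrib sum_distrib_left by (subst sum.swap) (simp add: mult_ac)
  also have "\<dots> = (\<Sum>l = - int N..int N. cnj (c l) * c l)"
    by (intro sum.cong refl arg_cong2[where f="(*)"] discrete_coeff_trig L) auto
  also have "\<dots> = complex_of_real (\<Sum>l = - int N..int N. (norm (c l))\<^sup>2)"
    by (simp add: complex_norm_square mult.commute del: of_real_power)
  finally show ?thesis unfolding of_real_eq_iff .
qed

lemma sum_mode_real:
  assumes "\<And>l. c (- l) = cnj (c l)"
  shows "complex_of_real (Re (\<Sum>l = - int N..int N. c l * fourier_mode L l x)) = (\<Sum>l = - int N..int N. c l * fourier_mode L l x)"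
proof -
  have "cnj (\<Sum>l = - int N..int N. c l * fourier_mode L l x) = (\<Sum>l = - int N..int N. c (- l) * fourier_mode L (- l) x)"
    by (simp add: assms)
  also have "\<dots> = (\<Sum>l = - int N..int N. c l * fourier_mode L l x)"
    by (rule sum.reindex_bij_witness[of _ uminus uminus]) auto
  finally have "(\<Sum>l = - int N..int N. c l * fourier_mode L l x) \<in> \<real>" by (simp only: Reals_cnj_iff)
  then show ?thesis by (rule of_real_Re)
qed

lemma discrete_coeff_cnj: "discrete_coeff L N (\<lambda>j. complex_of_real (f j)) (- l) = cnj (discrete_coeff L N (\<lambda>j. complex_of_real (f j)) l)"
  by (simp add: discrete_coeff_def)

text \<open>This resolves the definite description: discrete inversion provides an interpolant, and
  the coefficients of any interpolant can be read off from its grid values. It is real because the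
  coefficients of real data are conjugate symmetric.\<close>

lemma trig_interp_eq:
  assumes L: "L \<noteq> 0"
  shows "complex_of_real (trig_interp L N f x) = (\<Sum>l = - int N..int N. discrete_coeff L N (\<lambda>j. complex_of_real (f j)) l * fourier_mode L l x)"
proof -
  let ?c = "discrete_coeff L N (\<lambda>j. complex_of_real (f j))"
  define g where "g x = Re (\<Sum>l = - int N..int N. ?c l * fourier_mode L l x)" for x
  have g: "complex_of_real (g x) = (\<Sum>l = - int N..int N. ?c l * fourier_mode L l x)" for x
    unfolding g_def by (rule sum_mode_real) (rule discrete_coeff_cnj)
  have gt: "g \<in> trig_poly L N" unfolding trig_poly_def using g by blast
  have gi: "g (grid_point L N i) = f i" if "i \<le> 2 * N" for i
    unfolding g_def using discrete_inversion[OF L that, of "\<lambda>j. complex_of_real (f j)"] by simp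
  have uniq: "h = g" if h: "h \<in> trig_poly L N" and hi: "\<forall>i\<le>2 * N. h (grid_point L N i) = f i" for h
  proof -
    obtain d where d: "\<And>x. complex_of_real (h x) = (\<Sum>l = - int N..int N. d l * fourier_mode L l x)"
      using h unfolding trig_poly_def by blast
    have "d l = ?c l" if "\<bar>l\<bar> \<le> int N" for l
    proof -
      have "?c l = discrete_coeff L N (\<lambda>j. \<Sum>l = - int N..int N. d l * fourier_mode L l (grid_point L N j)) l"
        by (rule discrete_coeff_cong) (use hi d in metis)
      then show ?thesis using discrete_coeff_trig[OF L that, of d] by simp
    qed
    then have "complex_of_real (h x) = complex_of_real (g x)" for x
      unfolding d g by (intro sum.cong) auto
    then show ?thesis by (auto simp: fun_eq_iff)
  qed
  have "trig_interp L N f = g"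
    unfolding trig_interp_def
  proof (rule the_equality)
    show "g \<in> trig_poly L N \<and> (\<forall>i\<le>2 * N. g (grid_point L N i) = f i)" using gt gi by blast
  qed (blast intro: uniq)
  then show ?thesis using g by simp
qed

lemma discrete_deriv_eq:
  assumes L: "L \<noteq> 0"
  shows "complex_of_real (discrete_deriv L N f i) = (\<Sum>l = - int N..int N. \<i> * of_real (freq L l) *
    discrete_coeff L N (\<lambda>j. complex_of_real (f j)) l * fourier_mode L l (grid_point L N i))"
proof -
  let ?c = "discrete_coeff L N (\<lambda>j. complex_of_real (f j))"
  let ?x = "grid_point L N i"
  let ?s = "(\<Sum>l = - int N..int N. \<i> * of_real (freq L l) * ?c l * fourier_mode L l ?x)"
  have "((\<lambda>x. \<Sum>l = - int N..int N. ?c l * fourier_mode L l x) has_vector_derivative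
      (\<Sum>l = - int N..int N. ?c l * ((\<i> * of_real (2 * pi * of_int l / L)) * fourier_mode L l ?x))) (at ?x)"
    by (intro has_vector_derivative_sum has_vector_derivative_mult_right mode_deriv)
  then have "((\<lambda>x. complex_of_real (trig_interp L N f x)) has_vector_derivative ?s) (at ?x)"
    unfolding trig_interp_eq[OF L] freq_def by (simp add: mult_ac)
  then have der: "((\<lambda>x. Re (complex_of_real (trig_interp L N f x))) has_vector_derivative Re ?s) (at ?x)"
    by (rule bounded_linear.has_vector_derivative[OF bounded_linear_Re])
  have "discrete_deriv L N f i = Re ?s"
    unfolding discrete_deriv_def
    by (rule DERIV_imp_deriv) (use der in \<open>simp add: has_real_derivative_iff_has_vector_derivative\<close>)
  moreover have "complex_of_real (Re ?s) = ?s"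
    by (rule sum_mode_real) (simp add: discrete_coeff_cnj freq_def)
  ultimately show ?thesis by simp
qed

text \<open>The values of \<open>discrete_deriv\<close> are the grid values of a polynomial of
  degree \<open>N\<close>, hence re-interpolating between two applications loses nothing and the
  powers act as exact multipliers.\<close>

lemma discrete_coeff_deriv_funpow:
  assumes L: "L \<noteq> 0" and l: "\<bar>l\<bar> \<le> int N"
  shows "discrete_coeff L N (\<lambda>j. complex_of_real ((discrete_deriv L N ^^ k) f j)) l =
    (\<i> * of_real (freq L l)) ^ k * discrete_coeff L N (\<lambda>j. complex_of_real (f j)) l"
proof (induction k)
  case (Suc k)
  have "discrete_coeff L N (\<lambda>j. complex_of_real ((discrete_deriv L N ^^ Suc k) f j)) l
    = \<i> * of_real (freq L l) * discrete_coeff L N (\<lambda>j. complex_of_real ((discrete_deriv L N ^^ k) f j)) l"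
    unfolding funpow.simps comp_def discrete_deriv_eq[OF L] by (rule discrete_coeff_trig[OF L l])
  then show ?case using Suc by simp
qed simp

lemma discrete_deriv_funpow_eq:
  assumes L: "L \<noteq> 0" and i: "i \<le> 2 * N"
  shows "complex_of_real ((discrete_deriv L N ^^ k) f i) = (\<Sum>l = - int N..int N. (\<i> * of_real (freq L l)) ^ k *
    discrete_coeff L N (\<lambda>j. complex_of_real (f j)) l * fourier_mode L l (grid_point L N i))"
proof -
  have "complex_of_real ((discrete_deriv L N ^^ k) f i) = (\<Sum>l = - int N..int N.
     discrete_coeff L N (\<lambda>j. complex_of_real ((discrete_deriv L N ^^ k) f j)) l * fourier_mode L l (grid_point L N i))"
    using discrete_inversion[OF L i] by simp
  also have "\<dots> = (\<Sum>l = - int N..int N. (\<i> * of_real (freq L l)) ^ k *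
    discrete_coeff L N (\<lambda>j. complex_of_real (f j)) l * fourier_mode L l (grid_point L N i))"
    by (intro sum.cong refl, subst discrete_coeff_deriv_funpow[OF L]) auto
  finally show ?thesis .
qed

section \<open>Completeness of the Fourier modes\<close>

lemma wiener_integrable: "wiener L s B g \<Longrightarrow> integrable (lebI b) g"
  by (intro integrable_lebI_cont wiener_continuous)

lemma integrable_mult_wiener:
  fixes f :: "real \<Rightarrow> real"
  assumes f: "integrable (lebI b) f" and g: "wiener L s B g"
  shows "integrable (lebI b) (\<lambda>x. of_real (f x) * g x)"
proof (rule Bochner_Integration.integrable_bound[where f="\<lambda>x. B * f x"])
  have [measurable]: "g \<in> borel_measurable (lebI b)" using wiener_integrable[OF g] by auto
  have [measurable]: "f \<in> borel_measurable (lebI b)" using f by auto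
  show "(\<lambda>x. of_real (f x) * g x) \<in> borel_measurable (lebI b)" by measurable
  show "AE x in lebI b. norm (of_real (f x) * g x) \<le> norm (B * f x)"
    using wiener_norm_le[OF g] wiener_nonneg[OF g]
    by (intro AE_I2) (auto simp: norm_mult abs_mult mult.commute[of B] intro!: mult_left_mono)
qed (use f in simp)

lemma orthogonal_wiener:
  fixes f :: "real \<Rightarrow> real"
  assumes f: "integrable (lebI b) f" and orth: "\<And>l. (\<integral>x. of_real (f x) * fourier_mode L l x \<partial>lebI b) = 0"
    and g: "wiener L s B g"
  shows "(\<integral>x. of_real (f x) * g x \<partial>lebI b) = 0"
  using g
proof (induction rule: wiener.induct)
  case (add_mode B g c l)
  have "(\<integral>x. of_real (f x) * (g x + c * fourier_mode L l x) \<partial>lebI b)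
     = (\<integral>x. of_real (f x) * g x + c * (of_real (f x) * fourier_mode L l x) \<partial>lebI b)"
    by (simp add: algebra_simps)
  also have "\<dots> = (\<integral>x. of_real (f x) * g x \<partial>lebI b) + c * (\<integral>x. of_real (f x) * fourier_mode L l x \<partial>lebI b)"
    using integrable_mult_wiener[OF f add_mode.hyps] integrable_mult_wiener[OF f wiener_mode[of L s 1 l]]
    by (subst Bochner_Integration.integral_add) auto
  finally show ?case using add_mode orth by simp
qed auto

text \<open>Each factor has period \<open>2 L\<close>, but the product formula leaves a constant and
  a cosine of period \<open>L\<close>, that is, modes of degree at most one.\<close>

lemma wiener_sin_product:
  assumes L: "0 < L"
  shows "\<exists>B. wiener L 0 B (\<lambda>x. complex_of_real (sin (pi * (x - a) / L) * sin (pi * (b - x) / L)))"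
proof -
  define c where "c = cis (- (pi * (a + b) / L)) / 4"
  have "complex_of_real (sin (pi * (x - a) / L) * sin (pi * (b - x) / L))
     = c * fourier_mode L 1 x + cnj c * fourier_mode L (- 1) x + complex_of_real (- cos (pi * (b - a) / L) / 2)" for x
  proof -
    let ?y = "2 * pi * x / L - pi * (a + b) / L"
    have "pi * (x - a) / L - pi * (b - x) / L = ?y" "pi * (x - a) / L + pi * (b - x) / L = pi * (b - a) / L"
      using L by (simp_all add: field_simps)
    then have "sin (pi * (x - a) / L) * sin (pi * (b - x) / L) = (cos ?y - cos (pi * (b - a) / L)) / 2"
      unfolding sin_times_sin by simp
    moreover have "c * fourier_mode L 1 x + cnj c * fourier_mode L (- 1) x = complex_of_real (cos ?y / 2)"
    proof -
      have z: "c * fourier_mode L 1 x = cis ?y / 4"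
        by (simp add: c_def mode_eq_cis cis_mult algebra_simps)
      have "cnj c * fourier_mode L (- 1) x = cnj (c * fourier_mode L 1 x)" by simp
      then show ?thesis unfolding z complex_add_cnj by (simp add: complex_eq_iff)
    qed
    ultimately show ?thesis by (simp add: diff_divide_distrib)
  qed
  moreover have "\<exists>B. wiener L 0 B (\<lambda>x. c * fourier_mode L 1 x + cnj c * fourier_mode L (- 1) x + complex_of_real (- cos (pi * (b - a) / L) / 2))"
    using wiener_add[OF wiener_add[OF wiener_mode wiener_mode] wiener_const] by blast
  ultimately show ?thesis by simp
qed

lemma wiener_polynomial:
  fixes P q :: "real \<Rightarrow> real"
  assumes "real_polynomial_function P" and q: "wiener L 0 C (\<lambda>x. complex_of_real (q x))"
  shows "\<exists>B. wiener L 0 B (\<lambda>x. complex_of_real (P (q x)))"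
  using assms(1)
proof induction
  case (linear h)
  interpret bounded_linear h by fact
  have h: "h y = y * h 1" for y using scale[of y 1] by simp
  have "(\<lambda>x. complex_of_real (h (q x))) = (\<lambda>x. complex_of_real (h 1) * complex_of_real (q x))"
    by (rule ext, subst h, simp)
  then show ?case using wiener_scale[OF q, of "complex_of_real (h 1)"] by auto
next
  case (const c)
  show ?case using wiener_const by blast
next
  case (add f g)
  then obtain B C where "wiener L 0 B (\<lambda>x. complex_of_real (f (q x)))" "wiener L 0 C (\<lambda>x. complex_of_real (g (q x)))"
    by blast
  from wiener_add[OF this] show ?case unfolding of_real_add by blast
next
  case (mult f g)
  then obtain B C where "wiener L 0 B (\<lambda>x. complex_of_real (f (q x)))" "wiener L 0 C (\<lambda>x. complex_of_real (g (q x)))"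
    by blast
  from wiener_mult[OF this] show ?case unfolding of_real_mult by blast
qed

text \<open>The arguments stay strictly between \<open>- pi\<close> and \<open>pi\<close>, so each
  sine has the sign of its argument; to the left and to the right of \<open>[a, b]\<close> exactly
  one factor is negative.\<close>

lemma sin_product_pos_iff:
  assumes L: "0 < L" and ab: "0 \<le> a" "a < b" "b \<le> L" and x: "0 < x" "x < L"
  shows "0 < sin (pi * (x - a) / L) * sin (pi * (b - x) / L) \<longleftrightarrow> x \<in> {a<..<b}"
proof -
  have sgn: "0 < sin (pi * y / L)" if "0 < y" "y < L" for y
    using that L by (intro sin_gt_zero) (auto simp: field_simps)
  have neg: "sin (pi * y / L) < 0" if "y < 0" "- L < y" for y
    using sgn[of "- y"] that by simp
  consider "x < a" | "x = a" | "a < x" "x < b" | "x = b" | "b < x" by linarith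
  then show ?thesis
  proof cases
    case 1
    then have "sin (pi * (x - a) / L) < 0" "0 < sin (pi * (b - x) / L)" using ab x by (auto intro!: sgn neg)
    then show ?thesis using 1 mult_neg_pos by fastforce
  next
    case 3
    then have "0 < sin (pi * (x - a) / L)" "0 < sin (pi * (b - x) / L)" using ab x by (auto intro!: sgn neg)
    then show ?thesis using 3 by simp
  next
    case 5
    then have "0 < sin (pi * (x - a) / L)" "sin (pi * (b - x) / L) < 0" using ab x by (auto intro!: sgn neg)
    then show ?thesis using 5 mult_pos_neg by fastforce
  qed auto
qed

text \<open>The function \<open>q\<close> is a trigonometric polynomial that is positive exactly on
  \<open>(a, b)\<close>. Polynomials in \<open>q\<close> are trigonometric polynomials, hence
  orthogonal to \<open>f\<close>, and Weierstrass approximation of steep ramps in \<open>q\<close>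
  makes them converge boundedly to the indicator of \<open>(a, b)\<close>.\<close>

lemma fourier_completeness:
  fixes f :: "real \<Rightarrow> real"
  assumes L: "0 < L" and f: "integrable (lebI L) f"
    and orth: "\<And>l. (\<integral>x. of_real (f x) * fourier_mode L l x \<partial>lebI L) = 0"
  shows "AE x in lebI L. f x = 0"
proof (rule AE_eq_0_if_interval_integrals_lebI[OF f])
  fix a b :: real assume ab: "0 \<le> a" "a < b" "b \<le> L"
  have fm[measurable]: "f \<in> borel_measurable (lebI L)" using f by auto
  define q where "q x = sin (pi * (x - a) / L) * sin (pi * (b - x) / L)" for x
  obtain C where qw: "wiener L 0 C (\<lambda>x. complex_of_real (q x))"
    unfolding q_def using wiener_sin_product[OF L] by blast
  have q1: "q x \<in> {- 1..1}" for x
  proof -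
    have "\<bar>q x\<bar> \<le> 1 * 1" unfolding q_def abs_mult by (intro mult_mono abs_sin_le_one) auto
    then show ?thesis by auto
  qed
  \<comment> \<open>The ramp is 0 for \<open>y \<le> 0\<close> and 1 from \<open>1 / n\<close> on;
    approximation is only needed on the range of \<open>q\<close>.\<close>
  have "\<exists>P. real_polynomial_function P \<and> (\<forall>y\<in>{- 1..1}. \<bar>min 1 (max 0 (real n * y)) - P y\<bar> < 1 / real (Suc n))" for n
  proof -
    have "continuous_on {- 1..1} (\<lambda>y. min 1 (max 0 (real n * y)))" by (intro continuous_intros)
    from Stone_Weierstrass_real_polynomial_function[OF _ this, of "1 / real (Suc n)"] show ?thesis
      by (metis compact_Icc of_nat_0_less_iff zero_less_Suc zero_less_divide_1_iff)
  qed
  then obtain P where P: "\<And>n. real_polynomial_function (P n)"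
    "\<And>n y. y \<in> {- 1..1} \<Longrightarrow> \<bar>min 1 (max 0 (real n * y)) - P n y\<bar> < 1 / real (Suc n)" by metis
  have zero: "(\<integral>x. P n (q x) * f x \<partial>lebI L) = 0" for n
  proof -
    obtain B where B: "wiener L 0 B (\<lambda>x. complex_of_real (P n (q x)))" using wiener_polynomial[OF P(1) qw] by blast
    have "complex_of_real (\<integral>x. P n (q x) * f x \<partial>lebI L) = (\<integral>x. of_real (f x) * of_real (P n (q x)) \<partial>lebI L)"
      by (simp only: integral_complex_of_real[symmetric] of_real_mult mult.commute)
    then show ?thesis using orthogonal_wiener[OF f orth B] by simp
  qed
  have conv: "(\<lambda>n. P n (q x)) \<longlonglongrightarrow> indicator {a<..<b} x" if x: "x \<in> {0<..<L}" for x
  proof -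
    have "(\<lambda>n. min 1 (max 0 (real n * q x))) \<longlonglongrightarrow> indicator {a<..<b} x"
    proof (cases "0 < q x")
      case True
      obtain N where N: "1 / q x < real N" using reals_Archimedean2 by blast
      have "\<forall>\<^sub>F n in sequentially. min 1 (max 0 (real n * q x)) = indicator {a<..<b} x"
      proof (rule eventually_sequentiallyI[of N])
        fix n assume "N \<le> n"
        then have "1 / q x < real n" using N by linarith
        then have "1 < real n * q x" using True by (simp add: field_simps)
        moreover have "x \<in> {a<..<b}" using True sin_product_pos_iff[OF L ab, of x] x by (simp add: q_def)
        ultimately show "min 1 (max 0 (real n * q x)) = indicator {a<..<b} x" by simp
      qed
      then show ?thesis by (rule tendsto_eventually)
    next
      case False
      then have "min 1 (max 0 (real n * q x)) = 0" for n by (simp add: mult_nonneg_nonpos max_absorb1)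
      moreover have "x \<notin> {a<..<b}" using False sin_product_pos_iff[OF L ab, of x] x by (simp add: q_def)
      ultimately show ?thesis by simp
    qed
    moreover have "(\<lambda>n. min 1 (max 0 (real n * q x)) - P n (q x)) \<longlonglongrightarrow> 0"
    proof (rule tendsto_rabs_zero_cancel, rule real_tendsto_sandwich[OF _ _ tendsto_const])
      show "(\<lambda>n. 1 / real (Suc n)) \<longlonglongrightarrow> 0" using LIMSEQ_inverse_real_of_nat by (simp add: inverse_eq_divide)
    qed (use P(2)[OF q1] in \<open>auto intro!: always_eventually less_imp_le\<close>)
    ultimately show ?thesis using tendsto_diff by fastforce
  qed
  have "(\<lambda>n. \<integral>x. P n (q x) * f x \<partial>lebI L) \<longlonglongrightarrow> (\<integral>x. indicator {a<..<b} x * f x \<partial>lebI L)"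
  proof (rule integral_dominated_convergence[where w="\<lambda>x. 2 * \<bar>f x\<bar>"])
    show "AE x in lebI L. (\<lambda>n. P n (q x) * f x) \<longlonglongrightarrow> indicator {a<..<b} x * f x"
      by (intro AE_I2 tendsto_mult tendsto_const) (simp add: conv)
    show "AE x in lebI L. norm (P n (q x) * f x) \<le> 2 * \<bar>f x\<bar>" for n
    proof (rule AE_I2)
      fix x
      have "1 / real (Suc n) \<le> 1" by simp
      then have "\<bar>P n (q x)\<bar> \<le> 2" using P(2)[OF q1, of n x] by linarith
      then show "norm (P n (q x) * f x) \<le> 2 * \<bar>f x\<bar>" by (simp add: abs_mult mult_right_mono)
    qed
    have "P n \<in> borel_measurable borel" for n
      by (intro borel_measurable_continuous_onI continuous_on_polymonial_function)
        (use P(1) in \<open>simp add: real_polynomial_function_eq\<close>)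
    moreover have "q \<in> borel_measurable (lebI L)" unfolding q_def[abs_def] by measurable
    ultimately have [measurable]: "(\<lambda>x. P n (q x)) \<in> borel_measurable (lebI L)" for n
      using measurable_compose by blast
    show "(\<lambda>x. P n (q x) * f x) \<in> borel_measurable (lebI L)" for n by measurable
  qed (use f in auto)
  then show "(\<integral>x. indicator {a<..<b} x * f x \<partial>lebI L) = 0" unfolding zero by (simp add: LIMSEQ_const_iff)
qed

section \<open>Periodic Sobolev functions\<close>

lemma L2_D:
  assumes "f \<in> L2 L"
  shows "f \<in> borel_measurable (lebI L)" "integrable (lebI L) (\<lambda>x. (f x)\<^sup>2)" "integrable (lebI L) f"
proof -
  interpret finite_measure "lebI L" by (rule finite_measure_lebI)
  show m: "f \<in> borel_measurable (lebI L)" and i: "integrable (lebI L) (\<lambda>x. (f x)\<^sup>2)"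
    using assms by (auto simp: L2_def measurable_lebI_iff integrable_lebI)
  show "integrable (lebI L) f"
  proof (rule Bochner_Integration.integrable_bound[where f="\<lambda>x. 1 + (f x)\<^sup>2"])
    have "\<bar>y\<bar> \<le> 1 + y\<^sup>2" for y :: real
      using sum_squares_bound[of 1 "\<bar>y\<bar>"] by simp
    then show "AE x in lebI L. norm (f x) \<le> norm (1 + (f x)\<^sup>2)" by (intro AE_I2) simp
  qed (use m i in auto)
qed

lemma L2_norm_square: "(L2_norm L f)\<^sup>2 = (\<integral>x. (f x)\<^sup>2 \<partial>lebI L)"
proof -
  have "0 \<le> (\<integral>x. (f x)\<^sup>2 \<partial>lebI L)" by simp
  then show ?thesis by (simp add: L2_norm_def integral_lebI[symmetric])
qed

lemma fourier_coeff_lebI: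
  "fourier_coeff L f l = (\<integral>x. of_real (f x) * fourier_mode L (- l) x \<partial>lebI L) / of_real L"
  by (simp add: fourier_coeff_def integral_lebI)

lemma fourier_coeff_cnj: "fourier_coeff L f (- l) = cnj (fourier_coeff L f l)"
proof -
  have "cnj (\<integral>x. of_real (f x) * fourier_mode L (- l) x \<partial>lebI L) = (\<integral>x. cnj (of_real (f x) * fourier_mode L (- l) x) \<partial>lebI L)"
    by (rule Bochner_Integration.integral_cnj[symmetric])
  then show ?thesis by (simp add: fourier_coeff_lebI)
qed

lemma fourier_coeff_cong_AE:
  assumes "f \<in> borel_measurable (lebI L)" "g \<in> borel_measurable (lebI L)" "AE x in lebI L. f x = g x"
  shows "fourier_coeff L f l = fourier_coeff L g l"
proof -
  note [measurable] = assms(1,2)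
  have [measurable]: "fourier_mode L (- l) \<in> borel_measurable (lebI L)"
    by (intro continuous_measurable_lebI continuous_on_mode)
  have "(\<integral>x. of_real (f x) * fourier_mode L (- l) x \<partial>lebI L) = (\<integral>x. of_real (g x) * fourier_mode L (- l) x \<partial>lebI L)"
    by (rule integral_cong_AE) (use assms(3) in \<open>auto elim: eventually_mono\<close>)
  then show ?thesis by (simp add: fourier_coeff_lebI)
qed

lemma integrable_mult_mode:
  "integrable (lebI b) f \<Longrightarrow> integrable (lebI b) (\<lambda>x. of_real (f x) * fourier_mode L l x)"
  using integrable_mult_wiener[OF _ wiener_mode[of L 0 1 l]] by simp

text \<open>With \<open>g\<close> the partial sum over \<open>S\<close>, the integral of
  \<open>|f - g|^2\<close> is nonnegative, and orthogonality gives the cross term and the integral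
  of \<open>|g|^2\<close> the same value \<open>L * A\<close>.\<close>

lemma Bessel:
  assumes L: "0 < L" and f: "f \<in> L2 L" and S: "finite S"
  shows "(\<Sum>l\<in>S. (norm (fourier_coeff L f l))\<^sup>2) \<le> (L2_norm L f)\<^sup>2 / L"
proof -
  let ?c = "fourier_coeff L f"
  let ?M = "lebI L"
  define g where "g x = (\<Sum>l\<in>S. ?c l * fourier_mode L l x)" for x
  define A where "A = (\<Sum>l\<in>S. (norm (?c l))\<^sup>2)"
  have gw: "wiener L 0 (\<Sum>l\<in>S. norm (?c l) * (1 + \<bar>of_int l\<bar>) ^ 0) g"
    unfolding g_def[abs_def] by (rule wiener_sum[OF S])
  have gc: "continuous_on B g" for B by (rule wiener_continuous[OF gw])
  have fi: "integrable ?M f" by (rule L2_D(3)[OF f])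
  have fg: "integrable ?M (\<lambda>x. of_real (f x) * g x)" by (rule integrable_mult_wiener[OF fi gw])
  have gg: "integrable ?M (\<lambda>x. g x * cnj (g x))" by (intro integrable_lebI_cont continuous_intros gc)
  have "(\<integral>x. of_real (f x) * g x \<partial>?M) = (\<Sum>l\<in>S. ?c l * (\<integral>x. of_real (f x) * fourier_mode L l x \<partial>?M))"
  proof -
    have "(\<integral>x. of_real (f x) * g x \<partial>?M) = (\<integral>x. (\<Sum>l\<in>S. ?c l * (of_real (f x) * fourier_mode L l x)) \<partial>?M)"
      by (simp add: g_def sum_distrib_left mult_ac)
    also have "\<dots> = (\<Sum>l\<in>S. \<integral>x. ?c l * (of_real (f x) * fourier_mode L l x) \<partial>?M)"
      by (rule Bochner_Integration.integral_sum) (intro integrable_mult_right integrable_mult_mode fi)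
    finally show ?thesis by simp
  qed
  also have "\<dots> = (\<Sum>l\<in>S. ?c l * (of_real L * cnj (?c l)))"
    using L by (intro sum.cong refl) (simp only: fourier_coeff_cnj[symmetric] fourier_coeff_lebI[of L f "- _"], simp)
  also have "\<dots> = of_real (L * A)"
    by (simp add: A_def sum_distrib_left complex_norm_square mult_ac del: of_real_power)
  finally have I1: "(\<integral>x. of_real (f x) * g x \<partial>?M) = of_real (L * A)" .
  have "(\<integral>x. g x * cnj (g x) \<partial>?M) = (\<integral>x. (\<Sum>k\<in>S. \<Sum>l\<in>S. ?c k * cnj (?c l) * fourier_mode L (k - l) x) \<partial>?M)"
    by (simp add: g_def sum_product diff_conv_add_uminus mode_add mult_ac del: add_uminus_conv_diff)
  also have "\<dots> = (\<Sum>k\<in>S. \<Sum>l\<in>S. ?c k * cnj (?c l) * (\<integral>x. fourier_mode L (k - l) x \<partial>?M))"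
    by (subst Bochner_Integration.integral_sum Bochner_Integration.integral_sum;
        (intro Bochner_Integration.integrable_sum integrable_mult_right integrable_lebI_cont continuous_on_mode)?)+ simp
  also have "\<dots> = (\<Sum>k\<in>S. \<Sum>l\<in>S. if k = l then ?c k * cnj (?c l) * of_real L else 0)"
    by (intro sum.cong refl) (simp add: integral_mode[OF L])
  also have "\<dots> = of_real (L * A)"
    using S by (simp add: A_def sum_distrib_left complex_norm_square mult_ac del: of_real_power)
  finally have I2: "(\<integral>x. g x * cnj (g x) \<partial>?M) = of_real (L * A)" .
  have "(\<integral>x. 2 * Re (of_real (f x) * g x) - Re (g x * cnj (g x)) \<partial>?M) \<le> (\<integral>x. (f x)\<^sup>2 \<partial>?M)"
  proof (rule integral_mono)
    fix x
    \<comment> \<open>This is \<open>|f - g|^2 \<ge> 0\<close> with \<open>f\<close> real.\<close>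
    have "0 \<le> (f x - Re (g x))\<^sup>2 + (Im (g x))\<^sup>2" by simp
    then show "2 * Re (of_real (f x) * g x) - Re (g x * cnj (g x)) \<le> (f x)\<^sup>2"
      by (simp add: power2_eq_square algebra_simps)
    show "integrable ?M (\<lambda>x. 2 * Re (of_real (f x) * g x) - Re (g x * cnj (g x)))"
      by (intro Bochner_Integration.integrable_diff integrable_mult_right integrable_Re fg gg)
  qed (rule L2_D(2)[OF f])
  also have "(\<integral>x. 2 * Re (of_real (f x) * g x) - Re (g x * cnj (g x)) \<partial>?M) = 2 * (L * A) - L * A"
  proof -
    have R: "(\<integral>x. Re (of_real (f x) * g x) \<partial>?M) = L * A" "(\<integral>x. Re (g x * cnj (g x)) \<partial>?M) = L * A"
      unfolding integral_Re[OF fg] integral_Re[OF gg] I1 I2 by (rule Re_complex_of_real)+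
    have "(\<integral>x. 2 * Re (of_real (f x) * g x) - Re (g x * cnj (g x)) \<partial>?M)
        = (\<integral>x. 2 * Re (of_real (f x) * g x) \<partial>?M) - (\<integral>x. Re (g x * cnj (g x)) \<partial>?M)"
      by (intro Bochner_Integration.integral_diff integrable_mult_right integrable_Re fg gg)
    then show ?thesis unfolding integral_mult_right_zero R .
  qed
  finally show ?thesis using L unfolding A_def[symmetric] L2_norm_square by (simp add: field_simps)
qed

lemma L2_AE_eqI:
  assumes L: "0 < L" and f: "f \<in> L2 L" and g: "g \<in> L2 L" and eq: "\<And>l. fourier_coeff L f l = fourier_coeff L g l"
  shows "AE x in lebI L. f x = g x"
proof -
  have "AE x in lebI L. f x - g x = 0"
  proof (rule fourier_completeness[OF L])
    fix l
    have "(\<integral>x. of_real (f x - g x) * fourier_mode L l x \<partial>lebI L)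
       = (\<integral>x. of_real (f x) * fourier_mode L l x - of_real (g x) * fourier_mode L l x \<partial>lebI L)"
      by (simp add: left_diff_distrib)
    also have "\<dots> = (\<integral>x. of_real (f x) * fourier_mode L l x \<partial>lebI L) - (\<integral>x. of_real (g x) * fourier_mode L l x \<partial>lebI L)"
      by (intro Bochner_Integration.integral_diff integrable_mult_mode L2_D(3) f g)
    also have "\<dots> = 0" using eq[of "- l"] L by (simp add: fourier_coeff_lebI)
    finally show "(\<integral>x. of_real (f x - g x) * fourier_mode L l x \<partial>lebI L) = 0" .
  qed (use L2_D(3)[OF f] L2_D(3)[OF g] in auto)
  then show ?thesis by simp
qed

lemma Re_of_real_mult: "Re (of_real a * z) = a * Re z"
  by simp

lemma Re_mode_deriv:
  "((\<lambda>x. Re (c * fourier_mode L l x)) has_real_derivative Re (c * (\<i> * of_real (freq L l)) * fourier_mode L l x)) (at x)"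
proof -
  have "((\<lambda>x. c * fourier_mode L l x) has_vector_derivative c * ((\<i> * of_real (freq L l)) * fourier_mode L l x)) (at x)"
    unfolding freq_def by (intro has_vector_derivative_mult_right mode_deriv)
  then have "((\<lambda>x. Re (c * fourier_mode L l x)) has_vector_derivative Re (c * ((\<i> * of_real (freq L l)) * fourier_mode L l x))) (at x)"
    by (rule bounded_linear.has_vector_derivative[OF bounded_linear_Re])
  then show ?thesis unfolding has_real_derivative_iff_has_vector_derivative by (simp only: mult.assoc)
qed

lemma Re_mode_deriv_funpow:
  "(deriv ^^ j) (\<lambda>x. Re (c * fourier_mode L l x)) = (\<lambda>x. Re (c * (\<i> * of_real (freq L l)) ^ j * fourier_mode L l x))"
proof (induction j)
  case (Suc j)
  show ?case unfolding funpow.simps comp_def Suc power_Suc2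
    using Re_mode_deriv[of "c * (\<i> * of_real (freq L l)) ^ j"] by (auto intro!: DERIV_imp_deriv simp: mult.assoc)
qed simp

lemma smooth_Re_mode: "smooth (\<lambda>x. Re (c * fourier_mode L l x))"
  unfolding smooth_def Re_mode_deriv_funpow using Re_mode_deriv field_differentiable_def by blast

text \<open>Test functions are real, so a complex mode is tested through the real parts of its
  multiples by \<open>c\<close>. Conjugation turns \<open>freq L l\<close> into its negative, and
  this sign power cancels the \<open>(-1)^j\<close> of the weak derivative.\<close>

lemma weak_xderiv_coeff:
  assumes L: "0 < L" and f: "f \<in> L2 L" and g: "g \<in> L2 L" and weak: "weak_xderiv L j f g"
  shows "fourier_coeff L g l = (\<i> * of_real (freq L l)) ^ j * fourier_coeff L f l"
proof -
  let ?w = "\<i> * of_real (freq L (- l)) :: complex"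
  let ?F = "\<lambda>x. of_real (f x) * (?w ^ j * fourier_mode L (- l) x)" and ?G = "\<lambda>x. of_real (g x) * fourier_mode L (- l) x"
  have iF: "integrable (lebI L) ?F"
    using integrable_mult_wiener[OF L2_D(3)[OF f] wiener_mode] .
  have iG: "integrable (lebI L) ?G" by (intro integrable_mult_mode L2_D(3) g)
  have "Re (c * (\<integral>x. ?F x \<partial>lebI L)) = Re (c * ((- 1) ^ j * (\<integral>x. ?G x \<partial>lebI L)))" for c
  proof -
    have per: "periodic L (\<lambda>x. Re (c * fourier_mode L (- l) x))"
      using L by (simp add: periodic_def mode_periodic)
    have "Re (c * (\<integral>x. ?F x \<partial>lebI L)) = Re (\<integral>x. c * ?F x \<partial>lebI L)" by simp
    also have "\<dots> = (\<integral>x. Re (c * ?F x) \<partial>lebI L)" by (rule integral_Re[symmetric]) (intro integrable_mult_right iF)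
    also have "\<dots> = (\<integral>x. f x * Re (c * ?w ^ j * fourier_mode L (- l) x) \<partial>lebI L)"
    proof (rule Bochner_Integration.integral_cong[OF refl])
      fix x
      have "c * ?F x = of_real (f x) * (c * ?w ^ j * fourier_mode L (- l) x)" by (simp only: mult_ac)
      then show "Re (c * ?F x) = f x * Re (c * ?w ^ j * fourier_mode L (- l) x)"
        by (simp only: Re_of_real_mult)
    qed
    also have "\<dots> = (- 1) ^ j * (\<integral>x. g x * Re (c * fourier_mode L (- l) x) \<partial>lebI L)"
      using weak[unfolded weak_xderiv_def integral_lebI[symmetric], rule_format, OF conjI, OF smooth_Re_mode per]
      unfolding Re_mode_deriv_funpow .
    also have "(\<integral>x. g x * Re (c * fourier_mode L (- l) x) \<partial>lebI L) = (\<integral>x. Re (c * ?G x) \<partial>lebI L)"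
    proof (rule Bochner_Integration.integral_cong[OF refl])
      fix x
      have "c * ?G x = of_real (g x) * (c * fourier_mode L (- l) x)" by (simp only: mult_ac)
      then show "g x * Re (c * fourier_mode L (- l) x) = Re (c * ?G x)" by (simp only: Re_of_real_mult)
    qed
    also have "\<dots> = Re (\<integral>x. c * ?G x \<partial>lebI L)" by (rule integral_Re) (intro integrable_mult_right iG)
    also have "(- 1) ^ j * \<dots> = Re (c * ((- 1) ^ j * (\<integral>x. ?G x \<partial>lebI L)))"
      by (cases "even j") auto
    finally show ?thesis .
  qed
  \<comment> \<open>These two multiples recover the real and the imaginary part.\<close>
  from this[of 1] this[of "- \<i>"]
  have eq: "(\<integral>x. ?F x \<partial>lebI L) = (- 1) ^ j * (\<integral>x. ?G x \<partial>lebI L)" by (simp add: complex_eq_iff)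
  have "(\<integral>x. ?F x \<partial>lebI L) = ?w ^ j * (\<integral>x. of_real (f x) * fourier_mode L (- l) x \<partial>lebI L)"
    by (simp only: mult.left_commute[of _ "?w ^ j"] integral_mult_right_zero)
  moreover have "?w ^ j = (- 1) ^ j * (\<i> * of_real (freq L l)) ^ j"
    unfolding power_mult_distrib[symmetric] by (simp add: freq_def)
  ultimately have "(- 1) ^ j * (\<integral>x. ?G x \<partial>lebI L) = (- 1) ^ j * ((\<i> * of_real (freq L l)) ^ j * (\<integral>x. of_real (f x) * fourier_mode L (- l) x \<partial>lebI L))"
    using eq by simp
  then have "(\<integral>x. ?G x \<partial>lebI L) = (\<i> * of_real (freq L l)) ^ j * (\<integral>x. of_real (f x) * fourier_mode L (- l) x \<partial>lebI L)"
    by simp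
  then show ?thesis by (simp add: fourier_coeff_lebI)
qed

lemma xderiv_spec:
  assumes "f \<in> H_per L r" "j \<le> r"
  shows "xderiv L j f \<in> L2 L" "weak_xderiv L j f (xderiv L j f)"
proof -
  have "\<exists>g. g \<in> L2 L \<and> weak_xderiv L j f g" using assms unfolding H_per_def by blast
  from someI_ex[OF this] show "xderiv L j f \<in> L2 L" "weak_xderiv L j f (xderiv L j f)"
    by (auto simp: xderiv_def)
qed

lemma H_per_L2: "f \<in> H_per L r \<Longrightarrow> f \<in> L2 L"
  by (simp add: H_per_def)

lemma xderiv_coeff:
  assumes "0 < L" "f \<in> H_per L r" "j \<le> r"
  shows "fourier_coeff L (xderiv L j f) l = (\<i> * of_real (freq L l)) ^ j * fourier_coeff L f l"
  using weak_xderiv_coeff[OF assms(1) H_per_L2[OF assms(2)] xderiv_spec[OF assms(2,3)]] .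

lemma L2_norm_xderiv_le: "j \<le> r \<Longrightarrow> (L2_norm L (xderiv L j f))\<^sup>2 \<le> (H_per_norm L r f)\<^sup>2"
  unfolding H_per_norm_def
  by (subst real_sqrt_pow2) (auto intro!: sum_nonneg member_le_sum[of j "{..r}" "\<lambda>j. (L2_norm L (xderiv L j f))\<^sup>2"])

lemma H_per_norm_nonneg: "0 \<le> H_per_norm L r f"
  unfolding H_per_norm_def by (auto intro!: sum_nonneg)

text \<open>\<open>xderiv L 0 f\<close> is a chosen weak derivative of order 0, equal to
  \<open>f\<close> almost everywhere only; the two are identified by their Fourier coefficients and
  completeness.\<close>

lemma L2_norm_le_H_per_norm:
  assumes L: "0 < L" and f: "f \<in> H_per L r"
  shows "(L2_norm L f)\<^sup>2 \<le> (H_per_norm L r f)\<^sup>2"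
proof -
  have "AE x in lebI L. f x = xderiv L 0 f x"
    by (rule L2_AE_eqI[OF L H_per_L2[OF f] xderiv_spec(1)[OF f]]) (use xderiv_coeff[OF L f, of 0] in auto)
  then have "(L2_norm L f)\<^sup>2 = (L2_norm L (xderiv L 0 f))\<^sup>2"
    unfolding L2_norm_square
    by (intro integral_cong_AE) (use L2_D[OF H_per_L2[OF f]] L2_D[OF xderiv_spec(1)[OF f, of 0]] in auto)
  then show ?thesis using L2_norm_xderiv_le[of 0 r] by simp
qed

text \<open>From \<open>(1 + |l|)^(2r) \<le> 2^(2r) (1 + |l|^(2r))\<close> and
  \<open>|l| = L / (2 pi) * |freq L l|\<close>; the division by \<open>L\<close> is the one in
  Bessel's inequality.\<close>

definition sobolev_const :: "real \<Rightarrow> nat \<Rightarrow> real" where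
  "sobolev_const L r = 2 ^ (2 * r) * (1 + (L / (2 * pi)) ^ (2 * r)) / L"

lemma sobolev_const_nonneg: "0 < L \<Longrightarrow> 0 \<le> sobolev_const L r"
  unfolding sobolev_const_def by (intro divide_nonneg_nonneg mult_nonneg_nonneg add_nonneg_nonneg) auto

text \<open>Bessel's inequality for the derivatives of order 0 and \<open>r\<close>, which dominate
  all weights in between. Finite \<open>S\<close> keeps the estimate free of convergence questions
  and continuous in further parameters.\<close>

lemma weighted_coeff_bound:
  assumes L: "0 < L" and f: "f \<in> H_per L r" and S: "finite S"
  shows "(\<Sum>l\<in>S. (1 + \<bar>of_int l\<bar>) ^ (2 * r) * (norm (fourier_coeff L f l))\<^sup>2) \<le> sobolev_const L r * (H_per_norm L r f)\<^sup>2"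
proof -
  let ?K = "(L / (2 * pi)) ^ (2 * r)"
  have w: "(1 + \<bar>of_int l\<bar>) ^ (2 * r) \<le> 2 ^ (2 * r) * (1 + ?K * \<bar>freq L l\<bar> ^ (2 * r))" for l
  proof -
    have f: "\<bar>of_int l :: real\<bar> = L / (2 * pi) * \<bar>freq L l\<bar>" using L by (simp add: freq_def abs_mult)
    have "(1 + \<bar>of_int l :: real\<bar>) ^ (2 * r) \<le> (2 * max 1 \<bar>of_int l\<bar>) ^ (2 * r)"
      by (intro power_mono) auto
    also have "\<dots> = 2 ^ (2 * r) * max 1 \<bar>of_int l\<bar> ^ (2 * r)" by (rule power_mult_distrib)
    also have "\<dots> \<le> 2 ^ (2 * r) * (1 + \<bar>of_int l\<bar> ^ (2 * r))"
      by (intro mult_left_mono) (auto simp: max_def)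
    finally show ?thesis unfolding f power_mult_distrib .
  qed
  have B: "(\<Sum>l\<in>S. \<bar>freq L l\<bar> ^ (2 * j) * (norm (fourier_coeff L f l))\<^sup>2) \<le> (H_per_norm L r f)\<^sup>2 / L" if j: "j \<le> r" for j
  proof -
    have "(\<Sum>l\<in>S. \<bar>freq L l\<bar> ^ (2 * j) * (norm (fourier_coeff L f l))\<^sup>2) = (\<Sum>l\<in>S. (norm (fourier_coeff L (xderiv L j f) l))\<^sup>2)"
      by (intro sum.cong refl) (simp add: xderiv_coeff[OF L f j] norm_mult norm_power power_mult_distrib power_mult mult.commute[of 2] flip: power_mult)
    also have "\<dots> \<le> (L2_norm L (xderiv L j f))\<^sup>2 / L" by (rule Bessel[OF L xderiv_spec(1)[OF f j] S])
    also have "\<dots> \<le> (H_per_norm L r f)\<^sup>2 / L" using L by (intro divide_right_mono L2_norm_xderiv_le j) auto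
    finally show ?thesis .
  qed
  have "(\<Sum>l\<in>S. (1 + \<bar>of_int l\<bar>) ^ (2 * r) * (norm (fourier_coeff L f l))\<^sup>2)
      \<le> (\<Sum>l\<in>S. (2 ^ (2 * r) * (1 + ?K * \<bar>freq L l\<bar> ^ (2 * r))) * (norm (fourier_coeff L f l))\<^sup>2)"
    by (intro sum_mono mult_right_mono w) simp
  also have "\<dots> = 2 ^ (2 * r) * ((\<Sum>l\<in>S. \<bar>freq L l\<bar> ^ (2 * 0) * (norm (fourier_coeff L f l))\<^sup>2)
      + ?K * (\<Sum>l\<in>S. \<bar>freq L l\<bar> ^ (2 * r) * (norm (fourier_coeff L f l))\<^sup>2))"
    by (simp add: sum_distrib_left sum.distrib algebra_simps)
  also have "\<dots> \<le> 2 ^ (2 * r) * ((H_per_norm L r f)\<^sup>2 / L + ?K * ((H_per_norm L r f)\<^sup>2 / L))"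
    using L by (intro mult_left_mono add_mono B) auto
  also have "\<dots> = sobolev_const L r * (H_per_norm L r f)\<^sup>2" by (simp add: sobolev_const_def algebra_simps add_divide_distrib)
  finally show ?thesis .
qed

section \<open>Fourier coefficients as functions of time\<close>

lemma L2_time_D:
  assumes L: "0 < L" and u: "u \<in> L2_time L T r"
  shows "case_prod u \<in> borel_measurable (lebI T \<Otimes>\<^sub>M lebI L)"
    "AE t in lebI T. u t \<in> H_per L r"
    "integrable (lebI T) (\<lambda>t. (H_per_norm L r (u t))\<^sup>2)"
    "integrable (lebI T \<Otimes>\<^sub>M lebI L) (case_prod u)"
proof -
  interpret pair_sigma_finite "lebI T" "lebI L" by (rule pair_lebI)
  interpret fL: finite_measure "lebI L" by (rule finite_measure_lebI)
  interpret fT: finite_measure "lebI T" by (rule finite_measure_lebI)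
  show m: "case_prod u \<in> borel_measurable (lebI T \<Otimes>\<^sub>M lebI L)"
  proof -
    let ?S = "{0<..<T} \<times> {0<..<L}"
    have "(\<lambda>p. indicator ?S p *\<^sub>R case_prod u p) \<in> borel_measurable borel"
      using u by (simp add: L2_time_def jointly_measurable_def set_borel_measurable_def)
    moreover have "(\<lambda>p. (fst p, snd p)) \<in> lebI T \<Otimes>\<^sub>M lebI L \<rightarrow>\<^sub>M borel"
      unfolding borel_prod[symmetric] by measurable
    ultimately have "(\<lambda>p. indicator ?S p *\<^sub>R case_prod u p) \<in> borel_measurable (lebI T \<Otimes>\<^sub>M lebI L)"
      by (simp add: measurable_compose)
    then show ?thesis
      by (subst measurable_cong[where g="\<lambda>p. indicator ?S p *\<^sub>R case_prod u p"])
        (auto simp: space_pair_measure)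
  qed
  show H: "AE t in lebI T. u t \<in> H_per L r" and i: "integrable (lebI T) (\<lambda>t. (H_per_norm L r (u t))\<^sup>2)"
    using u by (auto simp: L2_time_def AE_lebI integrable_lebI)
  have L2: "AE t in lebI T. u t \<in> L2 L" using H by (auto elim: eventually_mono intro: H_per_L2)
  show "integrable (lebI T \<Otimes>\<^sub>M lebI L) (case_prod u)"
  proof (rule Fubini_integrable[OF m])
    show "AE t in lebI T. integrable (lebI L) (\<lambda>x. case (t, x) of (t, x) \<Rightarrow> u t x)"
      using L2 by eventually_elim (simp add: L2_D)
    show "integrable (lebI T) (\<lambda>t. \<integral>x. norm (case (t, x) of (t, x) \<Rightarrow> u t x) \<partial>lebI L)"
    proof (rule Bochner_Integration.integrable_bound[where f="\<lambda>t. L + (H_per_norm L r (u t))\<^sup>2"])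
      show "(\<lambda>t. \<integral>x. norm (case (t, x) of (t, x) \<Rightarrow> u t x) \<partial>lebI L) \<in> borel_measurable (lebI T)"
        using m by measurable
      show "AE t in lebI T. norm (\<integral>x. norm (case (t, x) of (t, x) \<Rightarrow> u t x) \<partial>lebI L) \<le> norm (L + (H_per_norm L r (u t))\<^sup>2)"
        using H
      proof eventually_elim
        case (elim t)
        note D = L2_D[OF H_per_L2[OF elim]]
        have "\<bar>y\<bar> \<le> 1 + y\<^sup>2" for y :: real
          using sum_squares_bound[of 1 "\<bar>y\<bar>"] by simp
        then have "(\<integral>x. \<bar>u t x\<bar> \<partial>lebI L) \<le> (\<integral>x. 1 + (u t x)\<^sup>2 \<partial>lebI L)"
          using D by (intro integral_mono) auto
        also have "\<dots> = L + (L2_norm L (u t))\<^sup>2"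
          using D L by (subst Bochner_Integration.integral_add) (auto simp: L2_norm_square measure_lebI)
        also have "\<dots> \<le> L + (H_per_norm L r (u t))\<^sup>2" using L2_norm_le_H_per_norm[OF L elim] by simp
        finally show ?case using L by simp
      qed
    qed (use i in simp)
  qed
qed

lemma integrable_pair_mult_scaleR:
  fixes f :: "'a \<Rightarrow> 'b \<Rightarrow> real" and k :: "'a \<times> 'b \<Rightarrow> complex"
  assumes f: "integrable (M1 \<Otimes>\<^sub>M M2) (case_prod f)" and k[measurable]: "k \<in> borel_measurable (M1 \<Otimes>\<^sub>M M2)"
    and C: "\<And>x y. x \<in> space M1 \<Longrightarrow> y \<in> space M2 \<Longrightarrow> norm (k (x, y)) \<le> C"
  shows "integrable (M1 \<Otimes>\<^sub>M M2) (\<lambda>(x, y). of_real (f x y) * k (x, y))"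
proof (rule Bochner_Integration.integrable_bound[where f="\<lambda>p. C * case_prod f p"])
  have [measurable]: "case_prod f \<in> borel_measurable (M1 \<Otimes>\<^sub>M M2)" using f by auto
  show "(\<lambda>(x, y). of_real (f x y) * k (x, y)) \<in> borel_measurable (M1 \<Otimes>\<^sub>M M2)"
  proof -
    have "(\<lambda>p. of_real (case_prod f p) * k p) \<in> borel_measurable (M1 \<Otimes>\<^sub>M M2)" by measurable
    then show ?thesis by (simp add: case_prod_beta')
  qed
  show "AE p in M1 \<Otimes>\<^sub>M M2. norm (case p of (x, y) \<Rightarrow> of_real (f x y) * k (x, y)) \<le> norm (C * case_prod f p)"
  proof (rule AE_I2)
    fix p assume "p \<in> space (M1 \<Otimes>\<^sub>M M2)"
    then obtain x y where p: "p = (x, y)" "x \<in> space M1" "y \<in> space M2" by (auto simp: space_pair_measure)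
    have "\<bar>f x y\<bar> * norm (k (x, y)) \<le> \<bar>f x y\<bar> * \<bar>C\<bar>"
      using C[OF p(2,3)] by (intro mult_left_mono) auto
    then show "norm (case p of (x, y) \<Rightarrow> of_real (f x y) * k (x, y)) \<le> norm (C * case_prod f p)"
      by (simp add: p norm_mult abs_mult mult.commute)
  qed
qed (use f in simp)

lemma integrable_fourier_coeff:
  assumes u: "integrable (lebI T \<Otimes>\<^sub>M lebI L) (case_prod u)"
  shows "integrable (lebI T) (\<lambda>t. fourier_coeff L (u t) l)"
proof -
  interpret pair_sigma_finite "lebI T" "lebI L" by (rule pair_lebI)
  have [measurable]: "fourier_mode L (- l) \<in> borel_measurable (lebI L)"
    by (intro continuous_measurable_lebI continuous_on_mode)
  have "integrable (lebI T \<Otimes>\<^sub>M lebI L) (\<lambda>(t, x). of_real (u t x) * fourier_mode L (- l) (snd (t, x)))"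
    by (rule integrable_pair_mult_scaleR[OF u, where C=1]) auto
  then have "integrable (lebI T) (\<lambda>t. \<integral>x. of_real (u t x) * fourier_mode L (- l) (snd (t, x)) \<partial>lebI L)"
    by (rule integrable_fst)
  then show ?thesis by (simp add: fourier_coeff_lebI)
qed

text \<open>Fubini moves the pairing with \<open>h\<close> under the space integral, the position in
  which the definition of the weak time derivative speaks about almost every
  \<open>x\<close>.\<close>

lemma test_integral_fourier_coeff:
  assumes u: "integrable (lebI T \<Otimes>\<^sub>M lebI L) (case_prod u)" and h: "continuous_on {0..T} h"
  shows "(\<integral>t. h t *\<^sub>R fourier_coeff L (u t) l \<partial>lebI T)
    = (\<integral>x. of_real (\<integral>t. h t * u t x \<partial>lebI T) * fourier_mode L (- l) x \<partial>lebI L) / of_real L"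
proof -
  interpret pair_sigma_finite "lebI T" "lebI L" by (rule pair_lebI)
  have [measurable]: "fourier_mode L (- l) \<in> borel_measurable (lebI L)" "h \<in> borel_measurable (lebI T)"
    by (intro continuous_measurable_lebI continuous_on_mode h)+
  obtain C where C: "0 \<le> C" "\<And>t. t \<in> {0..T} \<Longrightarrow> norm (h t) \<le> C" using continuous_bounded_Icc[OF h] by blast
  let ?k = "\<lambda>p. of_real (h (fst p)) * fourier_mode L (- l) (snd p)"
  have int: "integrable (lebI T \<Otimes>\<^sub>M lebI L) (\<lambda>(t, x). of_real (u t x) * ?k (t, x))"
    by (rule integrable_pair_mult_scaleR[OF u, where C=C]) (use C(2) in \<open>auto simp: norm_mult\<close>)
  have "(\<integral>t. h t *\<^sub>R fourier_coeff L (u t) l \<partial>lebI T)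
      = (\<integral>t. (\<integral>x. of_real (u t x) * ?k (t, x) \<partial>lebI L) / of_real L \<partial>lebI T)"
  proof (rule Bochner_Integration.integral_cong[OF refl])
    fix t
    have "(\<integral>x. of_real (u t x) * ?k (t, x) \<partial>lebI L) = (\<integral>x. of_real (h t) * (of_real (u t x) * fourier_mode L (- l) x) \<partial>lebI L)"
      by (simp add: mult_ac)
    then show "h t *\<^sub>R fourier_coeff L (u t) l = (\<integral>x. of_real (u t x) * ?k (t, x) \<partial>lebI L) / of_real L"
      by (simp add: fourier_coeff_lebI scaleR_conv_of_real)
  qed
  also have "\<dots> = (\<integral>t. (\<integral>x. of_real (u t x) * ?k (t, x) \<partial>lebI L) \<partial>lebI T) / of_real L" by simp
  also have "(\<integral>t. (\<integral>x. of_real (u t x) * ?k (t, x) \<partial>lebI L) \<partial>lebI T) = (\<integral>x. (\<integral>t. of_real (u t x) * ?k (t, x) \<partial>lebI T) \<partial>lebI L)"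
    by (rule Fubini_integral[symmetric, OF int])
  also have "\<dots> = (\<integral>x. of_real (\<integral>t. h t * u t x \<partial>lebI T) * fourier_mode L (- l) x \<partial>lebI L)"
  proof (rule Bochner_Integration.integral_cong[OF refl])
    fix x
    have "(\<integral>t. of_real (u t x) * ?k (t, x) \<partial>lebI T) = (\<integral>t. of_real (h t * u t x) * fourier_mode L (- l) x \<partial>lebI T)"
      by (simp add: mult_ac)
    also have "\<dots> = (\<integral>t. of_real (h t * u t x) \<partial>lebI T) * fourier_mode L (- l) x" by (rule integral_mult_left_zero)
    finally show "(\<integral>t. of_real (u t x) * ?k (t, x) \<partial>lebI T) = of_real (\<integral>t. h t * u t x \<partial>lebI T) * fourier_mode L (- l) x"
      unfolding integral_complex_of_real .
  qed
  finally show ?thesis .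
qed

text \<open>The exceptional null set of \<open>x\<close> may depend on \<open>\<phi>\<close>, which
  does no harm because \<open>\<phi>\<close> is fixed before the integration over
  \<open>x\<close>.\<close>

lemma weak_tderiv_coeff:
  assumes L: "0 < L" and u: "integrable (lebI T \<Otimes>\<^sub>M lebI L) (case_prod u)"
    and v: "integrable (lebI T \<Otimes>\<^sub>M lebI L) (case_prod v)"
    and weak: "weak_tderiv L T j u v" and \<phi>: "time_test_fun T \<phi>"
  shows "(\<integral>t. (deriv ^^ j) \<phi> t *\<^sub>R fourier_coeff L (u t) l \<partial>lebI T)
    = (- 1) ^ j * (\<integral>t. \<phi> t *\<^sub>R fourier_coeff L (v t) l \<partial>lebI T)"
proof -
  interpret pair_sigma_finite "lebI T" "lebI L" by (rule pair_lebI)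
  have h: "continuous_on {0..T} ((deriv ^^ j) \<phi>)" "continuous_on {0..T} \<phi>"
    by (intro smooth_deriv_n_continuous smooth_continuous test_fun_D(1)[OF \<phi>])+
  have [measurable]: "case_prod u \<in> borel_measurable (lebI T \<Otimes>\<^sub>M lebI L)" "case_prod v \<in> borel_measurable (lebI T \<Otimes>\<^sub>M lebI L)"
    using u v by auto
  have [measurable]: "(\<lambda>(x, t). u t x) \<in> borel_measurable (lebI L \<Otimes>\<^sub>M lebI T)" "(\<lambda>(x, t). v t x) \<in> borel_measurable (lebI L \<Otimes>\<^sub>M lebI T)"
    by measurable
  have [measurable]: "fourier_mode L (- l) \<in> borel_measurable (lebI L)"
    "(deriv ^^ j) \<phi> \<in> borel_measurable (lebI T)" "\<phi> \<in> borel_measurable (lebI T)"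
    by (intro continuous_measurable_lebI continuous_on_mode h)+
  have "(\<integral>x. of_real (\<integral>t. (deriv ^^ j) \<phi> t * u t x \<partial>lebI T) * fourier_mode L (- l) x \<partial>lebI L)
    = (\<integral>x. of_real ((- 1) ^ j * (\<integral>t. \<phi> t * v t x \<partial>lebI T)) * fourier_mode L (- l) x \<partial>lebI L)"
  proof (rule integral_cong_AE)
    show "AE x in lebI L. of_real (\<integral>t. (deriv ^^ j) \<phi> t * u t x \<partial>lebI T) * fourier_mode L (- l) x
        = of_real ((- 1) ^ j * (\<integral>t. \<phi> t * v t x \<partial>lebI T)) * fourier_mode L (- l) x"
      using weak \<phi> unfolding weak_tderiv_def AE_lebI integral_lebI by (auto elim: eventually_mono)
  qed measurable
  also have "\<dots> = (\<integral>x. (- 1) ^ j * (of_real (\<integral>t. \<phi> t * v t x \<partial>lebI T) * fourier_mode L (- l) x) \<partial>lebI L)"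
    by (simp only: of_real_mult of_real_power of_real_minus of_real_1 mult.assoc)
  also have "\<dots> = (- 1) ^ j * (\<integral>x. of_real (\<integral>t. \<phi> t * v t x \<partial>lebI T) * fourier_mode L (- l) x \<partial>lebI L)"
    by (rule integral_mult_right_zero)
  finally show ?thesis unfolding test_integral_fourier_coeff[OF u h(1)] test_integral_fourier_coeff[OF v h(2)] by simp
qed

lemma tderiv_spec:
  assumes "u \<in> H_time L T k 0" "j \<le> k"
  shows "tderiv L T j u \<in> L2_time L T 0" "weak_tderiv L T j u (tderiv L T j u)"
proof -
  have "\<exists>v. v \<in> L2_time L T 0 \<and> weak_tderiv L T j u v" using assms unfolding H_time_def by blast
  from someI_ex[OF this] show "tderiv L T j u \<in> L2_time L T 0" "weak_tderiv L T j u (tderiv L T j u)"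
    by (auto simp: tderiv_def)
qed

lemma continuous_on_integral_param:
  fixes f :: "real \<Rightarrow> real \<Rightarrow> 'a::euclidean_space"
  assumes "0 \<le> L" "continuous_on ({0..T} \<times> {0..L}) (case_prod f)"
  shows "continuous_on {0..T} (\<lambda>t. \<integral>x. f t x \<partial>lebI L)"
proof -
  have "continuous_on {0..T} (\<lambda>t. integral (cbox 0 L) (f t))"
    by (rule integral_continuous_on_param) (use assms in simp)
  moreover have "(\<integral>x. f t x \<partial>lebI L) = integral (cbox 0 L) (f t)" if t: "t \<in> {0..T}" for t
  proof -
    have "continuous_on {0..L} (\<lambda>x. case_prod f (t, x))"
      by (rule continuous_on_compose2[OF assms(2)]) (use t in \<open>auto intro!: continuous_intros\<close>)
    then have i: "integrable (lebI L) (f t)" by (intro integrable_lebI_cont) simp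
    have "(\<integral>x. f t x \<partial>lebI L) = (\<integral>x. indicator {0<..<L} x *\<^sub>R f t x \<partial>lebI L)"
      by (intro Bochner_Integration.integral_cong) auto
    then show ?thesis using integral_lebI_indicator(1)[OF i order_refl] by simp
  qed
  ultimately show ?thesis
    by (subst continuous_on_cong[OF refl, where g="\<lambda>t. integral (cbox 0 L) (f t)"]) auto
qed

lemma continuous_on_fourier_coeff:
  fixes u :: "real \<Rightarrow> real \<Rightarrow> real"
  assumes "0 < L" "continuous_on ({0..T} \<times> {0..L}) (case_prod u)"
  shows "continuous_on {0..T} (\<lambda>t. fourier_coeff L (u t) l)"
proof -
  have "continuous_on ({0..T} \<times> {0..L}) (\<lambda>p. fourier_mode L (- l) (snd p))"
    by (rule continuous_on_compose2[OF continuous_on_mode[of UNIV]]) (auto intro!: continuous_intros)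
  then have "continuous_on ({0..T} \<times> {0..L}) (\<lambda>p. of_real (case_prod u p) * fourier_mode L (- l) (snd p))"
    by (intro continuous_intros assms)
  then have "continuous_on ({0..T} \<times> {0..L}) (case_prod (\<lambda>t x. of_real (u t x) * fourier_mode L (- l) x))"
    by (simp add: case_prod_beta')
  then have "continuous_on {0..T} (\<lambda>t. \<integral>x. of_real (u t x) * fourier_mode L (- l) x \<partial>lebI L)"
    using assms(1) by (intro continuous_on_integral_param) auto
  then show ?thesis
    unfolding fourier_coeff_lebI using assms(1) by (intro continuous_intros) auto
qed

text \<open>The time regularity of \<open>u\<close> becomes a family of scalar statements, one for
  each mode, where continuous representatives exist. Weak derivatives are defined relative to
  \<open>u\<close> alone; testing with \<open>deriv \<phi>\<close> links consecutive orders.\<close>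

lemma mode_regularity:
  assumes L: "0 < L" and T: "0 < T" and u: "u \<in> H_time L T 4 0"
    and cont: "continuous_on ({0..T} \<times> UNIV) (case_prod u)"
  obtains c :: "nat \<Rightarrow> int \<Rightarrow> real \<Rightarrow> complex" where
    "\<And>l t. t \<in> {0..T} \<Longrightarrow> c 0 l t = fourier_coeff L (u t) l"
    "\<And>j l. j < 4 \<Longrightarrow> 0 < j \<Longrightarrow> AE t in lebI T. c j l t = fourier_coeff L (tderiv L T j u t) l"
    "\<And>j l. j < 4 \<Longrightarrow> continuous_on {0..T} (c j l)"
    "\<And>j l t. j < 3 \<Longrightarrow> t \<in> {0..T} \<Longrightarrow> (c j l has_vector_derivative c (Suc j) l t) (at t within {0..T})"
    "\<And>l t. t \<in> {0..T} \<Longrightarrow> c 3 l t = c 3 l 0 + integral {0..t} (\<lambda>s. fourier_coeff L (tderiv L T 4 u s) l)"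
proof -
  \<comment> \<open>Order 0 is \<open>u\<close> itself, since the choice behind
    \<open>tderiv L T 0 u\<close> fixes it only up to null sets.\<close>
  define v where "v j = (if j = 0 then u else tderiv L T j u)" for j
  have vi: "integrable (lebI T \<Otimes>\<^sub>M lebI L) (case_prod (v j))" if "j \<le> 4" for j
    using L2_time_D(4)[OF L] tderiv_spec(1)[OF u that] u by (auto simp: v_def H_time_def)
  have vw: "weak_tderiv L T j u (v j)" if "j \<le> 4" for j
  proof (cases "j = 0")
    case True
    then show ?thesis by (simp add: v_def weak_tderiv_def)
  qed (use tderiv_spec(2)[OF u that] in \<open>simp add: v_def\<close>)
  have ui: "integrable (lebI T \<Otimes>\<^sub>M lebI L) (case_prod u)" using vi[of 0] by (simp add: v_def)
  have weak: "(\<integral>t. deriv \<phi> t *\<^sub>R fourier_coeff L (v j t) l \<partial>lebI T)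
      = - (\<integral>t. \<phi> t *\<^sub>R fourier_coeff L (v (Suc j) t) l \<partial>lebI T)"
    if j: "j < 4" and \<phi>: "time_test_fun T \<phi>" for j \<phi> l
  proof -
    have "(- 1) ^ j * (\<integral>t. deriv \<phi> t *\<^sub>R fourier_coeff L (v j t) l \<partial>lebI T)
      = (\<integral>t. (deriv ^^ j) (deriv \<phi>) t *\<^sub>R fourier_coeff L (u t) l \<partial>lebI T)"
      by (rule weak_tderiv_coeff[symmetric, OF L ui vi vw test_fun_deriv[OF \<phi>]]) (use j in auto)
    also have "\<dots> = (\<integral>t. (deriv ^^ Suc j) \<phi> t *\<^sub>R fourier_coeff L (u t) l \<partial>lebI T)"
      by (simp only: funpow_Suc_right comp_def)
    also have "\<dots> = (- 1) ^ Suc j * (\<integral>t. \<phi> t *\<^sub>R fourier_coeff L (v (Suc j) t) l \<partial>lebI T)"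
      by (rule weak_tderiv_coeff[OF L ui vi vw \<phi>]) (use j in auto)
    also have "\<dots> = (- 1) ^ j * - (\<integral>t. \<phi> t *\<^sub>R fourier_coeff L (v (Suc j) t) l \<partial>lebI T)" by simp
    finally show ?thesis
      by (subst (asm) mult_cancel_left) auto
  qed
  define P where "P l f \<longleftrightarrow>
    (\<forall>j<4. AE t in lebI T. fourier_coeff L (v j t) l = f j t) \<and>
    (\<forall>j<4. continuous_on {0..T} (f j)) \<and>
    (\<forall>j t. Suc j < 4 \<longrightarrow> t \<in> {0..T} \<longrightarrow> (f j has_vector_derivative f (Suc j) t) (at t within {0..T})) \<and>
    (\<forall>j t. j < 4 \<longrightarrow> t \<in> {0..T} \<longrightarrow> f j t = f j 0 + integral {0..t} (\<lambda>t. fourier_coeff L (v (Suc j) t) l))"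
    for l :: int and f :: "nat \<Rightarrow> real \<Rightarrow> complex"
  have "\<exists>f. P l f" for l
  proof -
    have int: "integrable (lebI T) (\<lambda>t. fourier_coeff L (v j t) l)" if "j \<le> 4" for j
      by (intro integrable_fourier_coeff vi that)
    obtain f :: "nat \<Rightarrow> real \<Rightarrow> complex" where
      "\<And>j. j < 4 \<Longrightarrow> AE t in lebI T. fourier_coeff L (v j t) l = f j t"
      "\<And>j. j < 4 \<Longrightarrow> continuous_on {0..T} (f j)"
      "\<And>j t. Suc j < 4 \<Longrightarrow> t \<in> {0..T} \<Longrightarrow> (f j has_vector_derivative f (Suc j) t) (at t within {0..T})"
      "\<And>j t. j < 4 \<Longrightarrow> t \<in> {0..T} \<Longrightarrow> f j t = f j 0 + integral {0..t} (\<lambda>t. fourier_coeff L (v (Suc j) t) l)"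
      by (rule weak_derivs_imp_classical[where n=4 and a="\<lambda>j t. fourier_coeff L (v j t) l", OF T int weak]) blast+
    then show ?thesis unfolding P_def by blast
  qed
  then obtain f where Pf: "\<And>l. P l (f l)" by metis
  obtain f :: "int \<Rightarrow> nat \<Rightarrow> real \<Rightarrow> complex" where
    f1: "\<And>l j. j < 4 \<Longrightarrow> AE t in lebI T. fourier_coeff L (v j t) l = f l j t" and
    f2: "\<And>l j. j < 4 \<Longrightarrow> continuous_on {0..T} (f l j)" and
    f3: "\<And>l j t. Suc j < 4 \<Longrightarrow> t \<in> {0..T} \<Longrightarrow> (f l j has_vector_derivative f l (Suc j) t) (at t within {0..T})" and
    f4: "\<And>l j t. j < 4 \<Longrightarrow> t \<in> {0..T} \<Longrightarrow> f l j t = f l j 0 + integral {0..t} (\<lambda>t. fourier_coeff L (v (Suc j) t) l)"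
    using Pf unfolding P_def by blast
  show ?thesis
  proof (rule that[of "\<lambda>j l. f l j"])
    fix l t assume t: "t \<in> {0..T}"
    \<comment> \<open>Continuity of \<open>u\<close> gives the identity at every time, as the grid
      times require.\<close>
    show "f l 0 t = fourier_coeff L (u t) l"
    proof (rule AE_lebI_continuous_imp_eq[OF T f2 _ _ t])
      show "continuous_on {0..T} (\<lambda>t. fourier_coeff L (u t) l)"
        by (rule continuous_on_fourier_coeff[OF L continuous_on_subset[OF cont]]) auto
      show "AE t in lebI T. f l 0 t = fourier_coeff L (u t) l"
        using f1[of 0 l] by (auto simp: v_def elim: eventually_mono)
    qed simp
    show "f l 3 t = f l 3 0 + integral {0..t} (\<lambda>s. fourier_coeff L (tderiv L T 4 u s) l)"
      using f4[of 3 t l] t by (simp add: v_def numeral_eq_Suc)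
  next
    fix j :: nat and l assume "j < 4" "0 < j"
    then show "AE t in lebI T. f l j t = fourier_coeff L (tderiv L T j u t) l"
      using f1[of j l] by (auto simp: v_def elim: eventually_mono)
  qed (use f2 f3 in auto)
qed

lemma AE_lebI_continuous_imp_le:
  fixes f :: "real \<Rightarrow> real"
  assumes T: "0 < T" and f: "continuous_on {0..T} f" and AE: "AE t in lebI T. f t \<le> K" and t: "t \<in> {0..T}"
  shows "f t \<le> K"
proof -
  have "max (f t) K = K"
    by (rule AE_lebI_continuous_imp_eq[OF T _ continuous_on_const _ t])
      (use AE in \<open>auto intro!: continuous_intros f elim!: eventually_mono\<close>)
  then show ?thesis by linarith
qed

text \<open>The infimum is attained: the exceptional sets for the bounds increased by
  \<open>1 / (n + 1)\<close> form a countable family.\<close>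

lemma Linf_time_norm_bound:
  assumes "u \<in> Linf_time L T r"
  shows "AE t in lebI T. u t \<in> H_per L r \<and> H_per_norm L r (u t) \<le> Linf_time_norm L T r u"
proof -
  let ?S = "{C. 0 \<le> C \<and> (AE t in lborel. t \<in> {0<..<T} \<longrightarrow> H_per_norm L r (u t) \<le> C)}"
  obtain C where C: "AE t in lborel. t \<in> {0<..<T} \<longrightarrow> H_per_norm L r (u t) \<le> C"
    using assms by (auto simp: Linf_time_def)
  have "max 0 C \<in> ?S" using C by (auto elim!: eventually_mono)
  then have ne: "?S \<noteq> {}" by blast
  have "AE t in lebI T. H_per_norm L r (u t) \<le> Linf_time_norm L T r u + 1 / real (Suc n)" for n
  proof -
    have "Inf ?S < Linf_time_norm L T r u + 1 / real (Suc n)" by (simp add: Linf_time_norm_def)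
    then obtain C where "C \<in> ?S" "C < Linf_time_norm L T r u + 1 / real (Suc n)"
      using cInf_lessD[OF ne] by blast
    then show ?thesis unfolding AE_lebI by (auto elim!: eventually_mono)
  qed
  then have "AE t in lebI T. \<forall>n. H_per_norm L r (u t) \<le> Linf_time_norm L T r u + 1 / real (Suc n)"
    by (subst AE_all_countable) auto
  moreover have "AE t in lebI T. u t \<in> H_per L r" using assms by (simp add: Linf_time_def AE_lebI)
  ultimately show ?thesis
  proof eventually_elim
    case (elim t)
    have "(\<lambda>n. Linf_time_norm L T r u + 1 / real (Suc n)) \<longlonglongrightarrow> Linf_time_norm L T r u + 0"
      by (intro tendsto_intros) (use LIMSEQ_inverse_real_of_nat in \<open>simp add: inverse_eq_divide\<close>)
    then have "H_per_norm L r (u t) \<le> Linf_time_norm L T r u"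
      using elim by (intro LIMSEQ_le_const[of _ "Linf_time_norm L T r u"]) auto
    then show ?case using elim by simp
  qed
qed

text \<open>A finite weighted sum of coefficients is continuous in time, so the essential bound
  holds at every time.\<close>

lemma weighted_coeff_bound_all_times:
  assumes L: "0 < L" and T: "0 < T" and u: "u \<in> Linf_time L T r"
    and cont: "continuous_on ({0..T} \<times> UNIV) (case_prod u)" and t: "t \<in> {0..T}" and S: "finite S"
  shows "(\<Sum>l\<in>S. (1 + \<bar>of_int l\<bar>) ^ (2 * r) * (norm (fourier_coeff L (u t) l))\<^sup>2)
    \<le> sobolev_const L r * (Linf_time_norm L T r u)\<^sup>2"
proof (rule AE_lebI_continuous_imp_le[OF T _ _ t])
  show "continuous_on {0..T} (\<lambda>t. \<Sum>l\<in>S. (1 + \<bar>of_int l\<bar>) ^ (2 * r) * (norm (fourier_coeff L (u t) l))\<^sup>2)"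
    by (intro continuous_intros continuous_on_fourier_coeff[OF L continuous_on_subset[OF cont]]) auto
  show "AE t in lebI T. (\<Sum>l\<in>S. (1 + \<bar>of_int l\<bar>) ^ (2 * r) * (norm (fourier_coeff L (u t) l))\<^sup>2)
    \<le> sobolev_const L r * (Linf_time_norm L T r u)\<^sup>2"
    using Linf_time_norm_bound[OF u]
  proof eventually_elim
    case (elim t)
    have "(\<Sum>l\<in>S. (1 + \<bar>of_int l\<bar>) ^ (2 * r) * (norm (fourier_coeff L (u t) l))\<^sup>2) \<le> sobolev_const L r * (H_per_norm L r (u t))\<^sup>2"
      by (rule weighted_coeff_bound[OF L _ S]) (use elim in simp)
    also have "\<dots> \<le> sobolev_const L r * (Linf_time_norm L T r u)\<^sup>2"
      using elim by (intro mult_left_mono power_mono sobolev_const_nonneg L H_per_norm_nonneg) auto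
    finally show ?case .
  qed
qed

text \<open>At spatial order 0 the function chosen by \<open>tderiv\<close> lies in
  \<open>L2_time L T 0\<close>, so the integrands of \<open>H_time_norm L T k 0\<close> are
  integrable and this norm really controls the derivatives.\<close>

lemma tderiv_coeff_bound:
  assumes L: "0 < L" and u: "u \<in> H_time L T k 0" and j: "j \<le> k" and S: "finite S"
  shows "integrable (lebI T) (\<lambda>t. (norm (fourier_coeff L (tderiv L T j u t) l))\<^sup>2)"
    "(\<Sum>l\<in>S. \<integral>t. (norm (fourier_coeff L (tderiv L T j u t) l))\<^sup>2 \<partial>lebI T) \<le> (H_time_norm L T k 0 u)\<^sup>2 / L"
proof -
  let ?v = "tderiv L T j u"
  note v = tderiv_spec[OF u j]
  note D = L2_time_D[OF L v(1)]
  have B: "AE t in lebI T. (\<Sum>l\<in>S. (norm (fourier_coeff L (?v t) l))\<^sup>2) \<le> (H_per_norm L 0 (?v t))\<^sup>2 / L" if "finite S" for S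
    using D(2)
  proof eventually_elim
    case (elim t)
    have "(\<Sum>l\<in>S. (norm (fourier_coeff L (?v t) l))\<^sup>2) \<le> (L2_norm L (?v t))\<^sup>2 / L"
      by (rule Bessel[OF L H_per_L2[OF elim] that])
    also have "\<dots> \<le> (H_per_norm L 0 (?v t))\<^sup>2 / L"
      using L by (intro divide_right_mono L2_norm_le_H_per_norm elim) auto
    finally show ?case .
  qed
  show int: "integrable (lebI T) (\<lambda>t. (norm (fourier_coeff L (?v t) l))\<^sup>2)" for l
  proof (rule Bochner_Integration.integrable_bound[where f="\<lambda>t. (H_per_norm L 0 (?v t))\<^sup>2 / L"])
    have [measurable]: "(\<lambda>t. fourier_coeff L (?v t) l) \<in> borel_measurable (lebI T)"
      using integrable_fourier_coeff[OF D(4)] by auto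
    show "(\<lambda>t. (norm (fourier_coeff L (?v t) l))\<^sup>2) \<in> borel_measurable (lebI T)" by measurable
    show "AE t in lebI T. norm ((norm (fourier_coeff L (?v t) l))\<^sup>2) \<le> norm ((H_per_norm L 0 (?v t))\<^sup>2 / L)"
      using B[of "{l}"] L by (auto elim!: eventually_mono)
  qed (use D(3) in simp)
  have "(\<Sum>l\<in>S. \<integral>t. (norm (fourier_coeff L (?v t) l))\<^sup>2 \<partial>lebI T) = (\<integral>t. (\<Sum>l\<in>S. (norm (fourier_coeff L (?v t) l))\<^sup>2) \<partial>lebI T)"
    by (rule Bochner_Integration.integral_sum[symmetric]) (rule int)
  also have "\<dots> \<le> (\<integral>t. (H_per_norm L 0 (?v t))\<^sup>2 / L \<partial>lebI T)"
    by (rule integral_mono_AE) (use D(3) int B[OF S] in auto)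
  also have "\<dots> = (\<integral>t. (H_per_norm L 0 (?v t))\<^sup>2 \<partial>lebI T) / L" by simp
  also have "\<dots> \<le> (H_time_norm L T k 0 u)\<^sup>2 / L"
  proof (intro divide_right_mono)
    have "(\<integral>t. (H_per_norm L 0 (?v t))\<^sup>2 \<partial>lebI T) \<le> (\<Sum>j\<le>k. \<integral>t. (H_per_norm L 0 (tderiv L T j u t))\<^sup>2 \<partial>lebI T)"
      using j by (intro member_le_sum) auto
    also have "\<dots> = (H_time_norm L T k 0 u)\<^sup>2"
      unfolding H_time_norm_def integral_lebI[symmetric]
      by (rule real_sqrt_pow2[symmetric]) (intro sum_nonneg, simp)
    finally show "(\<integral>t. (H_per_norm L 0 (?v t))\<^sup>2 \<partial>lebI T) \<le> (H_time_norm L T k 0 u)\<^sup>2" .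
  qed (use L in simp)
  finally show "(\<Sum>l\<in>S. \<integral>t. (norm (fourier_coeff L (?v t) l))\<^sup>2 \<partial>lebI T) \<le> (H_time_norm L T k 0 u)\<^sup>2 / L" .
qed

section \<open>Interpolation between time derivatives\<close>

lemma vector_mvt_bound:
  fixes g :: "real \<Rightarrow> 'a::real_normed_vector"
  assumes "\<And>x. x \<in> {a..b} \<Longrightarrow> (g has_vector_derivative g' x) (at x within {a..b})"
    and B: "\<And>x. x \<in> {a..b} \<Longrightarrow> norm (g' x) \<le> B" and s: "s \<in> {a..b}"
  shows "norm (g s - g a) \<le> B * (s - a)"
proof -
  have "norm (g s - g a) \<le> B * norm (s - a)"
  proof (rule differentiable_bound)
    fix x assume x: "x \<in> {a..b}"
    show "(g has_derivative (\<lambda>h. h *\<^sub>R g' x)) (at x within {a..b})"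
      using assms(1)[OF x] by (simp add: has_vector_derivative_def)
    show "onorm (\<lambda>h. h *\<^sub>R g' x) \<le> B"
      by (rule onorm_le) (simp add: mult.commute[of B] mult_left_mono B[OF x])
  qed (use s in auto)
  then show ?thesis using s by simp
qed

lemma has_vector_derivative_scaleR_const:
  "(h has_real_derivative h') F \<Longrightarrow> ((\<lambda>s. h s *\<^sub>R c) has_vector_derivative h' *\<^sub>R c) F"
  unfolding has_vector_derivative_def has_field_derivative_def
  by (auto dest!: has_derivative_scaleR_left[of _ _ _ c] simp: mult.commute)

text \<open>The oscillation \<open>I\<close> of the third derivative replaces a pointwise bound on
  the fourth. Each estimate applies the mean value inequality to the function minus its Taylor
  polynomial, whose derivative is the previous remainder; inverse factorials are given away.\<close>

lemma Taylor_bounds: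
  fixes f :: "nat \<Rightarrow> real \<Rightarrow> 'a::real_normed_vector"
  assumes ab: "a \<le> b"
    and der: "\<And>j x. j < 3 \<Longrightarrow> x \<in> {a..b} \<Longrightarrow> (f j has_vector_derivative f (Suc j) x) (at x within {a..b})"
    and I: "\<And>x. x \<in> {a..b} \<Longrightarrow> norm (f 3 x - f 3 a) \<le> I" and s: "s \<in> {a..b}"
  shows "norm (f 2 s - f 2 a - (s - a) *\<^sub>R f 3 a) \<le> I * (b - a)"
    "norm (f 1 s - f 1 a - (s - a) *\<^sub>R f 2 a - ((s - a)\<^sup>2 / 2) *\<^sub>R f 3 a) \<le> I * (b - a) ^ 2"
    "norm (f 0 s - f 0 a - (s - a) *\<^sub>R f 1 a - ((s - a)\<^sup>2 / 2) *\<^sub>R f 2 a - ((s - a) ^ 3 / 6) *\<^sub>R f 3 a) \<le> I * (b - a) ^ 3"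
proof -
  have I0: "0 \<le> I" using I[of a] ab by (auto intro: order_trans[OF norm_ge_zero])
  have up: "B * (s - a) \<le> B * (b - a)" if "s \<in> {a..b}" "0 \<le> B" for B s
    using that by (intro mult_left_mono) auto
  have d: "(f 2 has_vector_derivative f 3 x) (at x within {a..b})" "(f 1 has_vector_derivative f 2 x) (at x within {a..b})"
    "(f 0 has_vector_derivative f 1 x) (at x within {a..b})" if "x \<in> {a..b}" for x
    using der[of 2 x] der[of 1 x] der[of 0 x] that by (simp_all add: numeral_eq_Suc)
  have e2: "norm (f 2 s - f 2 a - (s - a) *\<^sub>R f 3 a) \<le> I * (b - a)" if s: "s \<in> {a..b}" for s
  proof -
    have "norm ((f 2 s - (s - a) *\<^sub>R f 3 a) - (f 2 a - (a - a) *\<^sub>R f 3 a)) \<le> I * (s - a)"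
      by (rule vector_mvt_bound[where b=b and g'="\<lambda>x. f 3 x - f 3 a"])
        (use s I d in \<open>auto intro!: derivative_eq_intros\<close>)
    also have "\<dots> \<le> I * (b - a)" by (rule up[OF s I0])
    finally show ?thesis by (simp add: algebra_simps)
  qed
  have e1: "norm (f 1 s - f 1 a - (s - a) *\<^sub>R f 2 a - ((s - a)\<^sup>2 / 2) *\<^sub>R f 3 a) \<le> I * (b - a) ^ 2" if s: "s \<in> {a..b}" for s
  proof -
    have "norm ((f 1 s - (s - a) *\<^sub>R f 2 a - ((s - a)\<^sup>2 / 2) *\<^sub>R f 3 a) - (f 1 a - (a - a) *\<^sub>R f 2 a - ((a - a)\<^sup>2 / 2) *\<^sub>R f 3 a))
        \<le> (I * (b - a)) * (s - a)"
      by (rule vector_mvt_bound[where b=b and g'="\<lambda>x. f 2 x - f 2 a - (x - a) *\<^sub>R f 3 a"])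
        (use s e2 d in \<open>auto intro!: derivative_eq_intros\<close>)
    also have "\<dots> \<le> (I * (b - a)) * (b - a)" by (rule up[OF s]) (use I0 ab in auto)
    finally show ?thesis by (simp add: algebra_simps power2_eq_square)
  qed
  show "norm (f 2 s - f 2 a - (s - a) *\<^sub>R f 3 a) \<le> I * (b - a)"
    "norm (f 1 s - f 1 a - (s - a) *\<^sub>R f 2 a - ((s - a)\<^sup>2 / 2) *\<^sub>R f 3 a) \<le> I * (b - a) ^ 2"
    using e1 e2 s by auto
  have "norm ((f 0 s - (s - a) *\<^sub>R f 1 a - ((s - a)\<^sup>2 / 2) *\<^sub>R f 2 a - ((s - a) ^ 3 / 6) *\<^sub>R f 3 a)
      - (f 0 a - (a - a) *\<^sub>R f 1 a - ((a - a)\<^sup>2 / 2) *\<^sub>R f 2 a - ((a - a) ^ 3 / 6) *\<^sub>R f 3 a)) \<le> (I * (b - a) ^ 2) * (s - a)"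
  proof (rule vector_mvt_bound[where b=b and g'="\<lambda>x. f 1 x - f 1 a - (x - a) *\<^sub>R f 2 a - ((x - a)\<^sup>2 / 2) *\<^sub>R f 3 a"])
    fix x assume x: "x \<in> {a..b}"
    have "((\<lambda>s. (s - a) ^ 3 / 6) has_real_derivative (x - a)\<^sup>2 / 2) (at x within {a..b})"
      by (auto intro!: derivative_eq_intros)
    moreover have "((\<lambda>s. (s - a)\<^sup>2 / 2) has_real_derivative (x - a)) (at x within {a..b})"
      by (auto intro!: derivative_eq_intros)
    moreover have "((\<lambda>s. (s - a)) has_real_derivative 1) (at x within {a..b})"
      by (auto intro!: derivative_eq_intros)
    ultimately show "((\<lambda>s. f 0 s - (s - a) *\<^sub>R f 1 a - ((s - a)\<^sup>2 / 2) *\<^sub>R f 2 a - ((s - a) ^ 3 / 6) *\<^sub>R f 3 a) has_vector_derivative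
       f 1 x - f 1 a - (x - a) *\<^sub>R f 2 a - ((x - a)\<^sup>2 / 2) *\<^sub>R f 3 a) (at x within {a..b})"
      using d(3)[OF x] has_vector_derivative_scaleR_const[of "\<lambda>s. s - a" 1 _ "f 1 a"]
      by (intro has_vector_derivative_diff has_vector_derivative_scaleR_const) auto
  qed (use s e1 in auto)
  also have "\<dots> \<le> (I * (b - a) ^ 2) * (b - a)" by (rule up[OF s]) (use I0 ab in auto)
  finally show "norm (f 0 s - f 0 a - (s - a) *\<^sub>R f 1 a - ((s - a)\<^sup>2 / 2) *\<^sub>R f 2 a - ((s - a) ^ 3 / 6) *\<^sub>R f 3 a) \<le> I * (b - a) ^ 3"
    by (simp add: algebra_simps power3_eq_cube power2_eq_square)
qed

text \<open>Nonnegativity of the variance: with \<open>m\<close> the mean of \<open>g\<close>, the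
  integral of \<open>(g - m)^2\<close> is expanded.\<close>

lemma integral_Cauchy_Schwarz:
  fixes g :: "real \<Rightarrow> real"
  assumes g: "g integrable_on {a..b}" and g2: "(\<lambda>x. (g x)\<^sup>2) integrable_on {a..b}" and ab: "a \<le> b"
  shows "(integral {a..b} g)\<^sup>2 \<le> (b - a) * integral {a..b} (\<lambda>x. (g x)\<^sup>2)"
proof (cases "a = b")
  case False
  then have ab: "a < b" using ab by simp
  let ?G = "integral {a..b} g" and ?A = "integral {a..b} (\<lambda>x. (g x)\<^sup>2)"
  define m where "m = ?G / (b - a)"
  have "((\<lambda>x. (g x)\<^sup>2 - 2 * m * g x + m\<^sup>2) has_integral (?A - 2 * m * ?G + (b - a) *\<^sub>R m\<^sup>2)) {a..b}"
    using has_integral_const_real[of "m\<^sup>2" a b] ab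
    by (intro has_integral_add has_integral_diff has_integral_mult_right integrable_integral g g2) auto
  then have "0 \<le> ?A - 2 * m * ?G + (b - a) *\<^sub>R m\<^sup>2"
  proof (rule has_integral_nonneg)
    fix x
    have "0 \<le> (g x - m)\<^sup>2" by simp
    then show "0 \<le> (g x)\<^sup>2 - 2 * m * g x + m\<^sup>2" by (simp add: power2_eq_square algebra_simps)
  qed
  also have "?A - 2 * m * ?G + (b - a) *\<^sub>R m\<^sup>2 = ?A - ?G\<^sup>2 / (b - a)"
  proof -
    define d where "d = b - a"
    have "d > 0" using ab by (simp add: d_def)
    then show ?thesis unfolding m_def d_def[symmetric] by (simp add: power2_eq_square field_simps)
  qed
  finally show ?thesis using ab by (simp add: field_simps)
qed simp

lemma has_integral_power_01: "((\<lambda>x::real. x ^ n) has_integral 1 / real (Suc n)) {0..1}"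
proof -
  have "((\<lambda>x::real. x ^ n) has_integral (1 ^ Suc n / real (Suc n) - 0 ^ Suc n / real (Suc n))) {0..1}"
    by (rule fundamental_theorem_of_calculus)
      (auto intro!: derivative_eq_intros simp: has_real_derivative_iff_has_vector_derivative[symmetric] simp del: power_Suc of_nat_Suc)
  then show ?thesis by simp
qed

lemma cubic_moment:
  fixes k0 k1 k2 k3 :: real
  shows "((\<lambda>x. (k0 + k1 * x + k2 * x ^ 2 + k3 * x ^ 3) * x ^ n) has_integral
    (k0 / real (n + 1) + k1 / real (n + 2) + k2 / real (n + 3) + k3 / real (n + 4))) {0..1}"
proof -
  have "((\<lambda>x. k0 * x ^ n + k1 * x ^ (n + 1) + k2 * x ^ (n + 2) + k3 * x ^ (n + 3)) has_integral
    (k0 * (1 / real (Suc n)) + k1 * (1 / real (Suc (n + 1))) + k2 * (1 / real (Suc (n + 2))) + k3 * (1 / real (Suc (n + 3))))) {0..1}"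
    by (intro has_integral_add has_integral_mult_right has_integral_power_01)
  then show ?thesis by (simp add: algebra_simps power_add numeral_eq_Suc)
qed

text \<open>The kernel has the moments \<open>v\<close>, so integration against it reads off a linear functional of
  cubic polynomials; on \<open>g\<close> this functional is then perturbed only by the Taylor remainder.\<close>

lemma cubic_functional_bound:
  fixes g :: "real \<Rightarrow> complex" and c :: "nat \<Rightarrow> complex" and k v :: "nat \<Rightarrow> real"
  assumes g: "continuous_on {0..1} g"
    and rem: "\<And>x. x \<in> {0..1} \<Longrightarrow> norm (g x - (\<Sum>n<4. x ^ n *\<^sub>R c n)) \<le> I"
    and v: "\<And>n. n < 4 \<Longrightarrow> k 0 / real (n + 1) + k 1 / real (n + 2) + k 2 / real (n + 3) + k 3 / real (n + 4) = v n"
    and K: "\<bar>k 0\<bar> + \<bar>k 1\<bar> + \<bar>k 2\<bar> + \<bar>k 3\<bar> \<le> K"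
  shows "norm (\<Sum>n<4. v n *\<^sub>R c n) \<le> K * (integral {0..1} (\<lambda>x. norm (g x)) + I)"
proof -
  define p where "p x = k 0 + k 1 * x + k 2 * x ^ 2 + k 3 * x ^ 3" for x :: real
  have pc: "continuous_on {0..1} p" unfolding p_def by (intro continuous_intros)
  have pK: "\<bar>p x\<bar> \<le> K" if "x \<in> {0..1}" for x
  proof -
    have x: "\<bar>x ^ n\<bar> \<le> 1" for n using that by (simp add: power_le_one power_abs)
    have "\<bar>p x\<bar> \<le> \<bar>k 0\<bar> + \<bar>k 1 * x ^ 1\<bar> + \<bar>k 2 * x ^ 2\<bar> + \<bar>k 3 * x ^ 3\<bar>" unfolding p_def by simp
    also have "\<dots> \<le> \<bar>k 0\<bar> + \<bar>k 1\<bar> + \<bar>k 2\<bar> + \<bar>k 3\<bar>"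
      unfolding abs_mult by (intro add_mono order_refl mult_left_le x) auto
    finally show ?thesis using K by simp
  qed
  let ?q = "\<lambda>x. \<Sum>n<4. x ^ n *\<^sub>R c n"
  have "((\<lambda>x. \<Sum>n<4. (p x * x ^ n) *\<^sub>R c n) has_integral (\<Sum>n<4. v n *\<^sub>R c n)) {0..1}"
    unfolding p_def using v
    by (intro has_integral_sum has_integral_scaleR_left) (auto intro: has_integral_eq_rhs[OF cubic_moment])
  then have "(\<Sum>n<4. v n *\<^sub>R c n) = integral {0..1} (\<lambda>x. p x *\<^sub>R ?q x)"
    by (simp add: scaleR_sum_right integral_unique)
  also have "norm \<dots> \<le> integral {0..1} (\<lambda>x. K * (norm (g x) + I))"
  proof (rule integral_norm_bound_integral)
    show "(\<lambda>x. p x *\<^sub>R ?q x) integrable_on {0..1}" by (intro integrable_continuous_real continuous_intros pc)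
    show "(\<lambda>x. K * (norm (g x) + I)) integrable_on {0..1}" by (intro integrable_continuous_real continuous_intros g)
    fix x :: real assume x: "x \<in> {0..1}"
    have "norm (?q x) \<le> norm (g x) + norm (g x - ?q x)" by (metis norm_minus_commute norm_triangle_sub)
    then have "norm (?q x) \<le> norm (g x) + I" using rem[OF x] by linarith
    then show "norm (p x *\<^sub>R ?q x) \<le> K * (norm (g x) + I)"
      using pK[OF x] by (simp only: norm_scaleR) (intro mult_mono, auto)
  qed
  also have "integral {0..1} (\<lambda>x. K * (norm (g x) + I)) = K * (integral {0..1} (\<lambda>x. norm (g x)) + I)"
  proof -
    have "(\<lambda>x. norm (g x)) integrable_on {0..1}" by (intro integrable_continuous_real continuous_intros g)
    then have "((\<lambda>x. K * (norm (g x) + I)) has_integral K * (integral {0..1} (\<lambda>x. norm (g x)) + (1 - 0) *\<^sub>R I)) {0..1}"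
      using has_integral_const_real[of I 0 1]
      by (intro has_integral_mult_right has_integral_add integrable_integral) auto
    from integral_unique[OF this] show ?thesis by (simp only: diff_zero scaleR_one)
  qed
  finally show ?thesis .
qed

text \<open>A round upper bound. The kernels for the cubic coefficients 1, 2, 3 have absolute row
  sums 5700, 13620 and 8820; the factorials 1, 2 and 6 turn these into the bounds 5700, 27240 and
  52920 on the derivatives at 0. The second derivative then needs 27240 + 52920 + 1, the first
  less.\<close>

definition interp_const :: real where "interp_const = 81000"

text \<open>Up to the error \<open>I\<close>, \<open>g 0\<close> is a cubic polynomial, and the
  coefficients of a cubic are controlled by its mean modulus. Taylor's formula carries the bounds
  from 0 to \<open>s\<close>.\<close>

lemma interpolation_unit_interval:
  fixes g :: "nat \<Rightarrow> real \<Rightarrow> complex"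
  assumes der: "\<And>j x. j < 3 \<Longrightarrow> x \<in> {0..1} \<Longrightarrow> (g j has_vector_derivative g (Suc j) x) (at x within {0..1})"
    and I: "\<And>x. x \<in> {0..1} \<Longrightarrow> norm (g 3 x - g 3 0) \<le> I" and s: "s \<in> {0..1}"
  shows "norm (g 1 s) \<le> interp_const * (integral {0..1} (\<lambda>x. norm (g 0 x)) + I)"
    "norm (g 2 s) \<le> interp_const * (integral {0..1} (\<lambda>x. norm (g 0 x)) + I)"
proof -
  note T = Taylor_bounds[where a=0 and b=1, OF _ der I, simplified]
  define c where "c n = (if n = 0 then g 0 0 else if n = 1 then g 1 0 else if n = 2 then (1/2) *\<^sub>R g 2 0 else (1/6) *\<^sub>R g 3 0)" for n :: nat
  have cont: "continuous_on {0..1} (g 0)"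
    using der[of 0] by (intro continuous_on_vector_derivative[where f'="g 1"]) auto
  have rem: "norm (g 0 x - (\<Sum>n<4. x ^ n *\<^sub>R c n)) \<le> I" if "x \<in> {0..1}" for x
    using T(3)[of x] that by (simp add: numeral_eq_Suc c_def algebra_simps)
  let ?B = "integral {0..1} (\<lambda>x. norm (g 0 x)) + I"
  have B0: "0 \<le> ?B"
    using rem[of 0] by (intro add_nonneg_nonneg integral_nonneg integrable_continuous_real continuous_intros cont)
      (auto intro: order_trans[OF norm_ge_zero])
  have lt4: "n < 4 \<longleftrightarrow> n = 0 \<or> n = 1 \<or> n = 2 \<or> n = 3" for n :: nat by auto
  \<comment> \<open>The kernels below are rows 1 to 3, counted from 0, of the inverse of the \<open>4 \<times> 4\<close> Hilbert matrix.\<close>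
  have "norm (\<Sum>n<4. (if n = 1 then 1 else 0) *\<^sub>R c n) \<le> 5700 * ?B"
    by (rule cubic_functional_bound[OF cont rem, where k="\<lambda>i. if i = 0 then - 120 else if i = 1 then 1200 else if i = 2 then - 2700 else 1680"])
      (auto simp: lt4)
  then have c1: "norm (g 1 0) \<le> 5700 * ?B" by (simp add: numeral_eq_Suc c_def)
  have "norm (\<Sum>n<4. (if n = 2 then 1 else 0) *\<^sub>R c n) \<le> 13620 * ?B"
    by (rule cubic_functional_bound[OF cont rem, where k="\<lambda>i. if i = 0 then 240 else if i = 1 then - 2700 else if i = 2 then 6480 else - 4200"])
      (auto simp: lt4)
  then have c2: "norm (g 2 0) \<le> 27240 * ?B" by (simp add: numeral_eq_Suc c_def)
  have "norm (\<Sum>n<4. (if n = 3 then 1 else 0) *\<^sub>R c n) \<le> 8820 * ?B"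
    by (rule cubic_functional_bound[OF cont rem, where k="\<lambda>i. if i = 0 then - 140 else if i = 1 then 1680 else if i = 2 then - 4200 else 2800"])
      (auto simp: lt4)
  then have c3: "norm (g 3 0) \<le> 52920 * ?B" by (simp add: numeral_eq_Suc c_def)
  have IB: "I \<le> ?B" using integral_nonneg[of "\<lambda>x. norm (g 0 x)" "{0..1}"]
    by (simp add: integrable_continuous_real continuous_intros cont)
  have sn: "\<bar>s\<bar> \<le> 1" "s\<^sup>2 \<le> 1" using s by (auto simp: power_le_one)
  have "g 2 s = (g 2 s - g 2 0 - s *\<^sub>R g 3 0) + (g 2 0 + s *\<^sub>R g 3 0)" by simp
  then have "norm (g 2 s) \<le> norm (g 2 s - g 2 0 - s *\<^sub>R g 3 0) + (norm (g 2 0) + norm (s *\<^sub>R g 3 0))"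
    by (metis norm_triangle_le norm_triangle_ineq add_left_mono)
  also have "norm (s *\<^sub>R g 3 0) \<le> 1 * norm (g 3 0)" unfolding norm_scaleR using sn by (intro mult_right_mono) auto
  finally show "norm (g 2 s) \<le> interp_const * ?B"
    using T(1)[of s] s c2 c3 IB B0 by (simp add: interp_const_def)
  have tri: "norm (x + (y + (z + w))) \<le> norm x + (norm y + (norm z + norm w))" for x y z w :: complex
    by (intro order_trans[OF norm_triangle_ineq] add_left_mono norm_triangle_ineq)
  have "norm (g 1 s) \<le> norm (g 1 s - g 1 0 - s *\<^sub>R g 2 0 - (s\<^sup>2 / 2) *\<^sub>R g 3 0) + (norm (g 1 0) + (norm (s *\<^sub>R g 2 0) + norm ((s\<^sup>2 / 2) *\<^sub>R g 3 0)))"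
    using tri[of "g 1 s - g 1 0 - s *\<^sub>R g 2 0 - (s\<^sup>2 / 2) *\<^sub>R g 3 0" "g 1 0" "s *\<^sub>R g 2 0" "(s\<^sup>2 / 2) *\<^sub>R g 3 0"] by simp
  moreover have "norm (s *\<^sub>R g 2 0) \<le> 1 * norm (g 2 0)" unfolding norm_scaleR using sn by (intro mult_right_mono) auto
  moreover have "norm ((s\<^sup>2 / 2) *\<^sub>R g 3 0) \<le> (1 / 2) * norm (g 3 0)" unfolding norm_scaleR using sn by (intro mult_right_mono) auto
  ultimately show "norm (g 1 s) \<le> interp_const * ?B"
    using T(2)[of s] s c1 c2 c3 IB B0 by (simp add: interp_const_def)
qed

text \<open>Rescaling to the unit interval multiplies the derivative of order \<open>j\<close> by
  \<open>d ^ j\<close>, which explains the factor \<open>d ^ 3\<close> at the oscillation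
  \<open>I\<close>.\<close>

lemma interpolation_interval:
  fixes f :: "nat \<Rightarrow> real \<Rightarrow> complex"
  assumes d: "0 < d"
    and der: "\<And>j x. j < 3 \<Longrightarrow> x \<in> {a..a + d} \<Longrightarrow> (f j has_vector_derivative f (Suc j) x) (at x within {a..a + d})"
    and I: "\<And>x. x \<in> {a..a + d} \<Longrightarrow> norm (f 3 x - f 3 a) \<le> I" and s: "s \<in> {a..a + d}"
  shows "d * norm (f 1 s) \<le> interp_const * (1 / d * integral {a..a + d} (\<lambda>x. norm (f 0 x)) + d ^ 3 * I)"
    "d\<^sup>2 * norm (f 2 s) \<le> interp_const * (1 / d * integral {a..a + d} (\<lambda>x. norm (f 0 x)) + d ^ 3 * I)"
proof -
  define g where "g j x = d ^ j *\<^sub>R f j (a + d * x)" for j :: nat and x :: real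
  have sub: "a + d * x \<in> {a..a + d}" if "x \<in> {0..1}" for x
    using that d by (auto simp: mult_left_le)
  have img: "(\<lambda>x. a + d * x) ` {0..1} \<subseteq> {a..a + d}" using sub by blast
  have gder: "(g j has_vector_derivative g (Suc j) x) (at x within {0..1})" if j: "j < 3" and x: "x \<in> {0..1}" for j x
  proof -
    have "(f j has_vector_derivative f (Suc j) (a + d * x)) (at (a + d * x) within (\<lambda>x. a + d * x) ` {0..1})"
      by (rule has_vector_derivative_within_subset[OF der[OF j sub[OF x]] img])
    moreover have "((\<lambda>x. a + d * x) has_vector_derivative d) (at x within {0..1})"
      by (auto intro!: derivative_eq_intros)
    ultimately have "(f j \<circ> (\<lambda>x. a + d * x) has_vector_derivative d *\<^sub>R f (Suc j) (a + d * x)) (at x within {0..1})"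
      by (rule vector_diff_chain_within[rotated])
    then have "((\<lambda>x. d ^ j *\<^sub>R (f j \<circ> (\<lambda>x. a + d * x)) x) has_vector_derivative d ^ j *\<^sub>R (d *\<^sub>R f (Suc j) (a + d * x))) (at x within {0..1})"
      by (rule bounded_linear.has_vector_derivative[OF bounded_linear_scaleR_right])
    then show ?thesis by (simp add: g_def[abs_def] mult.commute)
  qed
  have gI: "norm (g 3 x - g 3 0) \<le> d ^ 3 * I" if "x \<in> {0..1}" for x
  proof -
    have "norm (g 3 x - g 3 0) = d ^ 3 * norm (f 3 (a + d * x) - f 3 a)"
      using d by (simp add: g_def scaleR_diff_right[symmetric])
    also have "\<dots> \<le> d ^ 3 * I" using d I[OF sub[OF that]] by (intro mult_left_mono) auto
    finally show ?thesis .
  qed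
  have cont: "continuous_on {a..a + d} (f 0)"
    using der[of 0] by (intro continuous_on_vector_derivative[where f'="f 1"]) auto
  have int: "integral {0..1} (\<lambda>x. norm (g 0 x)) = 1 / d * integral {a..a + d} (\<lambda>x. norm (f 0 x))"
  proof -
    have "((\<lambda>x. norm (f 0 x)) has_integral integral {a..a + d} (\<lambda>x. norm (f 0 x))) (cbox a (a + d))"
      unfolding cbox_interval by (intro integrable_integral integrable_continuous_real continuous_intros cont)
    from has_integral_affinity[OF this, of d a] d
    have "((\<lambda>x. norm (f 0 (d * x + a))) has_integral (1 / d) * integral {a..a + d} (\<lambda>x. norm (f 0 x)))
        ((\<lambda>x. (1 / d) * x + - (a / d)) ` {a..a + d})" by simp
    also have "(\<lambda>x. (1 / d) * x + - (a / d)) ` {a..a + d} = {0..1}"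
      using d by (subst image_affinity_atLeastAtMost) (auto simp: field_simps)
    finally show ?thesis by (simp add: g_def integral_unique add.commute)
  qed
  have "(s - a) / d \<in> {0..1}" "a + d * ((s - a) / d) = s" using s d by (auto simp: field_simps)
  then show "d * norm (f 1 s) \<le> interp_const * (1 / d * integral {a..a + d} (\<lambda>x. norm (f 0 x)) + d ^ 3 * I)"
    "d\<^sup>2 * norm (f 2 s) \<le> interp_const * (1 / d * integral {a..a + d} (\<lambda>x. norm (f 0 x)) + d ^ 3 * I)"
    using interpolation_unit_interval[OF gder gI, of "(s - a) / d"] d unfolding int by (auto simp: g_def)
qed

lemma power2_sum_le: "(x + y)\<^sup>2 \<le> 2 * (x\<^sup>2 + y\<^sup>2)" for x y :: real
proof -
  have "0 \<le> (x - y)\<^sup>2" by simp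
  then show ?thesis by (simp add: power2_eq_square algebra_simps)
qed

text \<open>After squaring, Cauchy-Schwarz adds one factor \<open>d\<close> to each term:
  \<open>d^(-2)\<close> becomes \<open>1 / d\<close>, and \<open>d^6\<close> becomes
  \<open>d^7\<close>.\<close>

lemma interpolation_interval_L2:
  fixes f :: "nat \<Rightarrow> real \<Rightarrow> complex" and r :: "real \<Rightarrow> real"
  assumes d: "0 < d"
    and der: "\<And>j x. j < 3 \<Longrightarrow> x \<in> {a..a + d} \<Longrightarrow> (f j has_vector_derivative f (Suc j) x) (at x within {a..a + d})"
    and I: "\<And>x. x \<in> {a..a + d} \<Longrightarrow> norm (f 3 x - f 3 a) \<le> integral {a..a + d} r"
    and r: "r integrable_on {a..a + d}" "(\<lambda>x. (r x)\<^sup>2) integrable_on {a..a + d}" and s: "s \<in> {a..a + d}"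
  shows "d\<^sup>2 * (norm (f 1 s))\<^sup>2 \<le> 2 * interp_const\<^sup>2 * (integral {a..a + d} (\<lambda>x. (norm (f 0 x))\<^sup>2) / d + d ^ 7 * integral {a..a + d} (\<lambda>x. (r x)\<^sup>2))"
    "d ^ 4 * (norm (f 2 s))\<^sup>2 \<le> 2 * interp_const\<^sup>2 * (integral {a..a + d} (\<lambda>x. (norm (f 0 x))\<^sup>2) / d + d ^ 7 * integral {a..a + d} (\<lambda>x. (r x)\<^sup>2))"
proof -
  let ?F = "integral {a..a + d} (\<lambda>x. norm (f 0 x))" and ?R = "integral {a..a + d} r"
  let ?F2 = "integral {a..a + d} (\<lambda>x. (norm (f 0 x))\<^sup>2)" and ?R2 = "integral {a..a + d} (\<lambda>x. (r x)\<^sup>2)"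
  have cont: "continuous_on {a..a + d} (f 0)"
    using der[of 0] by (intro continuous_on_vector_derivative[where f'="f 1"]) auto
  have "?F\<^sup>2 \<le> (a + d - a) * ?F2"
    using d by (intro integral_Cauchy_Schwarz integrable_continuous_real continuous_intros cont) auto
  then have F: "?F\<^sup>2 \<le> d * ?F2" by simp
  have "?R\<^sup>2 \<le> (a + d - a) * ?R2" using d by (intro integral_Cauchy_Schwarz r) auto
  then have R: "?R\<^sup>2 \<le> d * ?R2" by simp
  have "(1 / d * ?F + d ^ 3 * ?R)\<^sup>2 \<le> 2 * ((1 / d * ?F)\<^sup>2 + (d ^ 3 * ?R)\<^sup>2)"
    by (rule power2_sum_le)
  also have "\<dots> = 2 * (?F\<^sup>2 / d\<^sup>2 + d ^ 6 * ?R\<^sup>2)" by (simp add: power_mult_distrib power_divide flip: power_mult)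
  also have "\<dots> \<le> 2 * ((d * ?F2) / d\<^sup>2 + d ^ 6 * (d * ?R2))"
    using d by (intro mult_left_mono add_mono divide_right_mono F R) auto
  also have "\<dots> = 2 * (?F2 / d + d ^ 7 * ?R2)" using d by (simp add: power2_eq_square power_numeral_reduce)
  finally have key: "(1 / d * ?F + d ^ 3 * ?R)\<^sup>2 \<le> 2 * (?F2 / d + d ^ 7 * ?R2)" .
  have sq: "y\<^sup>2 \<le> 2 * interp_const\<^sup>2 * (?F2 / d + d ^ 7 * ?R2)"
    if "y \<le> interp_const * (1 / d * ?F + d ^ 3 * ?R)" "0 \<le> y" for y
  proof -
    have "y\<^sup>2 \<le> (interp_const * (1 / d * ?F + d ^ 3 * ?R))\<^sup>2" using that by (rule power_mono)
    also have "\<dots> = interp_const\<^sup>2 * (1 / d * ?F + d ^ 3 * ?R)\<^sup>2" by (rule power_mult_distrib)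
    also have "\<dots> \<le> interp_const\<^sup>2 * (2 * (?F2 / d + d ^ 7 * ?R2))" by (intro mult_left_mono key) simp
    also have "\<dots> = 2 * interp_const\<^sup>2 * (?F2 / d + d ^ 7 * ?R2)" by (simp only: mult_ac)
    finally show ?thesis .
  qed
  note B = interpolation_interval[OF d der I s]
  show "d\<^sup>2 * (norm (f 1 s))\<^sup>2 \<le> 2 * interp_const\<^sup>2 * (?F2 / d + d ^ 7 * ?R2)"
    using sq[OF B(1)] d by (simp add: power_mult_distrib)
  show "d ^ 4 * (norm (f 2 s))\<^sup>2 \<le> 2 * interp_const\<^sup>2 * (?F2 / d + d ^ 7 * ?R2)"
    using sq[OF B(2)] d by (simp add: power_mult_distrib flip: power_mult)
qed

text \<open>The first two summands serve the pointwise bound on the first derivative, the last two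
  the integral bound on the second. The numbers \<open>32 = 2^5\<close> and \<open>16 = 2^4\<close>
  come from rounding down the number of subintervals.\<close>

definition interp_time_const :: "real \<Rightarrow> real" where
  "interp_time_const T = 2 * interp_const\<^sup>2 * (1 / T ^ 3 + 32 * T ^ 5 + 1 / T ^ 4 + 16 * T ^ 4)"

section \<open>Interpolation in time for one function on \<open>[0,T]\<close>\<close>

context
  fixes T :: real and f :: "nat \<Rightarrow> real \<Rightarrow> complex" and r :: "real \<Rightarrow> complex"
  assumes T: "0 < T"
    and der: "\<And>j x. j < 3 \<Longrightarrow> x \<in> {0..T} \<Longrightarrow> (f j has_vector_derivative f (Suc j) x) (at x within {0..T})"
    and f3: "\<And>t. t \<in> {0..T} \<Longrightarrow> f 3 t = f 3 0 + integral {0..t} r"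
    and r: "integrable (lebI T) r" "integrable (lebI T) (\<lambda>t. (norm (r t))\<^sup>2)"
begin

lemma r_integrable:
  assumes "a \<ge> 0" "b \<le> T"
  shows "r integrable_on {a..b}" "(\<lambda>t. norm (r t)) integrable_on {a..b}" "(\<lambda>t. (norm (r t))\<^sup>2) integrable_on {a..b}"
  using assms integral_lebI_indicator(2)[OF r(1) order_refl] integral_lebI_indicator(2)[OF integrable_norm[OF r(1)] order_refl]
    integral_lebI_indicator(2)[OF r(2) order_refl]
  by (auto intro: integrable_on_subinterval)

lemma f3_diff_bound:
  assumes "0 \<le> a" "b \<le> T" "s \<in> {a..b}"
  shows "norm (f 3 s - f 3 a) \<le> integral {a..b} (\<lambda>t. norm (r t))"
proof -
  have "f 3 s - f 3 a = integral {0..s} r - integral {0..a} r" using assms f3[of s] f3[of a] by simp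
  also have "\<dots> = integral {a..s} r"
    using Henstock_Kurzweil_Integration.integral_combine[of 0 a s r] r_integrable(1)[of 0 s] assms by (simp add: algebra_simps)
  also have "norm \<dots> \<le> integral {a..s} (\<lambda>t. norm (r t))"
    by (rule integral_norm_bound_integral) (use r_integrable[of a s] assms in auto)
  also have "\<dots> \<le> integral {a..b} (\<lambda>t. norm (r t))"
    by (rule integral_subset_le) (use r_integrable[of a s] r_integrable[of a b] assms in auto)
  finally show ?thesis .
qed

lemma continuous_f: "j \<le> 2 \<Longrightarrow> continuous_on {0..T} (f j)"
  using der[of j] by (intro continuous_on_vector_derivative[where f'="f (Suc j)"]) auto

text \<open>For a pointwise bound a single window of length \<open>d\<close> around \<open>s\<close>
  suffices, at the price of \<open>A0 / d\<close>. For the integral bound the windows tile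
  \<open>[0,T]\<close>, and integrating over each supplies the factor \<open>d\<close> that removes
  this loss.\<close>

lemma interpolation_partition:
  assumes n: "0 < n" and d: "d = T / real n"
  defines "A0 \<equiv> integral {0..T} (\<lambda>x. (norm (f 0 x))\<^sup>2)" and "A4 \<equiv> integral {0..T} (\<lambda>x. (norm (r x))\<^sup>2)"
  shows "s \<in> {0..T} \<Longrightarrow> d\<^sup>2 * (norm (f 1 s))\<^sup>2 \<le> 2 * interp_const\<^sup>2 * (A0 / d + d ^ 7 * A4)"
    "d ^ 4 * integral {0..T} (\<lambda>x. (norm (f 2 x))\<^sup>2) \<le> 2 * interp_const\<^sup>2 * (A0 + d ^ 8 * A4)"
proof -
  have d0: "0 < d" using n T d by simp
  have nd: "real n * d = T" using n d by simp
  have f0i: "(\<lambda>x. (norm (f 0 x))\<^sup>2) integrable_on {a..b}" "(\<lambda>x. (norm (f 2 x))\<^sup>2) integrable_on {a..b}" if "0 \<le> a" "b \<le> T" for a b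
    by (intro integrable_continuous_real continuous_intros continuous_on_subset[OF continuous_f]; use that in auto)+
  have loc: "d\<^sup>2 * (norm (f 1 s))\<^sup>2 \<le> 2 * interp_const\<^sup>2 * (integral {a..a + d} (\<lambda>x. (norm (f 0 x))\<^sup>2) / d + d ^ 7 * integral {a..a + d} (\<lambda>x. (norm (r x))\<^sup>2))"
    "d ^ 4 * (norm (f 2 s))\<^sup>2 \<le> 2 * interp_const\<^sup>2 * (integral {a..a + d} (\<lambda>x. (norm (f 0 x))\<^sup>2) / d + d ^ 7 * integral {a..a + d} (\<lambda>x. (norm (r x))\<^sup>2))"
    if a: "0 \<le> a" "a + d \<le> T" and s: "s \<in> {a..a + d}" for a s
  proof -
    have "(f j has_vector_derivative f (Suc j) x) (at x within {a..a + d})" if "j < 3" "x \<in> {a..a + d}" for j x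
      using der[of j x] that a by (auto intro: has_vector_derivative_within_subset)
    note L = interpolation_interval_L2[OF d0 this f3_diff_bound[OF a] r_integrable(2,3)[OF a] s]
    show "d\<^sup>2 * (norm (f 1 s))\<^sup>2 \<le> 2 * interp_const\<^sup>2 * (integral {a..a + d} (\<lambda>x. (norm (f 0 x))\<^sup>2) / d + d ^ 7 * integral {a..a + d} (\<lambda>x. (norm (r x))\<^sup>2))"
      "d ^ 4 * (norm (f 2 s))\<^sup>2 \<le> 2 * interp_const\<^sup>2 * (integral {a..a + d} (\<lambda>x. (norm (f 0 x))\<^sup>2) / d + d ^ 7 * integral {a..a + d} (\<lambda>x. (norm (r x))\<^sup>2))"
      using L by auto
  qed
  show "d\<^sup>2 * (norm (f 1 s))\<^sup>2 \<le> 2 * interp_const\<^sup>2 * (A0 / d + d ^ 7 * A4)" if s: "s \<in> {0..T}"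
  proof -
    \<comment> \<open>Near the right end the window is pushed back so as to stay inside
      \<open>[0,T]\<close>.\<close>
    define a where "a = min s (T - d)"
    have "1 * d \<le> real n * d" using n d0 by (intro mult_right_mono) auto
    then have "T - d \<ge> 0" using nd by simp
    then have a: "0 \<le> a" "a + d \<le> T" "s \<in> {a..a + d}" using s d0 by (auto simp: a_def)
    have "integral {a..a + d} (\<lambda>x. (norm (f 0 x))\<^sup>2) \<le> A0" unfolding A0_def
      by (rule integral_subset_le) (use a f0i in auto)
    moreover have "integral {a..a + d} (\<lambda>x. (norm (r x))\<^sup>2) \<le> A4" unfolding A4_def
      by (rule integral_subset_le) (use a r_integrable in auto)
    ultimately have "2 * interp_const\<^sup>2 * (integral {a..a + d} (\<lambda>x. (norm (f 0 x))\<^sup>2) / d + d ^ 7 * integral {a..a + d} (\<lambda>x. (norm (r x))\<^sup>2))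
      \<le> 2 * interp_const\<^sup>2 * (A0 / d + d ^ 7 * A4)"
      using d0 by (intro mult_left_mono add_mono divide_right_mono) auto
    then show ?thesis using loc(1)[OF a] by linarith
  qed
  have "i \<le> n \<Longrightarrow> d ^ 4 * integral {0..real i * d} (\<lambda>x. (norm (f 2 x))\<^sup>2)
    \<le> 2 * interp_const\<^sup>2 * (integral {0..real i * d} (\<lambda>x. (norm (f 0 x))\<^sup>2) + d ^ 8 * integral {0..real i * d} (\<lambda>x. (norm (r x))\<^sup>2))" for i
  proof (induction i)
    case (Suc i)
    let ?a = "real i * d"
    have a: "0 \<le> ?a" "?a + d \<le> T"
      using d0 mult_right_mono[of "real (Suc i)" "real n" d] Suc.prems unfolding nd by (auto simp: algebra_simps)
    have split: "integral {0..real (Suc i) * d} h = integral {0..?a} h + integral {?a..?a + d} h"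
      if "h integrable_on {0..real (Suc i) * d}" for h :: "real \<Rightarrow> real"
      using Henstock_Kurzweil_Integration.integral_combine[of 0 ?a "real (Suc i) * d" h] that a d0 by (simp add: algebra_simps)
    let ?P = "2 * interp_const\<^sup>2 * (integral {?a..?a + d} (\<lambda>x. (norm (f 0 x))\<^sup>2) / d + d ^ 7 * integral {?a..?a + d} (\<lambda>x. (norm (r x))\<^sup>2))"
    have "integral {?a..?a + d} (\<lambda>x. d ^ 4 * (norm (f 2 x))\<^sup>2) \<le> integral {?a..?a + d} (\<lambda>x. ?P)"
      by (rule integral_le) (use loc(2)[OF a] integrable_on_mult_right[OF f0i(2)[OF a]] in auto)
    then have new: "d ^ 4 * integral {?a..?a + d} (\<lambda>x. (norm (f 2 x))\<^sup>2) \<le> d * ?P" using d0 by (simp add: mult.left_commute)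
    have "d * ?P = 2 * interp_const\<^sup>2 * (integral {?a..?a + d} (\<lambda>x. (norm (f 0 x))\<^sup>2) + d ^ 8 * integral {?a..?a + d} (\<lambda>x. (norm (r x))\<^sup>2))"
      using d0 by (simp add: field_simps power_numeral_reduce)
    moreover have "real (Suc i) * d \<le> T" using a by (simp add: algebra_simps)
    ultimately show ?case
      using new Suc by (simp only: split f0i r_integrable order_refl Suc_leD) (simp add: algebra_simps)
  qed simp
  from this[of n] show "d ^ 4 * integral {0..T} (\<lambda>x. (norm (f 2 x))\<^sup>2) \<le> 2 * interp_const\<^sup>2 * (A0 + d ^ 8 * A4)"
    unfolding nd A0_def A4_def by simp
qed

text \<open>With \<open>n\<close> of size \<open>w^(5/4)\<close> and \<open>d = T / n\<close>, the
  factors of \<open>A0\<close> are of size \<open>w^(6 + 15/4)\<close> and \<open>w^(4 + 5)\<close>,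
  both at most \<open>w^10\<close>, and those of \<open>A4\<close> of size
  \<open>w^(6 - 25/4)\<close> and \<open>w^(4 - 5)\<close>, both bounded.\<close>

lemma interpolation_weighted:
  assumes w: "1 \<le> w"
  defines "A0 \<equiv> integral {0..T} (\<lambda>x. (norm (f 0 x))\<^sup>2)" and "A4 \<equiv> integral {0..T} (\<lambda>x. (norm (r x))\<^sup>2)"
  shows "s \<in> {0..T} \<Longrightarrow> w ^ 6 * (norm (f 1 s))\<^sup>2 \<le> interp_time_const T * (w ^ 10 * A0 + A4)"
    "w ^ 4 * integral {0..T} (\<lambda>x. (norm (f 2 x))\<^sup>2) \<le> interp_time_const T * (w ^ 10 * A0 + A4)"
proof -
  \<comment> \<open>The fourth root turns all fractional powers of \<open>w\<close> into natural
    powers of \<open>y\<close>.\<close>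
  define y where "y = sqrt (sqrt w)"
  have y: "1 \<le> y" "y ^ 4 = w"
  proof -
    show "1 \<le> y" using w by (simp add: y_def)
    have "y ^ 4 = (y\<^sup>2)\<^sup>2" by (simp flip: power_mult)
    then show "y ^ 4 = w" using w by (simp add: y_def)
  qed
  \<comment> \<open>A step proportional to \<open>w powr (- 5 / 4)\<close> balances \<open>A0\<close> and \<open>d ^ 8 * A4\<close> when
    \<open>A4\<close> is of the size of \<open>w ^ 10 * A0\<close>.\<close>
  define n where "n = nat \<lfloor>y ^ 5\<rfloor>"
  have y5: "1 \<le> y ^ 5" using y by simp
  have rn: "real n = of_int \<lfloor>y ^ 5\<rfloor>" unfolding n_def using y5 by (intro of_nat_nat) linarith
  have n: "0 < n" "real n \<le> y ^ 5" using y5 unfolding n_def by linarith+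
  have "y ^ 5 \<le> real n + 1" "1 \<le> real n" using rn n(1) by linarith+
  \<comment> \<open>Rounding \<open>y ^ 5\<close> down to a natural number loses at most a factor 2,
    since it is at least 1.\<close>
  then have n3: "y ^ 5 \<le> 2 * real n" by linarith
  note n = n n3
  define d where "d = T / real n"
  have d0: "0 < d" using n T by (simp add: d_def)
  have "0 \<le> A0" unfolding A0_def
    by (auto intro!: integral_nonneg integrable_continuous_real continuous_intros continuous_f)
  moreover have "0 \<le> A4" unfolding A4_def by (auto intro!: integral_nonneg r_integrable)
  ultimately have A: "0 \<le> A0" "0 \<le> A4" by auto
  have w0: "w = y ^ 4" using y by simp
  have p1: "w ^ 6 * real n ^ 3 \<le> w ^ 10"
  proof -
    have "real n ^ 3 \<le> (y ^ 5) ^ 3" by (intro power_mono n) simp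
    moreover have "w ^ 6 = y ^ 24" unfolding w0 by (simp flip: power_mult)
    ultimately have "w ^ 6 * real n ^ 3 \<le> y ^ 24 * (y ^ 5) ^ 3"
      using y by (simp only:) (intro mult_left_mono, auto)
    also have "\<dots> = y ^ 39" by (simp flip: power_mult power_add)
    also have "\<dots> \<le> y ^ 40" using y by (intro power_increasing) auto
    finally show ?thesis unfolding w0 by (simp flip: power_mult)
  qed
  have p2: "w ^ 6 \<le> 32 * real n ^ 5"
  proof -
    have "w ^ 6 = y ^ 24" unfolding w0 by (simp flip: power_mult)
    also have "\<dots> \<le> y ^ 25" using y(1) by (intro power_increasing) auto
    also have "\<dots> = (y ^ 5) ^ 5" by (simp flip: power_mult)
    also have "\<dots> \<le> (2 * real n) ^ 5" using n y by (intro power_mono) auto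
    finally show ?thesis by (simp add: power_mult_distrib)
  qed
  have p3: "w ^ 4 * real n ^ 4 \<le> w ^ 10"
  proof -
    have "real n ^ 4 \<le> (y ^ 5) ^ 4" by (intro power_mono n) simp
    moreover have "w ^ 4 = y ^ 16" unfolding w0 by (simp flip: power_mult)
    ultimately have "w ^ 4 * real n ^ 4 \<le> y ^ 16 * (y ^ 5) ^ 4"
      using y by (simp only:) (intro mult_left_mono, auto)
    also have "\<dots> = y ^ 36" by (simp flip: power_mult power_add)
    also have "\<dots> \<le> y ^ 40" using y by (intro power_increasing) auto
    finally show ?thesis unfolding w0 by (simp flip: power_mult)
  qed
  have p4: "w ^ 4 \<le> 16 * real n ^ 4"
  proof -
    have "w ^ 4 = y ^ 16" unfolding w0 by (simp flip: power_mult)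
    also have "\<dots> \<le> y ^ 20" using y(1) by (intro power_increasing) auto
    also have "\<dots> = (y ^ 5) ^ 4" by (simp flip: power_mult)
    also have "\<dots> \<le> (2 * real n) ^ 4" using n y by (intro power_mono) auto
    finally show ?thesis by (simp add: power_mult_distrib)
  qed
  have K: "0 \<le> 2 * interp_const\<^sup>2" by simp
  have c1: "(w ^ 6 / d ^ 3) * A0 + (w ^ 6 * d ^ 5) * A4 \<le> (1 / T ^ 3 + 32 * T ^ 5 + 1 / T ^ 4 + 16 * T ^ 4) * (w ^ 10 * A0 + A4)"
  proof -
    have "w ^ 6 / d ^ 3 = w ^ 6 * real n ^ 3 / T ^ 3" using n by (simp add: d_def power_divide)
    also have "\<dots> \<le> w ^ 10 / T ^ 3" using p1 T by (intro divide_right_mono) auto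
    finally have a: "w ^ 6 / d ^ 3 * A0 \<le> (1 / T ^ 3) * (w ^ 10 * A0)" using mult_right_mono[OF _ A(1)] by fastforce
    have "w ^ 6 * d ^ 5 = w ^ 6 / real n ^ 5 * T ^ 5" by (simp add: d_def power_divide)
    also have "\<dots> \<le> 32 * T ^ 5" using p2 n T by (intro mult_right_mono) (auto simp: field_simps)
    finally have b: "w ^ 6 * d ^ 5 * A4 \<le> 32 * T ^ 5 * A4" using mult_right_mono[OF _ A(2)] by blast
    have "0 \<le> w ^ 10 * A0" using A w by simp
    then have "(1 / T ^ 3) * (w ^ 10 * A0) + 32 * T ^ 5 * A4 \<le> (1 / T ^ 3 + 32 * T ^ 5 + 1 / T ^ 4 + 16 * T ^ 4) * (w ^ 10 * A0 + A4)"
      using A T by (simp add: algebra_simps)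
    then show ?thesis using a b by linarith
  qed
  have c2: "(w ^ 4 / d ^ 4) * A0 + (w ^ 4 * d ^ 4) * A4 \<le> (1 / T ^ 3 + 32 * T ^ 5 + 1 / T ^ 4 + 16 * T ^ 4) * (w ^ 10 * A0 + A4)"
  proof -
    have "w ^ 4 / d ^ 4 = w ^ 4 * real n ^ 4 / T ^ 4" using n by (simp add: d_def power_divide)
    also have "\<dots> \<le> w ^ 10 / T ^ 4" using p3 T by (intro divide_right_mono) auto
    finally have a: "w ^ 4 / d ^ 4 * A0 \<le> (1 / T ^ 4) * (w ^ 10 * A0)" using mult_right_mono[OF _ A(1)] by fastforce
    have "w ^ 4 * d ^ 4 = w ^ 4 / real n ^ 4 * T ^ 4" by (simp add: d_def power_divide)
    also have "\<dots> \<le> 16 * T ^ 4" using p4 n T by (intro mult_right_mono) (auto simp: field_simps)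
    finally have b: "w ^ 4 * d ^ 4 * A4 \<le> 16 * T ^ 4 * A4" using mult_right_mono[OF _ A(2)] by blast
    have "0 \<le> w ^ 10 * A0" using A w by simp
    then have "(1 / T ^ 4) * (w ^ 10 * A0) + 16 * T ^ 4 * A4 \<le> (1 / T ^ 3 + 32 * T ^ 5 + 1 / T ^ 4 + 16 * T ^ 4) * (w ^ 10 * A0 + A4)"
      using A T by (simp add: algebra_simps)
    then show ?thesis using a b by linarith
  qed
  note P = interpolation_partition[OF n(1) d_def, folded A0_def A4_def]
  show "w ^ 6 * (norm (f 1 s))\<^sup>2 \<le> interp_time_const T * (w ^ 10 * A0 + A4)" if "s \<in> {0..T}"
  proof -
    have "(norm (f 1 s))\<^sup>2 = (d\<^sup>2 * (norm (f 1 s))\<^sup>2) / d\<^sup>2" using d0 by simp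
    also have "\<dots> \<le> (2 * interp_const\<^sup>2 * (A0 / d + d ^ 7 * A4)) / d\<^sup>2" using P(1)[OF that] d0 by (intro divide_right_mono) auto
    also have "\<dots> = 2 * interp_const\<^sup>2 * (1 / d ^ 3 * A0 + d ^ 5 * A4)" using d0 by (simp add: field_simps power_numeral_reduce)
    finally have "w ^ 6 * (norm (f 1 s))\<^sup>2 \<le> w ^ 6 * (2 * interp_const\<^sup>2 * (1 / d ^ 3 * A0 + d ^ 5 * A4))"
      using w by (intro mult_left_mono) auto
    also have "\<dots> = 2 * interp_const\<^sup>2 * ((w ^ 6 / d ^ 3) * A0 + (w ^ 6 * d ^ 5) * A4)" by (simp add: algebra_simps)
    also have "\<dots> \<le> interp_time_const T * (w ^ 10 * A0 + A4)"
      unfolding interp_time_const_def mult.assoc[of "2 * interp_const\<^sup>2"] by (intro mult_left_mono c1 K)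
    finally show ?thesis .
  qed
  show "w ^ 4 * integral {0..T} (\<lambda>x. (norm (f 2 x))\<^sup>2) \<le> interp_time_const T * (w ^ 10 * A0 + A4)"
  proof -
    let ?A = "integral {0..T} (\<lambda>x. (norm (f 2 x))\<^sup>2)"
    have "?A = (d ^ 4 * ?A) / d ^ 4" using d0 by simp
    also have "\<dots> \<le> (2 * interp_const\<^sup>2 * (A0 + d ^ 8 * A4)) / d ^ 4" using P(2) d0 by (intro divide_right_mono) auto
    also have "\<dots> = 2 * interp_const\<^sup>2 * (1 / d ^ 4 * A0 + d ^ 4 * A4)" using d0 by (simp add: field_simps power_numeral_reduce)
    finally have "w ^ 4 * ?A \<le> w ^ 4 * (2 * interp_const\<^sup>2 * (1 / d ^ 4 * A0 + d ^ 4 * A4))"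
      using w by (intro mult_left_mono) auto
    also have "\<dots> = 2 * interp_const\<^sup>2 * ((w ^ 4 / d ^ 4) * A0 + (w ^ 4 * d ^ 4) * A4)" by (simp add: algebra_simps)
    also have "\<dots> \<le> interp_time_const T * (w ^ 10 * A0 + A4)"
      unfolding interp_time_const_def mult.assoc[of "2 * interp_const\<^sup>2"] by (intro mult_left_mono c2 K)
    finally show ?thesis .
  qed
qed
end

section \<open>Projection and aliasing\<close>

definition fcoeff :: "real \<Rightarrow> (real \<Rightarrow> complex) \<Rightarrow> int \<Rightarrow> complex" where
  "fcoeff L g l = (\<integral>x. g x * fourier_mode L (- l) x \<partial>lebI L) / of_real L"

lemma fourier_coeff_eq_fcoeff: "fourier_coeff L f l = fcoeff L (\<lambda>x. of_real (f x)) l"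
  by (simp add: fourier_coeff_lebI fcoeff_def)

lemma integrable_cont_mult_mode:
  "continuous_on UNIV g \<Longrightarrow> integrable (lebI L) (\<lambda>x. g x * fourier_mode L l x)"
  by (intro integrable_lebI_cont continuous_intros) (auto elim: continuous_on_subset)

lemma fcoeff_add:
  assumes "continuous_on UNIV f" "continuous_on UNIV g"
  shows "fcoeff L (\<lambda>x. f x + g x) l = fcoeff L f l + fcoeff L g l"
  using integrable_cont_mult_mode[OF assms(1)] integrable_cont_mult_mode[OF assms(2)]
  by (simp add: fcoeff_def distrib_right add_divide_distrib)

lemma fcoeff_mult: "fcoeff L (\<lambda>x. c * f x) l = c * fcoeff L f l"
  by (simp add: fcoeff_def mult.assoc)

lemma fcoeff_diff:
  assumes "continuous_on UNIV f" "continuous_on UNIV g"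
  shows "fcoeff L (\<lambda>x. f x - g x) l = fcoeff L f l - fcoeff L g l"
  using fcoeff_add[OF assms(1), of "\<lambda>x. (- 1) * g x" L l] assms(2) fcoeff_mult[of L "- 1" g l]
  by (simp add: continuous_on_minus)

lemma fcoeff_mode: "0 < L \<Longrightarrow> fcoeff L (fourier_mode L k) l = (if k = l then 1 else 0)"
  using integral_mode[of L "k - l"] by (simp add: fcoeff_def mode_add[symmetric])

lemma fcoeff_mode_mult: "fcoeff L (\<lambda>x. fourier_mode L k x * g x) l = fcoeff L g (l - k)"
proof -
  have "fourier_mode L k x * g x * fourier_mode L (- l) x = g x * fourier_mode L (- (l - k)) x" for x
  proof -
    have "fourier_mode L (- (l - k)) x = fourier_mode L k x * fourier_mode L (- l) x"
      using mode_add[of L k "- l" x] by simp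
    then show ?thesis by (simp only: mult_ac)
  qed
  then show ?thesis unfolding fcoeff_def by (simp only:)
qed

lemma fcoeff_trig:
  assumes L: "0 < L" and S: "finite S"
  shows "fcoeff L (\<lambda>x. \<Sum>k\<in>S. a k * fourier_mode L k x) l = (if l \<in> S then a l else 0)"
  using S
proof (induction rule: finite_induct)
  case empty
  show ?case by (simp add: fcoeff_def)
next
  case (insert k S)
  have "fcoeff L (\<lambda>x. \<Sum>k\<in>insert k S. a k * fourier_mode L k x) l
      = fcoeff L (\<lambda>x. a k * fourier_mode L k x + (\<Sum>k\<in>S. a k * fourier_mode L k x)) l"
    using insert.hyps by simp
  also have "\<dots> = fcoeff L (\<lambda>x. a k * fourier_mode L k x) l + fcoeff L (\<lambda>x. \<Sum>k\<in>S. a k * fourier_mode L k x) l"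
    by (intro fcoeff_add continuous_intros)
  finally show ?case using insert by (auto simp: fcoeff_mult fcoeff_mode[OF L])
qed

text \<open>A Sobolev norm by coefficients, taken over finite index sets so that no series has to
  converge first. In contrast to \<open>wiener\<close> it applies to any continuous function, and it
  can carry bounds that hold in mean square over the modes only.\<close>

definition sobolev :: "real \<Rightarrow> nat \<Rightarrow> real \<Rightarrow> (real \<Rightarrow> complex) \<Rightarrow> bool" where
  "sobolev L s B g \<longleftrightarrow> continuous_on UNIV g \<and>
    (\<forall>F. finite F \<longrightarrow> L2_set (\<lambda>l. (1 + \<bar>of_int l\<bar>) ^ s * norm (fcoeff L g l)) F \<le> B)"

lemma sobolev_continuous: "sobolev L s B g \<Longrightarrow> continuous_on UNIV g"
  by (simp add: sobolev_def)

lemma sobolev_mono: "sobolev L s B g \<Longrightarrow> B \<le> C \<Longrightarrow> sobolev L s C g"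
  by (auto simp: sobolev_def intro: order_trans)

lemma sobolev_zero: "sobolev L s 0 (\<lambda>x. 0)"
  by (simp add: sobolev_def fcoeff_def L2_set_def)

lemma sobolev_nonneg: "sobolev L s B g \<Longrightarrow> 0 \<le> B"
  unfolding sobolev_def by (metis L2_set_empty finite.emptyI)

lemma sobolev_add:
  assumes f: "sobolev L s B f" and g: "sobolev L s C g"
  shows "sobolev L s (B + C) (\<lambda>x. f x + g x)"
  unfolding sobolev_def
proof (intro conjI allI impI)
  note c = sobolev_continuous[OF f] sobolev_continuous[OF g]
  show "continuous_on UNIV (\<lambda>x. f x + g x)" by (intro continuous_intros c)
  fix F :: "int set" assume F: "finite F"
  let ?w = "\<lambda>l :: int. (1 + \<bar>real_of_int l\<bar>) ^ s"
  have "L2_set (\<lambda>l. ?w l * norm (fcoeff L (\<lambda>x. f x + g x) l)) F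
      \<le> L2_set (\<lambda>l. ?w l * norm (fcoeff L f l) + ?w l * norm (fcoeff L g l)) F"
    unfolding fcoeff_add[OF c] distrib_left[symmetric] by (intro L2_set_mono mult_left_mono norm_triangle_ineq) auto
  also have "\<dots> \<le> L2_set (\<lambda>l. ?w l * norm (fcoeff L f l)) F + L2_set (\<lambda>l. ?w l * norm (fcoeff L g l)) F"
    by (rule L2_set_triangle_ineq)
  also have "\<dots> \<le> B + C" using f g F unfolding sobolev_def by (intro add_mono) auto
  finally show "L2_set (\<lambda>l. ?w l * norm (fcoeff L (\<lambda>x. f x + g x) l)) F \<le> B + C" .
qed

text \<open>The atomic case of Young's inequality for the convolution of an l^1 with an l^2
  sequence: multiplying by a mode translates the coefficients.\<close>

lemma sobolev_mult_mode:
  assumes g: "sobolev L s B g"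
  shows "sobolev L s (norm c * (1 + \<bar>of_int k\<bar>) ^ s * B) (\<lambda>x. c * fourier_mode L k x * g x)"
  unfolding sobolev_def
proof (intro conjI allI impI)
  show "continuous_on UNIV (\<lambda>x. c * fourier_mode L k x * g x)" by (intro continuous_intros sobolev_continuous[OF g])
  fix F :: "int set" assume F: "finite F"
  let ?w = "\<lambda>l :: int. (1 + \<bar>real_of_int l\<bar>) ^ s"
  have "L2_set (\<lambda>l. ?w l * norm (fcoeff L (\<lambda>x. c * fourier_mode L k x * g x) l)) F
      \<le> L2_set (\<lambda>l. (norm c * ?w k) * (?w (l - k) * norm (fcoeff L g (l - k)))) F"
  proof (intro L2_set_mono)
    fix l
    have "?w l \<le> ?w k * ?w (l - k)" using weight_submult[of k "l - k" s] by simp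
    then have "?w l * (norm c * norm (fcoeff L g (l - k))) \<le> (?w k * ?w (l - k)) * (norm c * norm (fcoeff L g (l - k)))"
      by (intro mult_right_mono) auto
    then show "?w l * norm (fcoeff L (\<lambda>x. c * fourier_mode L k x * g x) l)
        \<le> (norm c * ?w k) * (?w (l - k) * norm (fcoeff L g (l - k)))"
      by (simp only: mult.assoc fcoeff_mult fcoeff_mode_mult norm_mult) (simp add: mult_ac)
  qed simp
  also have "\<dots> = (norm c * ?w k) * L2_set (\<lambda>l. ?w (l - k) * norm (fcoeff L g (l - k))) F"
    by (rule L2_set_right_distrib[symmetric]) simp
  \<comment> \<open>The translated index set is again finite, and the bound \<open>B\<close> holds
    uniformly over such sets.\<close>
  also have "L2_set (\<lambda>l. ?w (l - k) * norm (fcoeff L g (l - k))) F = L2_set (\<lambda>l. ?w l * norm (fcoeff L g l)) ((\<lambda>l. l - k) ` F)"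
    unfolding L2_set_def by (subst sum.reindex) (auto simp: inj_on_def)
  also have "(norm c * ?w k) * \<dots> \<le> norm c * ?w k * B"
    using g F unfolding sobolev_def by (intro mult_left_mono) auto
  finally show "L2_set (\<lambda>l. ?w l * norm (fcoeff L (\<lambda>x. c * fourier_mode L k x * g x) l)) F \<le> norm c * ?w k * B" .
qed

lemma sobolev_mult_wiener:
  assumes f: "wiener L s B f" and g: "sobolev L s C g"
  shows "sobolev L s (B * C) (\<lambda>x. f x * g x)"
  using f
proof (induction rule: wiener.induct)
  case zero
  show ?case using sobolev_zero by simp
next
  case (add_mode B f c l)
  show ?case
    using sobolev_add[OF add_mode.IH sobolev_mult_mode[OF g, of c l]] by (simp add: algebra_simps)
next
  case (mono B f D)
  show ?case
    by (rule sobolev_mono[OF mono.IH]) (use mono sobolev_nonneg[OF g] in \<open>auto intro!: mult_right_mono\<close>)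
qed

lemma sobolev_trig:
  assumes L: "0 < L" and S: "finite S"
  shows "sobolev L s (L2_set (\<lambda>l. (1 + \<bar>of_int l\<bar>) ^ s * norm (a l)) S) (\<lambda>x. \<Sum>l\<in>S. a l * fourier_mode L l x)"
  unfolding sobolev_def fcoeff_trig[OF L S]
proof (intro conjI allI impI)
  show "continuous_on UNIV (\<lambda>x. \<Sum>l\<in>S. a l * fourier_mode L l x)" by (intro continuous_intros)
  fix F :: "int set" assume F: "finite F"
  have "(\<Sum>l\<in>F. ((1 + \<bar>real_of_int l\<bar>) ^ s * norm (if l \<in> S then a l else 0))\<^sup>2)
      = (\<Sum>l\<in>F \<inter> S. ((1 + \<bar>real_of_int l\<bar>) ^ s * norm (a l))\<^sup>2)"
    by (intro sum.mono_neutral_cong_right F) auto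
  also have "\<dots> \<le> (\<Sum>l\<in>S. ((1 + \<bar>real_of_int l\<bar>) ^ s * norm (a l))\<^sup>2)"
    by (intro sum_mono2 S) auto
  finally show "L2_set (\<lambda>l. (1 + \<bar>real_of_int l\<bar>) ^ s * norm (if l \<in> S then a l else 0)) F
      \<le> L2_set (\<lambda>l. (1 + \<bar>of_int l\<bar>) ^ s * norm (a l)) S"
    unfolding L2_set_def by (rule real_sqrt_le_mono)
qed

lemma wiener_imp_sobolev:
  assumes L: "0 < L" and f: "wiener L s B f"
  shows "sobolev L s B f"
proof -
  have "sobolev L s 1 (\<lambda>x. 1)"
    using sobolev_trig[OF L, of "{0}" s "\<lambda>_. 1"] by (simp add: L2_set_def)
  from sobolev_mult_wiener[OF f this] show ?thesis by simp
qed

text \<open>With \<open>\<Delta>(n) = X^n - 2 Y^n + Z^n\<close>, the induction uses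
  \<open>\<Delta>(n+1) = Y \<Delta>(n) + (X - Y)(X^n - Y^n) + (Z - Y)(Z^n - Y^n) + Y^n (X - 2 Y +
  Z)\<close>; the factor \<open>n^2\<close> reflects \<open>(n + 1)^2 = n^2 + 2 n + 1\<close>. First
  differences are measured in the algebra norm because they get multiplied. The second difference
  occurs linearly, so a mean square bound suffices for it.\<close>

lemma sobolev_power_second_diff:
  assumes L: "0 < L" and X: "wiener L s R X" and Y: "wiener L s R Y" and Z: "wiener L s R Z"
    and XY: "wiener L s D (\<lambda>x. X x - Y x)" and ZY: "wiener L s D (\<lambda>x. Z x - Y x)"
    and XYZ: "sobolev L s E (\<lambda>x. X x - 2 * Y x + Z x)" and R: "1 \<le> R"
  shows "sobolev L s (real n ^ 2 * R ^ n * (E + 2 * D ^ 2)) (\<lambda>x. X x ^ n - 2 * Y x ^ n + Z x ^ n)"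
proof (induction n)
  case 0
  show ?case using sobolev_zero by simp
next
  case (Suc n)
  let ?b = "real n ^ 2 * R ^ n * (E + 2 * D ^ 2)" and ?d = "real n * R ^ n * D"
  have E: "0 \<le> E" "0 \<le> D" using sobolev_nonneg[OF XYZ] wiener_nonneg[OF XY] by auto
  have "sobolev L s (R * ?b + D * ?d + D * ?d + R ^ n * E)
     (\<lambda>x. Y x * (X x ^ n - 2 * Y x ^ n + Z x ^ n) + (X x - Y x) * (X x ^ n - Y x ^ n)
        + (Z x - Y x) * (Z x ^ n - Y x ^ n) + Y x ^ n * (X x - 2 * Y x + Z x))"
    by (intro sobolev_add sobolev_mult_wiener wiener_imp_sobolev[OF L] Suc wiener_power wiener_power_diff X Y Z XY ZY XYZ R)
  moreover have "R * ?b + D * ?d + D * ?d + R ^ n * E \<le> real (Suc n) ^ 2 * R ^ Suc n * (E + 2 * D ^ 2)"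
  proof -
    have RR: "R ^ n \<le> R ^ Suc n" using R by simp
    have "R * ?b = real n ^ 2 * R ^ Suc n * (E + 2 * D ^ 2)" by simp
    moreover have "D * ?d + D * ?d \<le> 2 * real n * R ^ Suc n * (E + 2 * D ^ 2)"
    proof -
      have "D * ?d + D * ?d = R ^ n * (2 * real n * D ^ 2)" by (simp add: power2_eq_square)
      also have "\<dots> \<le> R ^ Suc n * (2 * real n * (E + 2 * D ^ 2))"
        using E R by (intro mult_mono RR mult_left_mono) auto
      also have "\<dots> = 2 * real n * R ^ Suc n * (E + 2 * D ^ 2)" by (simp only: mult_ac)
      finally show ?thesis .
    qed
    moreover have "R ^ n * E \<le> R ^ Suc n * (E + 2 * D ^ 2)" using E R by (intro mult_mono RR) auto
    ultimately have "R * ?b + D * ?d + D * ?d + R ^ n * E \<le>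
      real n ^ 2 * R ^ Suc n * (E + 2 * D ^ 2) + 2 * real n * R ^ Suc n * (E + 2 * D ^ 2) + R ^ Suc n * (E + 2 * D ^ 2)"
      by linarith
    also have "\<dots> = real (Suc n) ^ 2 * R ^ Suc n * (E + 2 * D ^ 2)" by (simp add: power2_eq_square algebra_simps)
    finally show ?thesis .
  qed
  ultimately show ?case by (auto intro: sobolev_mono simp: algebra_simps)
qed

text \<open>The second space derivative of the projection of \<open>g\<close>, with multiplier
  \<open>- (freq L l)^2\<close>. Its companion \<open>interp_xx\<close> below is the same for the
  interpolant of \<open>g\<close>, which on the grid is \<open>discrete_deriv\<close> applied
  twice.\<close>

definition proj_xx :: "real \<Rightarrow> nat \<Rightarrow> (real \<Rightarrow> complex) \<Rightarrow> real \<Rightarrow> complex" where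
  "proj_xx L N g x = (\<Sum>l = - int N..int N. - of_real ((freq L l)\<^sup>2) * fcoeff L g l * fourier_mode L l x)"

definition interp_xx :: "real \<Rightarrow> nat \<Rightarrow> (real \<Rightarrow> complex) \<Rightarrow> real \<Rightarrow> complex" where
  "interp_xx L N g x = (\<Sum>l = - int N..int N. - of_real ((freq L l)\<^sup>2) *
     discrete_coeff L N (\<lambda>j. g (grid_point L N j)) l * fourier_mode L l x)"

lemma proj_xx_add:
  "continuous_on UNIV f \<Longrightarrow> continuous_on UNIV g \<Longrightarrow> proj_xx L N (\<lambda>x. f x + g x) y = proj_xx L N f y + proj_xx L N g y"
  unfolding proj_xx_def sum.distrib[symmetric] by (intro sum.cong refl) (simp only: fcoeff_add distrib_left distrib_right)

lemma proj_xx_mult: "proj_xx L N (\<lambda>x. c * f x) y = c * proj_xx L N f y"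
  by (simp add: proj_xx_def fcoeff_mult sum_distrib_left algebra_simps)

lemma proj_xx_diff:
  "continuous_on UNIV f \<Longrightarrow> continuous_on UNIV g \<Longrightarrow> proj_xx L N (\<lambda>x. f x - g x) y = proj_xx L N f y - proj_xx L N g y"
  unfolding proj_xx_def sum_subtractf[symmetric]
  by (intro sum.cong refl) (simp only: fcoeff_diff left_diff_distrib right_diff_distrib)

lemma interp_xx_add: "interp_xx L N (\<lambda>x. f x + g x) y = interp_xx L N f y + interp_xx L N g y"
  unfolding interp_xx_def sum.distrib[symmetric]
  by (intro sum.cong refl) (simp only: discrete_coeff_add distrib_left distrib_right)

lemma interp_xx_mult: "interp_xx L N (\<lambda>x. c * f x) y = c * interp_xx L N f y"
  by (simp add: interp_xx_def discrete_coeff_mult sum_distrib_left algebra_simps)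

lemma proj_xx_mode:
  assumes "0 < L"
  shows "proj_xx L N (fourier_mode L k) x = (if \<bar>k\<bar> \<le> int N then - of_real ((freq L k)\<^sup>2) * fourier_mode L k x else 0)"
proof -
  have "proj_xx L N (fourier_mode L k) x = (\<Sum>l = - int N..int N. if k = l then - of_real ((freq L l)\<^sup>2) * fourier_mode L l x else 0)"
    unfolding proj_xx_def fcoeff_mode[OF assms] by (intro sum.cong) auto
  also have "\<dots> = (if \<bar>k\<bar> \<le> int N then - of_real ((freq L k)\<^sup>2) * fourier_mode L k x else 0)"
    by (auto simp: abs_le_iff)
  finally show ?thesis .
qed

lemma freq_square_le:
  assumes "0 < L" "\<bar>l\<bar> \<le> int N"
  shows "(freq L l)\<^sup>2 \<le> (2 * pi / L)\<^sup>2 * (real N)\<^sup>2"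
proof -
  have "\<bar>freq L l\<bar> = 2 * pi / L * \<bar>of_int l\<bar>" using assms by (simp add: freq_def abs_mult)
  also have "\<dots> \<le> 2 * pi / L * real N"
  proof (rule mult_left_mono)
    show "\<bar>real_of_int l\<bar> \<le> real N" using assms by linarith
  qed (use assms in simp)
  finally have "\<bar>freq L l\<bar>\<^sup>2 \<le> (2 * pi / L * real N)\<^sup>2" by (intro power_mono) auto
  then show ?thesis by (simp only: power2_abs power_mult_distrib)
qed

lemma proj_xx_wiener_bound:
  assumes L: "0 < L" and g: "wiener L 2 B g"
  shows "norm (proj_xx L N g x) \<le> (2 * pi / L)\<^sup>2 * B"
proof (rule wiener_functional_bound[OF g, where \<Lambda>="\<lambda>g. proj_xx L N g x"])
  show "proj_xx L N (\<lambda>x. f x + c * fourier_mode L l x) x = proj_xx L N f x + c * proj_xx L N (fourier_mode L l) x"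
    if "continuous_on UNIV f" for f c l
    using that by (simp add: proj_xx_add proj_xx_mult continuous_on_mode continuous_intros)
  fix l
  have "(freq L l)\<^sup>2 = (2 * pi / L)\<^sup>2 * \<bar>of_int l\<bar>\<^sup>2" by (simp add: freq_def power_mult_distrib power_divide)
  also have "\<dots> \<le> (2 * pi / L)\<^sup>2 * (1 + \<bar>of_int l\<bar>)\<^sup>2" by (intro mult_left_mono power_mono) auto
  finally show "norm (proj_xx L N (fourier_mode L l) x) \<le> (2 * pi / L)\<^sup>2 * (1 + \<bar>of_int l\<bar>)\<^sup>2"
    by (simp add: proj_xx_mode[OF L] norm_mult norm_power)
qed

text \<open>Modes of degree at most \<open>N\<close> are interpolated exactly; a higher mode is aliased to one of
  degree at most \<open>N\<close>, and the factor \<open>N\<^sup>2\<close> from differentiating is paid for by its weight.\<close>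

lemma aliasing_bound:
  assumes L: "0 < L" and g: "wiener L (m + 2) B g"
  shows "norm (proj_xx L N g x - interp_xx L N g x) \<le> ((2 * pi / L)\<^sup>2 * (2 / (2 * real N + 1)) ^ m) * B"
proof (rule wiener_functional_bound[OF g, where \<Lambda>="\<lambda>g. proj_xx L N g x - interp_xx L N g x"])
  let ?C = "(2 * pi / L)\<^sup>2 * (2 / (2 * real N + 1)) ^ m"
  show "proj_xx L N (\<lambda>x. f x + c * fourier_mode L l x) x - interp_xx L N (\<lambda>x. f x + c * fourier_mode L l x) x
     = proj_xx L N f x - interp_xx L N f x + c * (proj_xx L N (fourier_mode L l) x - interp_xx L N (fourier_mode L l) x)"
    if "continuous_on UNIV f" for f c l
    using that by (simp add: proj_xx_add proj_xx_mult interp_xx_add interp_xx_mult continuous_on_mode continuous_intros algebra_simps)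
  fix k
  have disc: "interp_xx L N (fourier_mode L k) x = (\<Sum>l = - int N..int N. if (2 * int N + 1) dvd (k - l) then - of_real ((freq L l)\<^sup>2) * fourier_mode L l x else 0)"
    unfolding interp_xx_def using L by (intro sum.cong refl) (simp add: discrete_coeff_mode)
  show "norm (proj_xx L N (fourier_mode L k) x - interp_xx L N (fourier_mode L k) x) \<le> ?C * (1 + \<bar>of_int k\<bar>) ^ (m + 2)"
  proof (cases "\<bar>k\<bar> \<le> int N")
    case True
    have "interp_xx L N (fourier_mode L k) x = (\<Sum>l = - int N..int N. if k = l then - of_real ((freq L l)\<^sup>2) * fourier_mode L l x else 0)"
      unfolding disc by (intro sum.cong refl) (use True dvd_mode_diff_iff[of k N] in auto)
    also have "\<dots> = - of_real ((freq L k)\<^sup>2) * fourier_mode L k x" using True by (auto simp: abs_le_iff)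
    finally show ?thesis using True L by (simp add: proj_xx_mode[OF L])
  next
    case False
    \<comment> \<open>A high mode has at most one alias: two candidates would differ by a multiple
      of \<open>2 N + 1\<close>.\<close>
    have "card {l \<in> {- int N..int N}. (2 * int N + 1) dvd (k - l)} \<le> 1"
    proof (subst One_nat_def, rule card_le_Suc0_iff_eq[THEN iffD2])
      show "\<forall>a\<in>{l \<in> {- int N..int N}. (2 * int N + 1) dvd (k - l)}. \<forall>b\<in>{l \<in> {- int N..int N}. (2 * int N + 1) dvd (k - l)}. a = b"
      proof (intro ballI)
        fix a b assume ab: "a \<in> {l \<in> {- int N..int N}. (2 * int N + 1) dvd (k - l)}" "b \<in> {l \<in> {- int N..int N}. (2 * int N + 1) dvd (k - l)}"
        then have "(2 * int N + 1) dvd (k - b)" "(2 * int N + 1) dvd (k - a)" by auto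
        from dvd_diff[OF this] have "(2 * int N + 1) dvd ((k - b) - (k - a))" .
        then have "(2 * int N + 1) dvd (a - b)" by simp
        then show "a = b" using ab dvd_mode_diff_iff[of a N b] by auto
      qed
    qed (rule finite_subset[of _ "{- int N..int N}"], auto)
    then have card: "real (card {l \<in> {- int N..int N}. (2 * int N + 1) dvd (k - l)}) \<le> 1" by simp
    have "norm (interp_xx L N (fourier_mode L k) x) \<le> (\<Sum>l = - int N..int N. if (2 * int N + 1) dvd (k - l) then (2 * pi / L)\<^sup>2 * (real N)\<^sup>2 else 0)"
      unfolding disc by (intro sum_norm_le) (use freq_square_le[OF L] in \<open>auto simp: norm_mult norm_power abs_le_iff\<close>)
    also have "\<dots> = real (card {l \<in> {- int N..int N}. (2 * int N + 1) dvd (k - l)}) * ((2 * pi / L)\<^sup>2 * (real N)\<^sup>2)"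
      by (subst sum.inter_filter[symmetric]) auto
    also have "\<dots> \<le> 1 * ((2 * pi / L)\<^sup>2 * (real N)\<^sup>2)" by (intro mult_right_mono card) auto
    also have "\<dots> \<le> (2 * pi / L)\<^sup>2 * ((2 / (2 * real N + 1)) ^ m * (1 + \<bar>of_int k\<bar>) ^ (m + 2))"
    proof -
      have k: "real N + 1 \<le> \<bar>of_int k\<bar>" using False by linarith
      \<comment> \<open>Beyond degree \<open>N\<close> the weight exceeds half of
        \<open>2 N + 1\<close>; \<open>m\<close> powers of the weight are exchanged for
        \<open>m\<close> powers of the mesh width.\<close>
      have "1 \<le> 2 / (2 * real N + 1) * (1 + \<bar>of_int k\<bar>)" using k by (simp add: field_simps)
      then have "1 \<le> (2 / (2 * real N + 1) * (1 + \<bar>of_int k\<bar>)) ^ m" by (rule one_le_power)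
      moreover have "(real N)\<^sup>2 \<le> (1 + \<bar>of_int k\<bar>)\<^sup>2" using k by (intro power_mono) auto
      ultimately have "1 * (real N)\<^sup>2 \<le> (2 / (2 * real N + 1) * (1 + \<bar>of_int k\<bar>)) ^ m * (1 + \<bar>of_int k\<bar>)\<^sup>2"
        by (intro mult_mono) auto
      also have "\<dots> = (2 / (2 * real N + 1)) ^ m * (1 + \<bar>of_int k\<bar>) ^ (m + 2)"
        unfolding power_mult_distrib power_add by (simp only: mult.assoc)
      finally show ?thesis by (simp add: mult_left_mono)
    qed
    finally show ?thesis using False by (simp add: proj_xx_mode[OF L] mult.assoc)
  qed
qed

text \<open>Discrete Parseval makes the grid average an exact sum over modes, so only the weight
  \<open>w^2\<close> is spent, the one required by two derivatives.\<close>

lemma proj_xx_sobolev_bound: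
  assumes L: "0 < L" and g: "sobolev L 2 B g"
  shows "(\<Sum>i\<le>2 * N. (norm (proj_xx L N g (grid_point L N i)))\<^sup>2) / real (2 * N + 1) \<le> ((2 * pi / L)\<^sup>2 * B)\<^sup>2"
proof -
  let ?w = "\<lambda>l :: int. (1 + \<bar>real_of_int l\<bar>) ^ 2 * norm (fcoeff L g l)"
  have "(\<Sum>i\<le>2 * N. (norm (proj_xx L N g (grid_point L N i)))\<^sup>2) / real (2 * N + 1)
     = (\<Sum>l = - int N..int N. (norm (- of_real ((freq L l)\<^sup>2) * fcoeff L g l))\<^sup>2)"
    unfolding proj_xx_def by (rule discrete_Parseval) (use L in simp)
  also have "\<dots> \<le> (\<Sum>l = - int N..int N. ((2 * pi / L)\<^sup>2 * ?w l)\<^sup>2)"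
  proof (intro sum_mono power_mono)
    fix l
    have "(freq L l)\<^sup>2 = (2 * pi / L)\<^sup>2 * \<bar>of_int l\<bar>\<^sup>2" by (simp add: freq_def power_mult_distrib power_divide)
    also have "\<dots> \<le> (2 * pi / L)\<^sup>2 * (1 + \<bar>of_int l\<bar>)\<^sup>2" by (intro mult_left_mono power_mono) auto
    finally have "(freq L l)\<^sup>2 * norm (fcoeff L g l) \<le> (2 * pi / L)\<^sup>2 * (1 + \<bar>of_int l\<bar>)\<^sup>2 * norm (fcoeff L g l)"
      by (intro mult_right_mono) auto
    then show "norm (- of_real ((freq L l)\<^sup>2) * fcoeff L g l) \<le> (2 * pi / L)\<^sup>2 * ?w l"
      by (simp add: norm_mult norm_power mult.assoc)
  qed simp
  also have "\<dots> = ((2 * pi / L)\<^sup>2)\<^sup>2 * (\<Sum>l = - int N..int N. (?w l)\<^sup>2)"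
    by (simp only: power_mult_distrib sum_distrib_left)
  also have "\<dots> \<le> ((2 * pi / L)\<^sup>2)\<^sup>2 * B\<^sup>2"
  proof (rule mult_left_mono)
    have "L2_set ?w {- int N..int N} \<le> B" using g unfolding sobolev_def by simp
    then have "(L2_set ?w {- int N..int N})\<^sup>2 \<le> B\<^sup>2" by (intro power_mono) auto
    then show "(\<Sum>l = - int N..int N. (?w l)\<^sup>2) \<le> B\<^sup>2" by (simp add: L2_set_def sum_nonneg)
  qed simp
  finally show ?thesis by (simp add: power_mult_distrib)
qed

section \<open>Truncation of the nonlinearity\<close>

definition trunc :: "real \<Rightarrow> nat \<Rightarrow> (real \<Rightarrow> real) \<Rightarrow> real \<Rightarrow> complex" where
  "trunc L N f x = (\<Sum>l = - int N..int N. fourier_coeff L f l * fourier_mode L l x)"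

lemma fourier_proj_trunc: "complex_of_real (fourier_proj L N f x) = trunc L N f x"
  unfolding fourier_proj_def trunc_def by (rule sum_mode_real) (rule fourier_coeff_cnj)

lemma continuous_on_trunc: "continuous_on A (trunc L N f)"
  unfolding trunc_def[abs_def] by (intro continuous_intros)

text \<open>Pairing \<open>n\<close> with \<open>- n\<close> presents symmetric truncations as
  partial sums of an ordinary series.\<close>

lemma sum_symmetric_Suc:
  fixes h :: "int \<Rightarrow> 'a::comm_monoid_add"
  shows "(\<Sum>l = - int N..int N. h l) = (\<Sum>n<Suc N. if n = 0 then h 0 else h (int n) + h (- int n))"
proof (induction N)
  case (Suc N)
  have "{- int (Suc N)..int (Suc N)} = insert (int (Suc N)) (insert (- int (Suc N)) {- int N..int N})" by auto
  then have "(\<Sum>l = - int (Suc N)..int (Suc N). h l) = h (int (Suc N)) + (h (- int (Suc N)) + (\<Sum>l = - int N..int N. h l))"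
    by simp
  then show ?case unfolding Suc sum.lessThan_Suc[of _ "Suc N"] by (simp add: ac_simps)
qed simp

text \<open>Absolute summability gives a uniform, hence continuous, limit with the Fourier
  coefficients of \<open>f\<close>. Completeness identifies it with \<open>f\<close> almost
  everywhere, continuity everywhere on \<open>[0,L]\<close>.\<close>

lemma trunc_tendsto:
  assumes L: "0 < L" and f: "continuous_on UNIV f"
    and R: "\<And>S. finite S \<Longrightarrow> (\<Sum>l\<in>S. norm (fourier_coeff L f l)) \<le> R"
    and x: "x \<in> {0..L}"
  shows "(\<lambda>N. trunc L N f x) \<longlonglongrightarrow> of_real (f x)"
proof -
  let ?c = "fourier_coeff L f"
  define g where "g n x = (if n = 0 then ?c 0 * fourier_mode L 0 x
     else ?c (int n) * fourier_mode L (int n) x + ?c (- int n) * fourier_mode L (- int n) x)" for n :: nat and x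
  define M where "M n = (if n = 0 then norm (?c 0) else norm (?c (int n)) + norm (?c (- int n)))" for n :: nat
  have tr: "trunc L N f x = (\<Sum>n<Suc N. g n x)" for N x
    unfolding trunc_def g_def by (rule sum_symmetric_Suc)
  have gM: "norm (g n x) \<le> M n" for n x
    unfolding g_def M_def by (auto simp: norm_mult intro!: order_trans[OF norm_triangle_ineq])
  have summ: "summable M"
  proof (rule bounded_imp_summable[of _ R])
    show "0 \<le> M n" for n by (simp add: M_def)
    show "(\<Sum>k\<le>n. M k) \<le> R" for n
      using R[of "{- int n..int n}"] sum_symmetric_Suc[of "\<lambda>l. norm (?c l)" n] unfolding M_def lessThan_Suc_atMost by simp
  qed
  define F where "F x = (\<Sum>n. g n x)" for x
  have ul: "uniform_limit UNIV (\<lambda>n x. \<Sum>i<n. g i x) F sequentially"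
    unfolding F_def[abs_def] by (rule Weierstrass_m_test[OF gM summ])
  have gc: "continuous_on A (g n)" for A n unfolding g_def[abs_def] by (cases "n = 0") (auto intro!: continuous_intros)
  have Fc: "continuous_on UNIV F"
    by (rule uniform_limit_theorem[OF _ ul]) (auto intro!: always_eventually continuous_intros gc)
  have lim: "(\<lambda>N. trunc L N f x) \<longlonglongrightarrow> F x" for x
    unfolding tr using tendsto_uniform_limitI[OF ul UNIV_I, of x] by (rule LIMSEQ_Suc)
  have bound: "norm (trunc L N f x) \<le> R" for N x
  proof -
    have "norm (trunc L N f x) \<le> (\<Sum>l = - int N..int N. norm (?c l))"
      unfolding trunc_def by (rule sum_norm_le) (simp add: norm_mult)
    then show ?thesis using R[of "{- int N..int N}"] by simp
  qed
  interpret finite_measure "lebI L" by (rule finite_measure_lebI)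
  have Fl: "(\<integral>x. F x * fourier_mode L l x \<partial>lebI L) = (\<integral>x. of_real (f x) * fourier_mode L l x \<partial>lebI L)" for l
  proof -
    have "(\<lambda>N. \<integral>x. trunc L N f x * fourier_mode L l x \<partial>lebI L) \<longlonglongrightarrow> (\<integral>x. F x * fourier_mode L l x \<partial>lebI L)"
    proof (rule integral_dominated_convergence[where w="\<lambda>_. R"])
      show "AE x in lebI L. (\<lambda>N. trunc L N f x * fourier_mode L l x) \<longlonglongrightarrow> F x * fourier_mode L l x"
        by (intro AE_I2 tendsto_intros lim)
    qed (auto intro!: continuous_measurable_lebI continuous_intros continuous_on_trunc continuous_on_subset[OF Fc] bound simp: norm_mult)
    moreover have "\<forall>\<^sub>F N in sequentially. (\<integral>x. trunc L N f x * fourier_mode L l x \<partial>lebI L) = (\<integral>x. of_real (f x) * fourier_mode L l x \<partial>lebI L)"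
    proof (rule eventually_sequentiallyI[of "nat \<bar>l\<bar>"])
      fix N assume "nat \<bar>l\<bar> \<le> N"
      then have "fcoeff L (trunc L N f) (- l) = fourier_coeff L f (- l)"
        unfolding trunc_def[abs_def] by (subst fcoeff_trig[OF L]) auto
      then show "(\<integral>x. trunc L N f x * fourier_mode L l x \<partial>lebI L) = (\<integral>x. of_real (f x) * fourier_mode L l x \<partial>lebI L)"
        using L by (simp add: fcoeff_def fourier_coeff_lebI)
    qed
    ultimately have "(\<lambda>N. (\<integral>x. of_real (f x) * fourier_mode L l x \<partial>lebI L)) \<longlonglongrightarrow> (\<integral>x. F x * fourier_mode L l x \<partial>lebI L)"
      by (rule Lim_transform_eventually)
    then show ?thesis by (simp add: LIMSEQ_const_iff)
  qed
  have real: "F x = of_real (Re (F x))" for x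
  proof -
    have "(\<lambda>N. Im (trunc L N f x)) \<longlonglongrightarrow> Im (F x)" by (intro tendsto_intros lim)
    then have "Im (F x) = 0"
      unfolding fourier_proj_trunc[symmetric] by (simp add: LIMSEQ_const_iff)
    then show ?thesis by (simp add: complex_eq_iff)
  qed
  have ReF: "continuous_on {0..L} (\<lambda>x. Re (F x))" by (intro continuous_intros continuous_on_subset[OF Fc]) auto
  have fc: "continuous_on {0..L} f" by (rule continuous_on_subset[OF f]) auto
  have "AE x in lebI L. Re (F x) - f x = 0"
  proof (rule fourier_completeness[OF L])
    show "integrable (lebI L) (\<lambda>x. Re (F x) - f x)" by (intro integrable_lebI_cont continuous_intros ReF fc)
    fix l
    have "(\<integral>x. of_real (Re (F x) - f x) * fourier_mode L l x \<partial>lebI L)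
      = (\<integral>x. F x * fourier_mode L l x - of_real (f x) * fourier_mode L l x \<partial>lebI L)"
      using real by (simp add: left_diff_distrib)
    also have "\<dots> = (\<integral>x. F x * fourier_mode L l x \<partial>lebI L) - (\<integral>x. of_real (f x) * fourier_mode L l x \<partial>lebI L)"
      by (intro Bochner_Integration.integral_diff integrable_cont_mult_mode Fc continuous_intros f)
    finally show "(\<integral>x. of_real (Re (F x) - f x) * fourier_mode L l x \<partial>lebI L) = 0" using Fl[of l] by simp
  qed
  then have "AE x in lebI L. Re (F x) = f x" by simp
  then have "Re (F x) = f x" by (rule AE_lebI_continuous_imp_eq[OF L ReF fc _ x])
  then show ?thesis using lim[of x] real[of x] by simp
qed

text \<open>The exact solution is in general not a trigonometric polynomial, so the algebra
  estimates do not apply to it directly. They apply to the truncation at degree \<open>M\<close>,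
  with bounds independent of \<open>M\<close>, and each of the finitely many projected coefficients
  passes to the limit by dominated convergence.\<close>

lemma power_truncation_bound:
  assumes L: "0 < L" and f: "continuous_on UNIV f" and R: "1 \<le> R"
    and bound: "\<And>S. finite S \<Longrightarrow> (\<Sum>l\<in>S. norm (fourier_coeff L f l) * (1 + \<bar>of_int l\<bar>) ^ (m + 2)) \<le> R"
  shows "norm (proj_xx L N (\<lambda>x. of_real (f x ^ p)) y - proj_xx L N (\<lambda>x. trunc L N f x ^ p) y)
    \<le> (2 * pi / L)\<^sup>2 * (real p * R ^ p * ((2 / (2 * real N + 1)) ^ m * R))"
proof -
  let ?c = "fourier_coeff L f" and ?e = "(2 / (2 * real N + 1)) ^ m * R"
  have w: "wiener L (m + 2) R (trunc L M f)" for M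
    unfolding trunc_def[abs_def] by (rule wiener.mono[OF wiener_sum bound]) auto
  then have w2: "wiener L 2 R (trunc L M f)" for M by (rule wiener_order_mono) simp
  \<comment> \<open>Only modes above \<open>N\<close> remain, and for those lowering the weight from
    order \<open>m + 2\<close> to order 2 gains \<open>(2 / (2 N + 1))^m\<close>.\<close>
  have tail: "wiener L 2 ?e (\<lambda>x. trunc L M f x - trunc L N f x)" if M: "N \<le> M" for M
  proof -
    let ?D = "{- int M..int M} - {- int N..int N}"
    have "{- int N..int N} \<subseteq> {- int M..int M}" using M by auto
    then have eq: "trunc L M f x - trunc L N f x = (\<Sum>l\<in>?D. ?c l * fourier_mode L l x)" for x
      unfolding trunc_def by (simp add: sum_diff)
    have "(\<Sum>l\<in>?D. norm (?c l) * (1 + \<bar>of_int l\<bar>) ^ 2) \<le> (\<Sum>l\<in>?D. (2 / (2 * real N + 1)) ^ m * (norm (?c l) * (1 + \<bar>of_int l\<bar>) ^ (m + 2)))"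
    proof (rule sum_mono)
      fix l assume "l \<in> ?D"
      then have k: "real N + 1 \<le> \<bar>of_int l\<bar>" by auto
      have "1 \<le> 2 / (2 * real N + 1) * (1 + \<bar>of_int l\<bar>)" using k by (simp add: field_simps)
      then have "1 \<le> (2 / (2 * real N + 1) * (1 + \<bar>of_int l\<bar>)) ^ m" by (rule one_le_power)
      then have "1 * (norm (?c l) * (1 + \<bar>of_int l\<bar>) ^ 2) \<le> (2 / (2 * real N + 1) * (1 + \<bar>of_int l\<bar>)) ^ m * (norm (?c l) * (1 + \<bar>of_int l\<bar>) ^ 2)"
        by (intro mult_right_mono) auto
      then show "norm (?c l) * (1 + \<bar>of_int l\<bar>) ^ 2 \<le> (2 / (2 * real N + 1)) ^ m * (norm (?c l) * (1 + \<bar>of_int l\<bar>) ^ (m + 2))"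
        unfolding power_mult_distrib power_add by (simp only: mult_ac mult_1_left mult_1_right)
    qed
    also have "\<dots> \<le> ?e" unfolding sum_distrib_left[symmetric] by (intro mult_left_mono bound) auto
    finally show ?thesis unfolding eq by (intro wiener.mono[OF wiener_sum]) auto
  qed
  have diff: "norm (proj_xx L N (\<lambda>x. trunc L M f x ^ p) y - proj_xx L N (\<lambda>x. trunc L N f x ^ p) y)
      \<le> (2 * pi / L)\<^sup>2 * (real p * R ^ p * ?e)" if M: "N \<le> M" for M
    using proj_xx_wiener_bound[OF L wiener_power_diff[OF w2 w2 tail[OF M] R, of p], of N y]
    by (subst (asm) proj_xx_diff) (auto intro!: continuous_intros continuous_on_trunc)
  have R1: "(\<Sum>l\<in>S. norm (?c l)) \<le> R" if S: "finite S" for S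
  proof -
    have "(\<Sum>l\<in>S. norm (?c l)) \<le> (\<Sum>l\<in>S. norm (?c l) * (1 + \<bar>of_int l\<bar>) ^ (m + 2))"
    proof (rule sum_mono)
      fix l
      have "1 \<le> (1 + \<bar>real_of_int l\<bar>) ^ (m + 2)" by (rule one_le_power) simp
      then show "norm (?c l) \<le> norm (?c l) * (1 + \<bar>of_int l\<bar>) ^ (m + 2)"
        using mult_left_mono[of 1 _ "norm (?c l)"] by simp
    qed
    then show ?thesis using bound[OF S] by linarith
  qed
  have fl: "(\<lambda>M. fcoeff L (\<lambda>x. trunc L M f x ^ p) l) \<longlonglongrightarrow> fcoeff L (\<lambda>x. of_real (f x ^ p)) l" for l
  proof -
    interpret finite_measure "lebI L" by (rule finite_measure_lebI)
    have "(\<lambda>M. \<integral>x. trunc L M f x ^ p * fourier_mode L (- l) x \<partial>lebI L) \<longlonglongrightarrow> (\<integral>x. of_real (f x ^ p) * fourier_mode L (- l) x \<partial>lebI L)"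
    proof (rule integral_dominated_convergence[where w="\<lambda>_. R ^ p"])
      show "AE x in lebI L. (\<lambda>M. trunc L M f x ^ p * fourier_mode L (- l) x) \<longlonglongrightarrow> of_real (f x ^ p) * fourier_mode L (- l) x"
        unfolding of_real_power by (intro AE_I2 tendsto_intros trunc_tendsto[OF L f R1]) auto
      show "AE x in lebI L. norm (trunc L M f x ^ p * fourier_mode L (- l) x) \<le> R ^ p" for M
        by (intro AE_I2) (simp add: norm_mult norm_power power_mono wiener_norm_le[OF w2])
    qed (auto intro!: continuous_measurable_lebI continuous_intros continuous_on_trunc continuous_on_subset[OF f])
    then show ?thesis unfolding fcoeff_def using L by (intro tendsto_divide tendsto_const) auto
  qed
  have "(\<lambda>M. proj_xx L N (\<lambda>x. trunc L M f x ^ p) y) \<longlonglongrightarrow> proj_xx L N (\<lambda>x. of_real (f x ^ p)) y"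
    unfolding proj_xx_def by (intro tendsto_intros fl)
  then have "(\<lambda>M. norm (proj_xx L N (\<lambda>x. trunc L M f x ^ p) y - proj_xx L N (\<lambda>x. trunc L N f x ^ p) y))
     \<longlonglongrightarrow> norm (proj_xx L N (\<lambda>x. of_real (f x ^ p)) y - proj_xx L N (\<lambda>x. trunc L N f x ^ p) y)"
    by (intro tendsto_intros)
  then show ?thesis by (rule LIMSEQ_le_const2) (use diff in blast)
qed

section \<open>The equation for a single mode\<close>

lemma fourier_coeff_lincomb:
  assumes "f \<in> L2 L" "g \<in> L2 L" "h \<in> L2 L"
  shows "fourier_coeff L (\<lambda>x. - f x + g x + h x) l = - fourier_coeff L f l + fourier_coeff L g l + fourier_coeff L h l"
proof -
  note i = integrable_mult_mode[OF L2_D(3)[OF assms(1)], of L "- l"]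
    integrable_mult_mode[OF L2_D(3)[OF assms(2)], of L "- l"] integrable_mult_mode[OF L2_D(3)[OF assms(3)], of L "- l"]
  have "(\<integral>x. of_real (- f x + g x + h x) * fourier_mode L (- l) x \<partial>lebI L)
    = (\<integral>x. - (of_real (f x) * fourier_mode L (- l) x) + of_real (g x) * fourier_mode L (- l) x + of_real (h x) * fourier_mode L (- l) x \<partial>lebI L)"
    by (simp add: distrib_right left_diff_distrib)
  also have "\<dots> = - (\<integral>x. of_real (f x) * fourier_mode L (- l) x \<partial>lebI L) + (\<integral>x. of_real (g x) * fourier_mode L (- l) x \<partial>lebI L)
      + (\<integral>x. of_real (h x) * fourier_mode L (- l) x \<partial>lebI L)"
    using i by (subst Bochner_Integration.integral_add | simp)+
  finally show ?thesis by (simp add: fourier_coeff_lebI add_divide_distrib diff_divide_distrib)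
qed

text \<open>Taking coefficients turns the weak space derivatives into multipliers and makes the
  almost-everywhere equation one between continuous functions of time. It therefore holds on all of
  \<open>[0,T]\<close>, in particular at grid times.\<close>

lemma equation_modes:
  fixes c :: "nat \<Rightarrow> int \<Rightarrow> real \<Rightarrow> complex"
  assumes L: "0 < L" and T: "0 < T" and sol: "boussinesq_solution L T p u0 v0 u" and u: "u \<in> H_time L T 4 0"
    and c0: "\<And>l t. t \<in> {0..T} \<Longrightarrow> c 0 l t = fourier_coeff L (u t) l"
    and cAE: "\<And>l. AE t in lebI T. c 2 l t = fourier_coeff L (tderiv L T 2 u t) l"
    and cont: "\<And>j l. j < 4 \<Longrightarrow> continuous_on {0..T} (c j l)"
    and t: "t \<in> {0..T}"
  shows "c 2 l t = - of_real (freq L l ^ 4 + (freq L l)\<^sup>2) * c 0 l t - of_real ((freq L l)\<^sup>2) * fourier_coeff L (\<lambda>x. u t x ^ p) l"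
proof (rule AE_lebI_continuous_imp_eq[OF T _ _ _ t])
  have uc: "continuous_on ({0..T} \<times> UNIV) (\<lambda>(t, x). u t x)" using sol by (simp add: boussinesq_solution_def)
  have "continuous_on ({0..T} \<times> {0..L}) (\<lambda>q. (case_prod u q) ^ p)"
    by (intro continuous_intros continuous_on_subset[OF uc]) auto
  then have "continuous_on ({0..T} \<times> {0..L}) (case_prod (\<lambda>t x. u t x ^ p))" by (simp add: case_prod_beta')
  from continuous_on_fourier_coeff[OF L this]
  show "continuous_on {0..T} (\<lambda>t. - of_real (freq L l ^ 4 + (freq L l)\<^sup>2) * c 0 l t - of_real ((freq L l)\<^sup>2) * fourier_coeff L (\<lambda>x. u t x ^ p) l)"
    by (intro continuous_intros cont) auto
  have H: "AE t in lebI T. u t \<in> H_per L 4 \<and> (\<lambda>y. u t y ^ p) \<in> H_per L 2 \<and>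
        (AE x in lebI L. tderiv L T 2 u t x = - xderiv L 4 (u t) x + xderiv L 2 (u t) x + xderiv L 2 (\<lambda>y. u t y ^ p) x)"
    using sol unfolding AE_lebI by (simp add: boussinesq_solution_def)
  have D: "AE t in lebI T. tderiv L T 2 u t \<in> H_per L 0"
    by (rule L2_time_D(2)[OF L tderiv_spec(1)[OF u]]) simp
  have sp: "AE t in lebI T. t \<in> {0<..<T}" by (rule AE_I2) simp
  show "AE t in lebI T. c 2 l t = - of_real (freq L l ^ 4 + (freq L l)\<^sup>2) * c 0 l t - of_real ((freq L l)\<^sup>2) * fourier_coeff L (\<lambda>x. u t x ^ p) l"
    using H D cAE[of l] sp
  proof eventually_elim
    case (elim t)
    then have H4: "u t \<in> H_per L 4" and H2: "(\<lambda>y. u t y ^ p) \<in> H_per L 2"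
      and ae: "AE x in lebI L. tderiv L T 2 u t x = - xderiv L 4 (u t) x + xderiv L 2 (u t) x + xderiv L 2 (\<lambda>y. u t y ^ p) x" by auto
    have s: "xderiv L 4 (u t) \<in> L2 L" "xderiv L 2 (u t) \<in> L2 L" "xderiv L 2 (\<lambda>y. u t y ^ p) \<in> L2 L"
      by (intro xderiv_spec(1)[OF H4] xderiv_spec(1)[OF H2]; simp)+
    have i4: "\<i> ^ 4 = (1 :: complex)" by (simp add: power4_eq_xxxx)
    have ii: "(\<i> * complex_of_real y) ^ 4 = of_real (y ^ 4)" "(\<i> * complex_of_real y) ^ 2 = - of_real (y ^ 2)" for y
      by (simp_all add: power_mult_distrib i4)
    have "c 2 l t = fourier_coeff L (\<lambda>x. - xderiv L 4 (u t) x + xderiv L 2 (u t) x + xderiv L 2 (\<lambda>y. u t y ^ p) x) l"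
      unfolding elim(3)
      by (rule fourier_coeff_cong_AE[OF _ _ ae]) (use elim(2) s in \<open>auto dest!: H_per_L2 L2_D(1)\<close>)
    also have "\<dots> = - ((\<i> * of_real (freq L l)) ^ 4 * fourier_coeff L (u t) l) + (\<i> * of_real (freq L l)) ^ 2 * fourier_coeff L (u t) l
        + (\<i> * of_real (freq L l)) ^ 2 * fourier_coeff L (\<lambda>y. u t y ^ p) l"
      unfolding fourier_coeff_lincomb[OF s] by (simp add: xderiv_coeff[OF L H4] xderiv_coeff[OF L H2])
    also have "\<dots> = - of_real (freq L l ^ 4 + (freq L l)\<^sup>2) * c 0 l t - of_real ((freq L l)\<^sup>2) * fourier_coeff L (\<lambda>x. u t x ^ p) l"
      unfolding ii using c0[of t l] elim(4) by (simp add: algebra_simps)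
    finally show ?case .
  qed
qed (use cont in auto)

text \<open>For symmetric sums the sharper bound \<open>3 - 2 / (n + 1)\<close> is inductive,
  because \<open>2 / (n + 2)^2\<close> is at most the telescoping difference
  \<open>2 / (n + 1) - 2 / (n + 2)\<close>.\<close>

lemma sum_inverse_square_weight:
  assumes "finite S"
  shows "(\<Sum>l\<in>S. 1 / (1 + \<bar>real_of_int l\<bar>)\<^sup>2) \<le> 3"
proof -
  have sym: "(\<Sum>l = - int n..int n. 1 / (1 + \<bar>real_of_int l\<bar>)\<^sup>2) \<le> 3 - 2 / (real n + 1)" for n
  proof -
    have "(\<Sum>k<Suc n. if k = 0 then 1 else 1 / (1 + real k)\<^sup>2 + 1 / (1 + real k)\<^sup>2) \<le> 3 - 2 / (real n + 1)"
    proof (induction n)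
      case (Suc n)
      have "2 / (2 + real n)\<^sup>2 \<le> 2 / ((real n + 1) * (real n + 2))"
      proof (rule divide_left_mono)
        show "(real n + 1) * (real n + 2) \<le> (2 + real n)\<^sup>2" by (simp add: power2_eq_square algebra_simps)
        show "0 < (2 + real n)\<^sup>2 * ((real n + 1) * (real n + 2))" by (intro mult_pos_pos zero_less_power) auto
      qed simp
      also have "\<dots> = 2 / (real n + 1) - 2 / (real n + 2)" by (simp add: field_simps)
      finally show ?case using Suc unfolding sum.lessThan_Suc[of _ "Suc n"] by (simp add: add.commute)
    qed simp
    then show ?thesis unfolding sum_symmetric_Suc by (simp cong: if_cong)
  qed
  obtain n where n: "S \<subseteq> {- int n..int n}"
  proof -
    obtain b where b: "\<And>l. l \<in> S \<Longrightarrow> \<bar>l\<bar> \<le> b" using assms by (metis Max_ge finite_imageI imageI)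
    show ?thesis by (rule that[of "nat b"]) (use b in fastforce)
  qed
  have "(\<Sum>l\<in>S. 1 / (1 + \<bar>real_of_int l\<bar>)\<^sup>2) \<le> (\<Sum>l = - int n..int n. 1 / (1 + \<bar>real_of_int l\<bar>)\<^sup>2)"
    by (rule sum_mono2) (use n in auto)
  also have "\<dots> \<le> 3 - 2 / (real n + 1)" by (rule sym)
  also have "\<dots> \<le> 3" by simp
  finally show ?thesis .
qed

text \<open>Cauchy-Schwarz against \<open>1 / w\<close>: passing from square sums to absolute sums
  costs one power of the weight, two after squaring.\<close>

lemma weighted_l1_le_l2:
  assumes "finite S" "(\<Sum>l\<in>S. (1 + \<bar>real_of_int l\<bar>) ^ (2 * s + 2) * (y l)\<^sup>2) \<le> Q"
  shows "(\<Sum>l\<in>S. (1 + \<bar>of_int l\<bar>) ^ s * \<bar>y l\<bar>) \<le> 2 * sqrt Q"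
proof -
  let ?w = "\<lambda>l :: int. 1 + \<bar>real_of_int l\<bar>"
  have "(\<Sum>l\<in>S. ?w l ^ s * \<bar>y l\<bar>) = (\<Sum>l\<in>S. \<bar>1 / ?w l\<bar> * \<bar>?w l ^ (s + 1) * y l\<bar>)"
  proof (intro sum.cong refl)
    fix l
    have "?w l \<noteq> 0" by linarith
    then show "?w l ^ s * \<bar>y l\<bar> = \<bar>1 / ?w l\<bar> * \<bar>?w l ^ (s + 1) * y l\<bar>" by (simp add: abs_mult power_abs)
  qed
  also have "\<dots> \<le> L2_set (\<lambda>l. 1 / ?w l) S * L2_set (\<lambda>l. ?w l ^ (s + 1) * y l) S"
    by (rule L2_set_mult_ineq)
  also have "\<dots> \<le> 2 * sqrt Q"
  proof (rule mult_mono)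
    \<comment> \<open>The bound 3 is rounded up to 4 for the sake of an integral square
      root.\<close>
    have "L2_set (\<lambda>l. 1 / ?w l) S \<le> sqrt 4"
      unfolding L2_set_def using sum_inverse_square_weight[OF assms(1)] by (intro real_sqrt_le_mono) (simp add: power_divide)
    then show "L2_set (\<lambda>l. 1 / ?w l) S \<le> 2" by simp
    have "(?w l ^ (s + 1) * y l)\<^sup>2 = ?w l ^ (2 * s + 2) * (y l)\<^sup>2" for l
      unfolding power_mult_distrib power_mult[symmetric] by (simp only: distrib_right mult_1_left mult.commute[of s])
    then show "L2_set (\<lambda>l. ?w l ^ (s + 1) * y l) S \<le> sqrt Q"
      unfolding L2_set_def using assms(2) by (intro real_sqrt_le_mono) simp
  qed auto
  finally show ?thesis .
qed

section \<open>Consistency of the scheme\<close>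

text \<open>After Taylor expansion at the left end the coefficients of \<open>d^2 F3a\<close> are
  \<open>1/6\<close> from the difference quotient, \<open>- 1/4\<close> from the average of
  \<open>F1\<close> and \<open>1/12\<close> from the correction. Their sum is zero, which fixes the
  number 12.\<close>

lemma midpoint_residual:
  fixes d I :: real
  assumes d: "0 < d" and e0: "\<bar>F0b - F0a - d * F1a - d\<^sup>2 / 2 * F2a - d ^ 3 / 6 * F3a\<bar> \<le> I * d ^ 3"
    and e1: "\<bar>F1b - F1a - d * F2a - d\<^sup>2 / 2 * F3a\<bar> \<le> I * d\<^sup>2" and e3: "\<bar>F3b - F3a\<bar> \<le> I"
  shows "\<bar>(F0b - F0a) / d - ((F1b - d\<^sup>2 / 12 * F3b) + (F1a - d\<^sup>2 / 12 * F3a)) / 2\<bar> \<le> 2 * I * d\<^sup>2"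
proof -
  define x0 x1 x3 where "x0 = F0b - F0a - d * F1a - d\<^sup>2 / 2 * F2a - d ^ 3 / 6 * F3a"
    and "x1 = F1b - F1a - d * F2a - d\<^sup>2 / 2 * F3a" and "x3 = F3b - F3a"
  have I: "0 \<le> I" using e3 by linarith
  have "(F0b - F0a) / d = x0 / d + F1a + d / 2 * F2a + d\<^sup>2 / 6 * F3a"
    using d by (simp add: x0_def field_simps power2_eq_square power3_eq_cube)
  moreover have "F1b = x1 + F1a + d * F2a + d\<^sup>2 / 2 * F3a" "F3b = x3 + F3a" by (simp_all add: x1_def x3_def)
  ultimately have eq: "(F0b - F0a) / d - ((F1b - d\<^sup>2 / 12 * F3b) + (F1a - d\<^sup>2 / 12 * F3a)) / 2 = x0 / d - x1 / 2 + d\<^sup>2 / 24 * x3"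
    by (simp only: distrib_left diff_divide_distrib add_divide_distrib)
  have "\<bar>x0 / d\<bar> \<le> I * d\<^sup>2"
  proof -
    have "\<bar>x0\<bar> / d \<le> (I * d ^ 3) / d" using e0 d unfolding x0_def by (intro divide_right_mono) auto
    also have "\<dots> = I * d\<^sup>2" using d by (simp add: power2_eq_square power3_eq_cube)
    finally show ?thesis using d by simp
  qed
  moreover have "\<bar>d\<^sup>2 / 24 * x3\<bar> \<le> I * d\<^sup>2 / 24"
    using mult_mono[of "\<bar>x3\<bar>" I "d\<^sup>2" "d\<^sup>2"] e3 I unfolding x3_def[symmetric] by (simp add: abs_mult mult.commute)
  moreover have "\<bar>x1 / 2\<bar> \<le> I * d\<^sup>2 / 2" using e1 unfolding x1_def by simp
  moreover have "0 \<le> I * d\<^sup>2" using I by simp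
  ultimately show ?thesis unfolding eq by linarith
qed

text \<open>The terms \<open>d / 2 * F3a\<close> of the difference quotient and of the average
  cancel. The correction contributes only the oscillation of \<open>F3\<close> times
  \<open>d / 12\<close>, so it does not spoil the order.\<close>

lemma trapezoid_residual:
  fixes d I :: real
  assumes d: "0 < d" and e1: "\<bar>F1b - F1a - d * F2a - d\<^sup>2 / 2 * F3a\<bar> \<le> I * d\<^sup>2"
    and e2: "\<bar>F2b - F2a - d * F3a\<bar> \<le> I * d" and e3: "\<bar>F3b - F3a\<bar> \<le> I"
  shows "\<bar>((F1b - d\<^sup>2 / 12 * F3b) - (F1a - d\<^sup>2 / 12 * F3a)) / d - (F2b + F2a) / 2\<bar> \<le> 2 * I * d"
proof -
  define x1 x2 x3 where "x1 = F1b - F1a - d * F2a - d\<^sup>2 / 2 * F3a"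
    and "x2 = F2b - F2a - d * F3a" and "x3 = F3b - F3a"
  have I: "0 \<le> I" using e3 by linarith
  have eq: "((F1b - d\<^sup>2 / 12 * F3b) - (F1a - d\<^sup>2 / 12 * F3a)) / d - (F2b + F2a) / 2 = x1 / d - d / 12 * x3 - x2 / 2"
    using d unfolding x1_def x2_def x3_def by (simp add: field_simps power2_eq_square)
  have "\<bar>x1 / d\<bar> \<le> I * d"
  proof -
    have "\<bar>x1\<bar> / d \<le> (I * d\<^sup>2) / d" using e1 d unfolding x1_def by (intro divide_right_mono) auto
    also have "\<dots> = I * d" using d by (simp add: power2_eq_square)
    finally show ?thesis using d by simp
  qed
  moreover have "\<bar>d / 12 * x3\<bar> \<le> I * d / 12"
    using mult_mono[of "\<bar>x3\<bar>" I d d] e3 I d unfolding x3_def[symmetric] by (simp add: abs_mult mult.commute)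
  moreover have "\<bar>x2 / 2\<bar> \<le> I * d / 2" using e2 unfolding x2_def by simp
  moreover have "0 \<le> I * d" using I d by simp
  ultimately show ?thesis unfolding eq by linarith
qed

lemma discrete_norm_square: "(discrete_norm N f)\<^sup>2 = (\<Sum>i\<le>2 * N. (f i)\<^sup>2) / real (2 * N + 1)"
  unfolding discrete_norm_def by (simp add: sum_nonneg atMost_atLeast0)

text \<open>One solution on one mesh, stripped to what the estimates use. Its size enters through
  \<open>A\<close> and \<open>B\<close> alone, so constants built from these are uniform in the
  solution, in \<open>N\<close> and in \<open>K\<close>.\<close>

locale spectral_modes =
  fixes L T A B :: real and p m N K :: nat and u :: "real \<Rightarrow> real \<Rightarrow> real"
    and c :: "nat \<Rightarrow> int \<Rightarrow> real \<Rightarrow> complex" and r :: "int \<Rightarrow> real \<Rightarrow> complex"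
  assumes L: "0 < L" and T: "0 < T" and m: "1 \<le> m" and K: "1 \<le> K" and A0: "0 \<le> A"
    and ucont: "\<And>t. t \<in> {0..T} \<Longrightarrow> continuous_on UNIV (u t)"
    and c0: "\<And>l t. t \<in> {0..T} \<Longrightarrow> c 0 l t = fourier_coeff L (u t) l"
    and der: "\<And>j l t. j < 3 \<Longrightarrow> t \<in> {0..T} \<Longrightarrow> (c j l has_vector_derivative c (Suc j) l t) (at t within {0..T})"
    and c3: "\<And>l t. t \<in> {0..T} \<Longrightarrow> c 3 l t = c 3 l 0 + integral {0..t} (r l)"
    and r: "\<And>l. integrable (lebI T) (r l)" "\<And>l. integrable (lebI T) (\<lambda>t. (norm (r l t))\<^sup>2)"
    and rA: "\<And>S. finite S \<Longrightarrow> (\<Sum>l\<in>S. integral {0..T} (\<lambda>t. (norm (r l t))\<^sup>2)) \<le> A"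
    and cB: "\<And>S t. finite S \<Longrightarrow> t \<in> {0..T} \<Longrightarrow> (\<Sum>l\<in>S. (1 + \<bar>of_int l\<bar>) ^ (2 * (m + 4)) * (norm (c 0 l t))\<^sup>2) \<le> B"
    and eqn: "\<And>l t. t \<in> {0..T} \<Longrightarrow> c 2 l t = - of_real (freq L l ^ 4 + (freq L l)\<^sup>2) * c 0 l t
        - of_real ((freq L l)\<^sup>2) * fourier_coeff L (\<lambda>x. u t x ^ p) l"
begin

section \<open>Time grid and local Taylor remainders\<close>

definition dt :: real where "dt = T / real K"
definition tm :: "nat \<Rightarrow> real" where "tm n = real n * dt"
abbreviation "S \<equiv> {- int N..int N}"
abbreviation w :: "int \<Rightarrow> real" where "w l \<equiv> 1 + \<bar>of_int l\<bar>"
abbreviation "xg \<equiv> grid_point L N"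

lemma dt_pos: "0 < dt" using T K by (simp add: dt_def)

lemma K_dt: "real K * dt = T" using K by (simp add: dt_def)

lemma tm_Suc: "tm (Suc n) = tm n + dt" by (simp add: tm_def algebra_simps)

lemma tm_0: "0 \<le> tm n" using dt_pos by (simp add: tm_def)

lemma tm_T: "n \<le> K \<Longrightarrow> tm n \<le> T"
  using mult_right_mono[of "real n" "real K" dt] dt_pos K_dt by (simp add: tm_def)

lemma tm_in: "n \<le> K \<Longrightarrow> tm n \<in> {0..T}" using tm_0 tm_T by auto

lemma sum_integral_steps:
  fixes g :: "real \<Rightarrow> real"
  assumes g: "g integrable_on {0..T}"
  shows "(\<Sum>n<K. integral {tm n..tm (Suc n)} g) = integral {0..T} g"
proof -
  have "k \<le> K \<Longrightarrow> (\<Sum>n<k. integral {tm n..tm (Suc n)} g) = integral {0..tm k} g" for k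
  proof (induction k)
    case (Suc k)
    have "g integrable_on {0..tm (Suc k)}"
      by (rule integrable_on_subinterval[OF g]) (use tm_T[OF Suc.prems] in auto)
    then have "integral {0..tm k} g + integral {tm k..tm (Suc k)} g = integral {0..tm (Suc k)} g"
      by (intro Henstock_Kurzweil_Integration.integral_combine) (use tm_0[of k] tm_Suc[of k] dt_pos in auto)
    then show ?case using Suc by simp
  qed (simp add: tm_def)
  from this[of K] show ?thesis using K_dt by (simp add: tm_def)
qed

lemma c_cont: "j \<le> 2 \<Longrightarrow> continuous_on {0..T} (c j l)"
  using der[of j] by (intro continuous_on_vector_derivative[where f'="c (Suc j) l"]) auto

text \<open>The time derivatives of order \<open>j \<le> 3\<close> of the truncated solution. The
  fourth one, \<open>\<rho>\<close> below, exists only as an integrable density of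
  \<open>F 3\<close>.\<close>

definition F :: "nat \<Rightarrow> real \<Rightarrow> real \<Rightarrow> complex" where
  "F j x t = (\<Sum>l\<in>S. c j l t * fourier_mode L l x)"

definition \<rho> :: "real \<Rightarrow> real \<Rightarrow> complex" where
  "\<rho> x t = (\<Sum>l\<in>S. r l t * fourier_mode L l x)"

lemma F_der: "j < 3 \<Longrightarrow> t \<in> {0..T} \<Longrightarrow> (F j x has_vector_derivative F (Suc j) x t) (at t within {0..T})"
  unfolding F_def[abs_def] by (intro has_vector_derivative_sum has_vector_derivative_mult_left der)

lemma r_int:
  assumes "0 \<le> a" "b \<le> T"
  shows "r l integrable_on {a..b}" "(\<lambda>t. (norm (r l t))\<^sup>2) integrable_on {a..b}"
  using integral_lebI_indicator(2)[OF r(1)[of l] order_refl] integral_lebI_indicator(2)[OF r(2)[of l] order_refl] assms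
  by (auto intro: integrable_on_subinterval)

lemma F_3: "t \<in> {0..T} \<Longrightarrow> F 3 x t = F 3 x 0 + integral {0..t} (\<rho> x)"
proof -
  assume t: "t \<in> {0..T}"
  have "(\<rho> x has_integral (\<Sum>l\<in>S. integral {0..t} (r l) * fourier_mode L l x)) {0..t}"
    unfolding \<rho>_def[abs_def] using t
    by (intro has_integral_sum has_integral_mult_left integrable_integral r_int) auto
  then show ?thesis unfolding F_def integral_unique[OF \<open>(\<rho> x has_integral _) _\<close>]
    using c3[OF t] by (simp add: sum.distrib[symmetric] distrib_right[symmetric])
qed

lemma \<rho>_int: "integrable (lebI T) (\<rho> x)"
  unfolding \<rho>_def[abs_def] by (intro Bochner_Integration.integrable_sum integrable_mult_left r)

lemma \<rho>_int2: "integrable (lebI T) (\<lambda>t. (norm (\<rho> x t))\<^sup>2)"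
proof (rule Bochner_Integration.integrable_bound[where f="\<lambda>t. (\<Sum>l\<in>S. (norm (r l t))\<^sup>2) * real (card S)"])
  have [measurable]: "\<rho> x \<in> borel_measurable (lebI T)" using \<rho>_int by auto
  show "(\<lambda>t. (norm (\<rho> x t))\<^sup>2) \<in> borel_measurable (lebI T)" by measurable
  show "AE t in lebI T. norm ((norm (\<rho> x t))\<^sup>2) \<le> norm ((\<Sum>l\<in>S. (norm (r l t))\<^sup>2) * real (card S))"
  proof (rule AE_I2)
    fix t
    have "norm (\<rho> x t) \<le> (\<Sum>l\<in>S. norm (r l t))" unfolding \<rho>_def by (rule sum_norm_le) (simp add: norm_mult)
    then have "(norm (\<rho> x t))\<^sup>2 \<le> (\<Sum>l\<in>S. norm (r l t))\<^sup>2" by (rule power_mono) simp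
    also have "\<dots> \<le> (\<Sum>l\<in>S. (norm (r l t))\<^sup>2) * real (card S)" by (rule sum_squared_le_sum_of_squares)
    finally show "norm ((norm (\<rho> x t))\<^sup>2) \<le> norm ((\<Sum>l\<in>S. (norm (r l t))\<^sup>2) * real (card S))" by simp
  qed
qed (intro integrable_mult_left Bochner_Integration.integrable_sum r)

text \<open>Bounds the oscillation of the third time derivative at one grid point over one step; all
  four Taylor remainders are multiples of it.\<close>

definition I :: "nat \<Rightarrow> nat \<Rightarrow> real" where
  "I n i = integral {tm n..tm (Suc n)} (\<lambda>t. norm (\<rho> (xg i) t))"

definition V :: "nat \<Rightarrow> real" where
  "V n = (\<Sum>l\<in>S. integral {tm n..tm (Suc n)} (\<lambda>t. (norm (r l t))\<^sup>2))"

text \<open>Cauchy-Schwarz over one step yields the factor \<open>dt\<close>; discrete Parseval then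
  turns the grid average of \<open>\<rho>\<close> into the sum over modes in \<open>V n\<close>,
  whose sum over all steps is at most \<open>A\<close>.\<close>

lemma I_square_sum:
  assumes n: "n < K"
  shows "(\<Sum>i\<le>2 * N. (I n i)\<^sup>2) / real (2 * N + 1) \<le> dt * V n"
proof -
  let ?J = "{tm n..tm (Suc n)}"
  have J: "0 \<le> tm n" "tm n \<le> tm (Suc n)" "tm (Suc n) \<le> T" using tm_0 tm_Suc dt_pos tm_T[of "Suc n"] n by auto
  have i2: "(\<lambda>t. (norm (\<rho> x t))\<^sup>2) integrable_on ?J" for x
    by (rule integrable_on_subinterval[OF integral_lebI_indicator(2)[OF \<rho>_int2[of x] order_refl]]) (use J in auto)
  have I1: "(I n i)\<^sup>2 \<le> dt * integral ?J (\<lambda>t. (norm (\<rho> (xg i) t))\<^sup>2)" for i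
  proof -
    have "(\<lambda>t. norm (\<rho> (xg i) t)) integrable_on ?J"
      by (rule integrable_on_subinterval[OF integral_lebI_indicator(2)[OF integrable_norm[OF \<rho>_int[of "xg i"]] order_refl]])
        (use J in auto)
    from integral_Cauchy_Schwarz[OF this i2 J(2)] show ?thesis by (simp add: I_def tm_Suc)
  qed
  have "(\<Sum>i\<le>2 * N. (I n i)\<^sup>2) / real (2 * N + 1)
      \<le> (\<Sum>i\<le>2 * N. dt * integral ?J (\<lambda>t. (norm (\<rho> (xg i) t))\<^sup>2)) / real (2 * N + 1)"
    by (intro divide_right_mono sum_mono I1) simp
  also have "\<dots> = dt * integral ?J (\<lambda>t. (\<Sum>i\<le>2 * N. (norm (\<rho> (xg i) t))\<^sup>2) / real (2 * N + 1))"
  proof -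
    have "((\<lambda>t. (\<Sum>i\<le>2 * N. (norm (\<rho> (xg i) t))\<^sup>2) / real (2 * N + 1)) has_integral
      (\<Sum>i\<le>2 * N. integral ?J (\<lambda>t. (norm (\<rho> (xg i) t))\<^sup>2)) / real (2 * N + 1)) ?J"
      by (intro has_integral_divide has_integral_sum integrable_integral i2) auto
    from integral_unique[OF this] show ?thesis by (simp add: sum_distrib_left)
  qed
  also have "(\<lambda>t. (\<Sum>i\<le>2 * N. (norm (\<rho> (xg i) t))\<^sup>2) / real (2 * N + 1)) = (\<lambda>t. \<Sum>l\<in>S. (norm (r l t))\<^sup>2)"
    unfolding \<rho>_def using discrete_Parseval[of L "\<lambda>l. r l _" N] L by auto
  also have "integral ?J (\<lambda>t. \<Sum>l\<in>S. (norm (r l t))\<^sup>2) = V n"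
    unfolding V_def using J by (intro Henstock_Kurzweil_Integration.integral_sum r_int) auto
  finally show ?thesis .
qed

lemma V_nonneg: "n < K \<Longrightarrow> 0 \<le> V n"
  unfolding V_def using tm_T[of "Suc n"] tm_0[of n]
  by (intro sum_nonneg integral_nonneg r_int) auto

lemma V_sum: "(\<Sum>n<K. V n) \<le> A"
proof -
  have "(\<Sum>n<K. V n) = (\<Sum>l\<in>S. \<Sum>n<K. integral {tm n..tm (Suc n)} (\<lambda>t. (norm (r l t))\<^sup>2))"
    unfolding V_def by (rule sum.swap)
  also have "\<dots> = (\<Sum>l\<in>S. integral {0..T} (\<lambda>t. (norm (r l t))\<^sup>2))"
    by (intro sum.cong refl sum_integral_steps r_int) auto
  also have "\<dots> \<le> A" by (rule rA) simp
  finally show ?thesis .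
qed

lemma F_Taylor:
  assumes n: "n < K"
  defines "a \<equiv> tm n" and "b \<equiv> tm (Suc n)"
  shows "norm (F 3 (xg i) b - F 3 (xg i) a) \<le> I n i"
    "norm (F 2 (xg i) b - F 2 (xg i) a - dt *\<^sub>R F 3 (xg i) a) \<le> I n i * dt"
    "norm (F 1 (xg i) b - F 1 (xg i) a - dt *\<^sub>R F 2 (xg i) a - (dt\<^sup>2 / 2) *\<^sub>R F 3 (xg i) a) \<le> I n i * dt ^ 2"
    "norm (F 0 (xg i) b - F 0 (xg i) a - dt *\<^sub>R F 1 (xg i) a - (dt\<^sup>2 / 2) *\<^sub>R F 2 (xg i) a - (dt ^ 3 / 6) *\<^sub>R F 3 (xg i) a) \<le> I n i * dt ^ 3"
proof -
  have ab: "0 \<le> a" "a \<le> b" "b \<le> T" "b - a = dt"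
    using tm_0 tm_Suc dt_pos tm_T[of "Suc n"] n by (auto simp: a_def b_def)
  have I: "norm (F 3 (xg i) s - F 3 (xg i) a) \<le> I n i" if "s \<in> {a..b}" for s
    unfolding I_def a_def[symmetric] b_def[symmetric]
    by (rule f3_diff_bound[where f="\<lambda>j. F j (xg i)" and T=T])
      (use T ab that in \<open>auto intro: F_3 \<rho>_int \<rho>_int2 F_der\<close>)
  have d: "(F j (xg i) has_vector_derivative F (Suc j) (xg i) t) (at t within {a..b})" if "j < 3" "t \<in> {a..b}" for j t
    by (rule has_vector_derivative_within_subset[OF F_der]) (use that ab in auto)
  have bb: "b \<in> {a..b}" using ab by simp
  show "norm (F 3 (xg i) b - F 3 (xg i) a) \<le> I n i" by (rule I[OF bb])
  show "norm (F 2 (xg i) b - F 2 (xg i) a - dt *\<^sub>R F 3 (xg i) a) \<le> I n i * dt"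
    "norm (F 1 (xg i) b - F 1 (xg i) a - dt *\<^sub>R F 2 (xg i) a - (dt\<^sup>2 / 2) *\<^sub>R F 3 (xg i) a) \<le> I n i * dt ^ 2"
    "norm (F 0 (xg i) b - F 0 (xg i) a - dt *\<^sub>R F 1 (xg i) a - (dt\<^sup>2 / 2) *\<^sub>R F 2 (xg i) a - (dt ^ 3 / 6) *\<^sub>R F 3 (xg i) a) \<le> I n i * dt ^ 3"
    using Taylor_bounds[where f="\<lambda>j. F j (xg i)", OF ab(2) d I bb] unfolding ab(4) by auto
qed

section \<open>Residuals of the time discretization\<close>

lemma U_eq: "t \<in> {0..T} \<Longrightarrow> U_approx L N u t x = Re (F 0 x t)"
  by (simp add: U_approx_def fourier_proj_def F_def c0)

lemma time_deriv_eq: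
  assumes g: "\<And>s. s \<in> {0..T} \<Longrightarrow> g s = Re (F j x s)" and j: "j < 3" and t: "t \<in> {0..T}"
  shows "time_deriv T g t = Re (F (Suc j) x t)"
proof -
  have "((\<lambda>s. Re (F j x s)) has_vector_derivative Re (F (Suc j) x t)) (at t within {0..T})"
    by (rule bounded_linear.has_vector_derivative[OF bounded_linear_Re F_der[OF j t]])
  then have "(g has_vector_derivative Re (F (Suc j) x t)) (at t within {0..T})"
    by (rule has_vector_derivative_transform[rotated 2]) (use g t in auto)
  then show ?thesis
    unfolding time_deriv_def using T t by (intro vector_derivative_within_closed_interval) auto
qed

lemma Psi_eq:
  assumes t: "t \<in> {0..T}"
  shows "Psi_approx L T N dt u t x = Re (F 1 x t) - dt\<^sup>2 / 12 * Re (F 3 x t)"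
proof -
  let ?g = "\<lambda>s. U_approx L N u s x"
  have 1: "time_deriv T ?g s = Re (F 1 x s)" if "s \<in> {0..T}" for s
    using time_deriv_eq[OF U_eq _ that] by simp
  have 2: "time_deriv T (time_deriv T ?g) s = Re (F 2 x s)" if "s \<in> {0..T}" for s
    using time_deriv_eq[OF 1 _ that] by (simp add: numeral_eq_Suc)
  have 3: "time_deriv T (time_deriv T (time_deriv T ?g)) s = Re (F 3 x s)" if "s \<in> {0..T}" for s
    using time_deriv_eq[OF 2 _ that] by (simp add: numeral_eq_Suc)
  show ?thesis unfolding Psi_approx_def using 1[OF t] 3[OF t] by (simp add: numeral_eq_Suc)
qed

lemma residual_bounds:
  fixes n i :: nat
  assumes n: "n < K"
  defines "a \<equiv> tm n" and "b \<equiv> tm (Suc n)"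
  defines "\<Psi> \<equiv> \<lambda>t. Psi_approx L T N dt u t (xg i)"
  shows "\<bar>(U_approx L N u b (xg i) - U_approx L N u a (xg i)) / dt - (\<Psi> b + \<Psi> a) / 2\<bar> \<le> 2 * I n i * dt\<^sup>2"
    "\<bar>(\<Psi> b - \<Psi> a) / dt - (Re (F 2 (xg i) b) + Re (F 2 (xg i) a)) / 2\<bar> \<le> 2 * I n i * dt"
proof -
  note B = F_Taylor[OF n, of i, folded a_def b_def]
  have in_T: "a \<in> {0..T}" "b \<in> {0..T}" using tm_in n by (auto simp: a_def b_def)
  have R: "\<bar>Re (F 3 (xg i) b) - Re (F 3 (xg i) a)\<bar> \<le> I n i"
    "\<bar>Re (F 2 (xg i) b) - Re (F 2 (xg i) a) - dt * Re (F 3 (xg i) a)\<bar> \<le> I n i * dt"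
    "\<bar>Re (F 1 (xg i) b) - Re (F 1 (xg i) a) - dt * Re (F 2 (xg i) a) - dt\<^sup>2 / 2 * Re (F 3 (xg i) a)\<bar> \<le> I n i * dt ^ 2"
    "\<bar>Re (F 0 (xg i) b) - Re (F 0 (xg i) a) - dt * Re (F 1 (xg i) a) - dt\<^sup>2 / 2 * Re (F 2 (xg i) a) - dt ^ 3 / 6 * Re (F 3 (xg i) a)\<bar> \<le> I n i * dt ^ 3"
    using B[THEN order_trans[OF abs_Re_le_cmod]] by (simp_all add: minus_complex.sel)
  show "\<bar>(U_approx L N u b (xg i) - U_approx L N u a (xg i)) / dt - (\<Psi> b + \<Psi> a) / 2\<bar> \<le> 2 * I n i * dt\<^sup>2"
    unfolding \<Psi>_def U_eq[OF in_T(1)] U_eq[OF in_T(2)] Psi_eq[OF in_T(1)] Psi_eq[OF in_T(2)]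
    by (rule midpoint_residual[OF dt_pos R(4) R(3) R(1)])
  show "\<bar>(\<Psi> b - \<Psi> a) / dt - (Re (F 2 (xg i) b) + Re (F 2 (xg i) a)) / 2\<bar> \<le> 2 * I n i * dt"
    unfolding \<Psi>_def Psi_eq[OF in_T(1)] Psi_eq[OF in_T(2)]
    by (rule trapezoid_residual[OF dt_pos R(3) R(2) R(1)])
qed

text \<open>The nonlinear part is the projection of \<open>u^p\<close> with the exact solution,
  whereas the scheme sees powers of the truncation; bridging the two is left to the nonlinear
  estimates.\<close>

lemma F_2_eq:
  assumes t: "t \<in> {0..T}"
  shows "F 2 x t = - (\<Sum>l\<in>S. of_real (freq L l ^ 4 + (freq L l)\<^sup>2) * c 0 l t * fourier_mode L l x)
    + proj_xx L N (\<lambda>x. of_real (u t x ^ p)) x"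
  unfolding F_def proj_xx_def sum_negf[symmetric] sum.distrib[symmetric]
  by (intro sum.cong refl) (simp add: eqn[OF t] fourier_coeff_eq_fcoeff algebra_simps)

lemma of_real_U: "complex_of_real (U_approx L N u t x) = trunc L N (u t) x"
  unfolding U_approx_def by (rule fourier_proj_trunc)

lemma trunc_eq: "t \<in> {0..T} \<Longrightarrow> trunc L N (u t) x = (\<Sum>l\<in>S. c 0 l t * fourier_mode L l x)"
  by (simp add: trunc_def c0)

lemma discrete_deriv_linear:
  assumes ab: "a \<in> {0..T}" "b \<in> {0..T}" and i: "i \<le> 2 * N"
  defines "g \<equiv> \<lambda>j. (U_approx L N u b (xg j) + U_approx L N u a (xg j)) / 2"
  shows "complex_of_real ((discrete_deriv L N ^^ k) g i)
    = (\<Sum>l\<in>S. (\<i> * of_real (freq L l)) ^ k * ((c 0 l b + c 0 l a) / 2) * fourier_mode L l (xg i))"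
proof -
  have g: "complex_of_real (g j) = (\<Sum>l\<in>S. (c 0 l b + c 0 l a) / 2 * fourier_mode L l (xg j))" for j
    unfolding g_def of_real_divide of_real_add of_real_U trunc_eq[OF ab(1)] trunc_eq[OF ab(2)]
    by (simp add: sum.distrib[symmetric] sum_divide_distrib algebra_simps add_divide_distrib)
  have "complex_of_real ((discrete_deriv L N ^^ k) g i) = (\<Sum>l\<in>S. (\<i> * of_real (freq L l)) ^ k *
     discrete_coeff L N (\<lambda>j. complex_of_real (g j)) l * fourier_mode L l (xg i))"
    by (rule discrete_deriv_funpow_eq[OF _ i]) (use L in simp)
  also have "\<dots> = (\<Sum>l\<in>S. (\<i> * of_real (freq L l)) ^ k * ((c 0 l b + c 0 l a) / 2) * fourier_mode L l (xg i))"
    unfolding g by (intro sum.cong refl arg_cong2[where f="(*)"] discrete_coeff_trig) (use L in auto)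
  finally show ?thesis .
qed

lemma discrete_deriv_nonlinear:
  assumes i: "i \<le> 2 * N"
  shows "complex_of_real ((discrete_deriv L N ^^ 2) (\<lambda>j. 3 / 2 * U_approx L N u a (xg j) ^ p - 1 / 2 * U_approx L N u z (xg j) ^ p) i)
    = interp_xx L N (\<lambda>x. 3 / 2 * trunc L N (u a) x ^ p - 1 / 2 * trunc L N (u z) x ^ p) (xg i)"
proof -
  have "(\<i> * complex_of_real y) ^ 2 = - of_real (y ^ 2)" for y
    by (simp add: power_mult_distrib)
  moreover have "L \<noteq> 0" using L by simp
  ultimately show ?thesis
    unfolding interp_xx_def discrete_deriv_funpow_eq[OF \<open>L \<noteq> 0\<close> i] by (simp add: of_real_U)
qed

text \<open>The bound \<open>2 * sqrt B\<close> on weighted absolute sums of coefficients, increased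
  by 1 so that powers of \<open>R\<close> are monotone in the exponent.\<close>

definition R :: real where "R = 1 + 2 * sqrt B"
definition \<kappa> :: real where "\<kappa> = (2 * pi / L)\<^sup>2"
text \<open>With \<open>h\<close> the mesh width this is \<open>(2 h / L)^m\<close>.\<close>

definition \<theta> :: real where "\<theta> = (2 / (2 * real N + 1)) ^ m"
text \<open>The common bound that interpolation in time gives, summed over all modes, for the first
  derivative pointwise and for the second in mean square.\<close>

definition Q :: real where "Q = interp_time_const T * (T * B + A)"

definition NL :: "nat \<Rightarrow> real \<Rightarrow> complex" where
  "NL n x = (proj_xx L N (\<lambda>x. of_real (u (tm (Suc n)) x ^ p)) x + proj_xx L N (\<lambda>x. of_real (u (tm n) x ^ p)) x) / 2
    - interp_xx L N (\<lambda>x. 3 / 2 * trunc L N (u (tm n)) x ^ p - 1 / 2 * trunc L N (u (tm (n - 1))) x ^ p) x"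

text \<open>The discrete derivatives act on the averaged truncation by the same multipliers
  \<open>freq^4\<close> and \<open>- freq^2\<close> that occur in the equation for each mode. All
  linear terms cancel exactly, and \<open>NL\<close> is what remains.\<close>

lemma residual1_eq:
  assumes n: "n < K" and i: "i \<le> 2 * N"
  defines "a \<equiv> tm n" and "b \<equiv> tm (Suc n)"
  defines "g \<equiv> \<lambda>j. (U_approx L N u b (xg j) + U_approx L N u a (xg j)) / 2"
  shows "(Re (F 2 (xg i) b) + Re (F 2 (xg i) a)) / 2 + (discrete_deriv L N ^^ 4) g i - (discrete_deriv L N ^^ 2) g i
    - (discrete_deriv L N ^^ 2) (\<lambda>j. 3 / 2 * U_approx L N u a (xg j) ^ p - 1 / 2 * U_approx L N u (tm (n - 1)) (xg j) ^ p) i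
    = Re (NL n (xg i))"
proof -
  have in_T: "a \<in> {0..T}" "b \<in> {0..T}" using tm_in n by (auto simp: a_def b_def)
  have i4: "\<i> ^ 4 = (1 :: complex)" by (simp add: power4_eq_xxxx)
  have ii: "(\<i> * complex_of_real y) ^ 4 = of_real (y ^ 4)" "(\<i> * complex_of_real y) ^ 2 = - of_real (y ^ 2)" for y
    by (simp_all add: power_mult_distrib i4)
  let ?X = "xg i"
  let ?P = "\<lambda>t. proj_xx L N (\<lambda>x. of_real (u t x ^ p)) ?X"
  have D: "of_real ((discrete_deriv L N ^^ 4) g i) - of_real ((discrete_deriv L N ^^ 2) g i)
      = (\<Sum>l\<in>S. of_real (freq L l ^ 4 + (freq L l)\<^sup>2) * ((c 0 l b + c 0 l a) / 2) * fourier_mode L l ?X)"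
    unfolding g_def discrete_deriv_linear[OF in_T i] ii sum_subtractf[symmetric]
    by (intro sum.cong refl)
      (simp only: of_real_add left_diff_distrib distrib_right mult_minus_left diff_minus_eq_add)
  have "(F 2 ?X b + F 2 ?X a) / 2 = (?P b + ?P a) / 2
      - (\<Sum>l\<in>S. of_real (freq L l ^ 4 + (freq L l)\<^sup>2) * ((c 0 l b + c 0 l a) / 2) * fourier_mode L l ?X)"
  proof -
    have "(\<Sum>l\<in>S. of_real (freq L l ^ 4 + (freq L l)\<^sup>2) * ((c 0 l b + c 0 l a) / 2) * fourier_mode L l ?X)
      = ((\<Sum>l\<in>S. of_real (freq L l ^ 4 + (freq L l)\<^sup>2) * c 0 l b * fourier_mode L l ?X)
        + (\<Sum>l\<in>S. of_real (freq L l ^ 4 + (freq L l)\<^sup>2) * c 0 l a * fourier_mode L l ?X)) / 2"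
      unfolding sum.distrib[symmetric] sum_divide_distrib by (intro sum.cong refl) (simp add: algebra_simps add_divide_distrib)
    then show ?thesis unfolding F_2_eq[OF in_T(1)] F_2_eq[OF in_T(2)] by (simp add: add_divide_distrib diff_divide_distrib)
  qed
  then have "(F 2 ?X b + F 2 ?X a) / 2 + (of_real ((discrete_deriv L N ^^ 4) g i) - of_real ((discrete_deriv L N ^^ 2) g i))
    = (?P b + ?P a) / 2" unfolding D by (simp only: diff_add_cancel)
  then have "(F 2 ?X b + F 2 ?X a) / 2 + (of_real ((discrete_deriv L N ^^ 4) g i) - of_real ((discrete_deriv L N ^^ 2) g i))
     - of_real ((discrete_deriv L N ^^ 2) (\<lambda>j. 3 / 2 * U_approx L N u a (xg j) ^ p - 1 / 2 * U_approx L N u (tm (n - 1)) (xg j) ^ p) i)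
    = NL n ?X"
    unfolding NL_def discrete_deriv_nonlinear[OF i] a_def b_def by simp
  from arg_cong[OF this, of Re] show ?thesis by (simp add: algebra_simps)
qed

section \<open>Mesh-independent bounds on the truncated solution and its time derivatives\<close>

lemma B_nonneg: "0 \<le> B"
  using cB[of "{}" 0] T by simp

lemma R_ge_1: "1 \<le> R"
  using B_nonneg by (simp add: R_def)

lemma coeff_l1_bound:
  assumes t: "t \<in> {0..T}" and X: "finite X"
  shows "(\<Sum>l\<in>X. norm (fourier_coeff L (u t) l) * (1 + \<bar>of_int l\<bar>) ^ (m + 2)) \<le> R"
proof -
  \<comment> \<open>The absolute sum of order \<open>m + 2\<close> uses up square sums of order
    \<open>m + 3\<close>; order \<open>m + 4\<close> is available.\<close>
  have "(\<Sum>l\<in>X. w l ^ (2 * (m + 2) + 2) * (norm (c 0 l t))\<^sup>2) \<le> (\<Sum>l\<in>X. w l ^ (2 * (m + 4)) * (norm (c 0 l t))\<^sup>2)"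
    by (intro sum_mono mult_right_mono power_increasing) auto
  also have "\<dots> \<le> B" by (rule cB[OF X t])
  finally have "(\<Sum>l\<in>X. w l ^ (m + 2) * \<bar>norm (c 0 l t)\<bar>) \<le> 2 * sqrt B" by (rule weighted_l1_le_l2[OF X])
  then show ?thesis by (simp add: R_def c0[OF t] mult.commute)
qed

lemma wiener_trunc: "t \<in> {0..T} \<Longrightarrow> wiener L (m + 2) R (trunc L N (u t))"
  unfolding trunc_def[abs_def] by (rule wiener.mono[OF wiener_sum coeff_l1_bound]) auto

lemma wiener_2_trunc: "t \<in> {0..T} \<Longrightarrow> wiener L 2 R (trunc L N (u t))"
  by (rule wiener_order_mono[OF wiener_trunc]) auto

abbreviation "a0 l \<equiv> integral {0..T} (\<lambda>t. (norm (c 0 l t))\<^sup>2)"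
abbreviation "a4 l \<equiv> integral {0..T} (\<lambda>t. (norm (r l t))\<^sup>2)"
abbreviation "Ci \<equiv> interp_time_const T"

lemma mode_interpolation:
  "s \<in> {0..T} \<Longrightarrow> w l ^ 6 * (norm (c 1 l s))\<^sup>2 \<le> Ci * (w l ^ 10 * a0 l + a4 l)"
  "w l ^ 4 * integral {0..T} (\<lambda>t. (norm (c 2 l t))\<^sup>2) \<le> Ci * (w l ^ 10 * a0 l + a4 l)"
proof -
  show "s \<in> {0..T} \<Longrightarrow> w l ^ 6 * (norm (c 1 l s))\<^sup>2 \<le> Ci * (w l ^ 10 * a0 l + a4 l)"
    by (rule interpolation_weighted(1)[where f="\<lambda>j. c j l" and r="r l"]) (use T in \<open>auto intro: der c3 r\<close>)
  show "w l ^ 4 * integral {0..T} (\<lambda>t. (norm (c 2 l t))\<^sup>2) \<le> Ci * (w l ^ 10 * a0 l + a4 l)"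
    by (rule interpolation_weighted(2)[where f="\<lambda>j. c j l" and r="r l"]) (use T in \<open>auto intro: der c3 r\<close>)
qed

lemma interpolation_sum: "(\<Sum>l\<in>S. Ci * (w l ^ 10 * a0 l + a4 l)) \<le> Q"
proof -
  have i: "(\<lambda>t. (norm (c 0 l t))\<^sup>2) integrable_on {0..T}" for l
    by (intro integrable_continuous_real continuous_intros c_cont) simp
  have "(\<Sum>l\<in>S. w l ^ 10 * a0 l) = integral {0..T} (\<lambda>t. \<Sum>l\<in>S. w l ^ 10 * (norm (c 0 l t))\<^sup>2)"
    by (subst Henstock_Kurzweil_Integration.integral_sum) (auto intro!: integrable_on_mult_right i)
  also have "\<dots> \<le> integral {0..T} (\<lambda>t. B)"
  proof (rule integral_le)
    fix t assume t: "t \<in> {0..T}"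
    \<comment> \<open>Here \<open>m \<ge> 1\<close> enters:
      \<open>10 \<le> 2 * (m + 4)\<close>.\<close>
    have "(\<Sum>l\<in>S. w l ^ 10 * (norm (c 0 l t))\<^sup>2) \<le> (\<Sum>l\<in>S. w l ^ (2 * (m + 4)) * (norm (c 0 l t))\<^sup>2)"
      using m by (intro sum_mono mult_right_mono power_increasing) auto
    also have "\<dots> \<le> B" by (rule cB[OF _ t]) simp
    finally show "(\<Sum>l\<in>S. w l ^ 10 * (norm (c 0 l t))\<^sup>2) \<le> B" .
  qed (auto intro!: integrable_sum integrable_on_mult_right i)
  also have "\<dots> = T * B" using T by simp
  finally have "(\<Sum>l\<in>S. w l ^ 10 * a0 l + a4 l) \<le> T * B + A"
    using rA[of S] by (simp add: sum.distrib)
  moreover have "0 \<le> Ci" using T by (simp add: interp_time_const_def)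
  ultimately show ?thesis unfolding Q_def sum_distrib_left[symmetric] by (intro mult_left_mono)
qed

text \<open>A majorant of the first derivative of mode \<open>l\<close> that is the same for all
  times, so that a single weighted sum over the modes controls every increment in time.\<close>

definition \<mu> :: "int \<Rightarrow> real" where
  "\<mu> l = sqrt (Ci * (w l ^ 10 * a0 l + a4 l) / w l ^ 6)"

lemma c1_le: "s \<in> {0..T} \<Longrightarrow> norm (c 1 l s) \<le> \<mu> l"
proof -
  assume s: "s \<in> {0..T}"
  have "(norm (c 1 l s))\<^sup>2 \<le> Ci * (w l ^ 10 * a0 l + a4 l) / w l ^ 6"
    using mode_interpolation(1)[OF s, of l] by (simp add: pos_le_divide_eq zero_less_power mult.commute)
  then show ?thesis unfolding \<mu>_def by (rule real_le_rsqrt)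
qed

lemma \<mu>_nonneg: "0 \<le> \<mu> l"
  using c1_le[of 0 l] T by (auto intro: order_trans[OF norm_ge_zero])

lemma \<mu>_sum: "(\<Sum>l\<in>S. w l ^ 2 * \<mu> l) \<le> 2 * sqrt Q"
proof -
  have "w l ^ (2 * 2 + 2) * (\<mu> l)\<^sup>2 = Ci * (w l ^ 10 * a0 l + a4 l)" for l
  proof -
    have "0 \<le> w l ^ 6 * (norm (c 1 l 0))\<^sup>2" by simp
    also have "\<dots> \<le> Ci * (w l ^ 10 * a0 l + a4 l)" by (rule mode_interpolation(1)) (use T in simp)
    finally have "(\<mu> l)\<^sup>2 = Ci * (w l ^ 10 * a0 l + a4 l) / w l ^ 6" unfolding \<mu>_def by (intro real_sqrt_pow2 divide_nonneg_nonneg) auto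
    moreover have "w l ^ 6 \<noteq> 0" by (simp add: add_nonneg_eq_0_iff)
    ultimately show ?thesis by simp
  qed
  then have "(\<Sum>l\<in>S. w l ^ (2 * 2 + 2) * (\<mu> l)\<^sup>2) \<le> Q" using interpolation_sum by simp
  then have "(\<Sum>l\<in>S. w l ^ 2 * \<bar>\<mu> l\<bar>) \<le> 2 * sqrt Q" by (rule weighted_l1_le_l2[rotated]) simp
  then show ?thesis using \<mu>_nonneg by simp
qed

lemma Q_nonneg: "0 \<le> Q"
proof -
  have "0 \<le> 2 * sqrt Q" by (rule order_trans[OF _ \<mu>_sum]) (auto intro!: sum_nonneg mult_nonneg_nonneg \<mu>_nonneg)
  then show ?thesis by simp
qed

lemma c0_diff:
  assumes "s \<in> {0..T}" "t \<in> {0..T}" "s \<le> t"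
  shows "norm (c 0 l t - c 0 l s) \<le> \<mu> l * (t - s)"
proof (rule vector_mvt_bound[where b=t and g'="c 1 l"])
  fix x assume x: "x \<in> {s..t}"
  have "(c 0 l has_vector_derivative c (Suc 0) l x) (at x within {0..T})" by (rule der) (use x assms in auto)
  then show "(c 0 l has_vector_derivative c 1 l x) (at x within {s..t})"
    using assms by (auto elim!: has_vector_derivative_within_subset)
  show "norm (c 1 l x) \<le> \<mu> l" using x assms by (intro c1_le) auto
qed (use assms in auto)

lemma wiener_trunc_diff:
  assumes "s \<in> {0..T}" "t \<in> {0..T}" "\<bar>t - s\<bar> = dt"
  shows "wiener L 2 (dt * (2 * sqrt Q)) (\<lambda>x. trunc L N (u t) x - trunc L N (u s) x)"
proof -
  have d: "norm (c 0 l t - c 0 l s) \<le> \<mu> l * dt" for l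
    using c0_diff[of s t l] c0_diff[of t s l] assms by (cases "s \<le> t") (auto simp: norm_minus_commute)
  have eq: "trunc L N (u t) x - trunc L N (u s) x = (\<Sum>l\<in>S. (c 0 l t - c 0 l s) * fourier_mode L l x)" for x
    unfolding trunc_eq[OF assms(1)] trunc_eq[OF assms(2)] by (simp add: left_diff_distrib sum_subtractf)
  have "(\<Sum>l\<in>S. norm (c 0 l t - c 0 l s) * w l ^ 2) \<le> (\<Sum>l\<in>S. dt * (w l ^ 2 * \<mu> l))"
  proof (rule sum_mono)
    fix l
    have "norm (c 0 l t - c 0 l s) * w l ^ 2 \<le> (\<mu> l * dt) * w l ^ 2" by (intro mult_right_mono d) simp
    then show "norm (c 0 l t - c 0 l s) * w l ^ 2 \<le> dt * (w l ^ 2 * \<mu> l)" by (simp only: mult_ac)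
  qed
  also have "\<dots> \<le> dt * (2 * sqrt Q)" unfolding sum_distrib_left[symmetric] using dt_pos by (intro mult_left_mono \<mu>_sum) auto
  finally show ?thesis unfolding eq by (intro wiener.mono[OF wiener_sum]) auto
qed

section \<open>The second difference in time\<close>

definition W :: "nat \<Rightarrow> real" where
  "W n = (\<Sum>l\<in>S. w l ^ 4 * integral {tm n..tm (Suc n)} (\<lambda>t. (norm (c 2 l t))\<^sup>2))"

lemma c2_int: "0 \<le> a \<Longrightarrow> b \<le> T \<Longrightarrow> (\<lambda>t. (norm (c 2 l t))\<^sup>2) integrable_on {a..b}"
  by (intro integrable_continuous_real continuous_intros continuous_on_subset[OF c_cont]) auto

lemma W_sum: "(\<Sum>n<K. W n) \<le> Q"
proof -
  have "(\<Sum>n<K. W n) = (\<Sum>l\<in>S. \<Sum>n<K. w l ^ 4 * integral {tm n..tm (Suc n)} (\<lambda>t. (norm (c 2 l t))\<^sup>2))"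
    unfolding W_def by (rule sum.swap)
  also have "\<dots> = (\<Sum>l\<in>S. w l ^ 4 * integral {0..T} (\<lambda>t. (norm (c 2 l t))\<^sup>2))"
    unfolding sum_distrib_left[symmetric]
    by (intro sum.cong refl arg_cong2[where f="(*)"] sum_integral_steps c2_int) auto
  also have "\<dots> \<le> (\<Sum>l\<in>S. Ci * (w l ^ 10 * a0 l + a4 l))" by (intro sum_mono mode_interpolation)
  also have "\<dots> \<le> Q" by (rule interpolation_sum)
  finally show ?thesis .
qed

lemma W_nonneg: "n < K \<Longrightarrow> 0 \<le> W n"
  unfolding W_def using tm_T[of "Suc n"] tm_0[of n]
  by (intro sum_nonneg mult_nonneg_nonneg integral_nonneg c2_int) auto

definition E :: "nat \<Rightarrow> real" where
  "E n = L2_set (\<lambda>l. w l ^ 2 * norm (c 0 l (tm (Suc n)) - 2 * c 0 l (tm n) + c 0 l (tm (n - 1)))) S"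

text \<open>After subtraction of the affine function with slope \<open>c 1 l (tm n)\<close>, both
  one-step increments have a derivative bounded by the integral \<open>J\<close> of
  \<open>|c''|\<close> over the two steps. The difference is then at most \<open>2 dt J\<close>, and
  Cauchy-Schwarz over the length \<open>2 dt\<close> gives
  \<open>4 dt^2 * 2 dt = 8 dt^3\<close>.\<close>

lemma second_difference_le:
  assumes n: "0 < n" "n < K"
  defines "z \<equiv> tm (n - 1)" and "b \<equiv> tm (Suc n)"
  shows "(norm (c 0 l b - 2 * c 0 l (tm n) + c 0 l z))\<^sup>2 \<le> 8 * dt ^ 3 * integral {z..b} (\<lambda>t. (norm (c 2 l t))\<^sup>2)"
proof -
  let ?a = "tm n"
  have a: "?a = z + dt" "b = ?a + dt" using tm_Suc[of "n - 1"] tm_Suc[of n] n by (auto simp: z_def b_def)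
  have ord: "0 \<le> z" "z \<le> ?a" "?a \<le> b" "b \<le> T" using a dt_pos tm_0 tm_T[of "Suc n"] n by (auto simp: z_def b_def)
  let ?J = "integral {z..b} (\<lambda>t. norm (c 2 l t))"
  have c2: "continuous_on {x..y} (c 2 l)" if "0 \<le> x" "y \<le> T" for x y
    by (rule continuous_on_subset[OF c_cont]) (use that in auto)
  have inc: "norm (c 1 l y - c 1 l x) \<le> ?J" if "z \<le> x" "x \<le> y" "y \<le> b" for x y
  proof -
    have "(c 2 l has_integral (c 1 l y - c 1 l x)) {x..y}"
    proof (rule fundamental_theorem_of_calculus)
      fix s assume s: "s \<in> {x..y}"
      have "(c 1 l has_vector_derivative c (Suc 1) l s) (at s within {0..T})" by (rule der) (use s that ord in auto)
      then show "(c 1 l has_vector_derivative c 2 l s) (at s within {x..y})"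
        using that ord by (auto simp: numeral_2_eq_2 elim!: has_vector_derivative_within_subset)
    qed (use that in auto)
    then have "norm (c 1 l y - c 1 l x) = norm (integral {x..y} (c 2 l))" by (simp add: integral_unique)
    also have "\<dots> \<le> integral {x..y} (\<lambda>t. norm (c 2 l t))"
      using that ord by (intro integral_norm_bound_integral integrable_continuous_real continuous_intros c2) auto
    also have "\<dots> \<le> ?J"
      using that ord by (intro integral_subset_le integrable_continuous_real continuous_intros c2) auto
    finally show ?thesis .
  qed
  have inc2: "norm (c 1 l x - c 1 l ?a) \<le> ?J" if "z \<le> x" "x \<le> ?a" for x
    using inc[OF that ord(3)] by (simp only: norm_minus_commute)
  have d0: "(c 0 l has_vector_derivative c 1 l s) (at s within {x..y})" if "0 \<le> x" "y \<le> T" "s \<in> {x..y}" for x y s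
  proof -
    have "(c 0 l has_vector_derivative c (Suc 0) l s) (at s within {0..T})" by (rule der) (use that in auto)
    then show ?thesis using that by (auto elim!: has_vector_derivative_within_subset)
  qed
  have lin: "((\<lambda>s. c 0 l s - s *\<^sub>R c 1 l ?a) has_vector_derivative (c 1 l s - c 1 l ?a)) (at s within {x..y})"
    if "0 \<le> x" "y \<le> T" "s \<in> {x..y}" for x y s
    using d0[OF that] by (auto intro!: derivative_eq_intros)
  have "norm ((c 0 l b - b *\<^sub>R c 1 l ?a) - (c 0 l ?a - ?a *\<^sub>R c 1 l ?a)) \<le> ?J * (b - ?a)"
    by (rule vector_mvt_bound[where b=b and g'="\<lambda>s. c 1 l s - c 1 l ?a"]) (use lin inc ord in auto)
  moreover have "norm ((c 0 l ?a - ?a *\<^sub>R c 1 l ?a) - (c 0 l z - z *\<^sub>R c 1 l ?a)) \<le> ?J * (?a - z)"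
    by (rule vector_mvt_bound[where b="?a" and g'="\<lambda>s. c 1 l s - c 1 l ?a"])
      (use lin inc2 ord in auto)
  \<comment> \<open>The affine parts drop out because the two steps have equal length.\<close>
  moreover have "c 0 l b - 2 * c 0 l ?a + c 0 l z = ((c 0 l b - b *\<^sub>R c 1 l ?a) - (c 0 l ?a - ?a *\<^sub>R c 1 l ?a))
      - ((c 0 l ?a - ?a *\<^sub>R c 1 l ?a) - (c 0 l z - z *\<^sub>R c 1 l ?a))"
    unfolding a(2) a(1) by (simp add: scaleR_conv_of_real algebra_simps)
  ultimately have N: "norm (c 0 l b - 2 * c 0 l ?a + c 0 l z) \<le> ?J * dt + ?J * dt"
    using norm_triangle_ineq4 a by (smt (verit) add_diff_cancel_left')
  have "?J\<^sup>2 \<le> (b - z) * integral {z..b} (\<lambda>t. (norm (c 2 l t))\<^sup>2)"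
    using ord by (intro integral_Cauchy_Schwarz integrable_continuous_real continuous_intros c2) auto
  also have "b - z = 2 * dt" using a by simp
  finally have J: "?J\<^sup>2 \<le> 2 * dt * integral {z..b} (\<lambda>t. (norm (c 2 l t))\<^sup>2)" .
  have "(norm (c 0 l b - 2 * c 0 l ?a + c 0 l z))\<^sup>2 \<le> (?J * dt + ?J * dt)\<^sup>2" using N by (rule power_mono) simp
  also have "\<dots> = 4 * dt\<^sup>2 * ?J\<^sup>2" by (simp add: power2_eq_square algebra_simps)
  also have "\<dots> \<le> 4 * dt\<^sup>2 * (2 * dt * integral {z..b} (\<lambda>t. (norm (c 2 l t))\<^sup>2))" by (intro mult_left_mono J) simp
  also have "\<dots> = 8 * dt ^ 3 * integral {z..b} (\<lambda>t. (norm (c 2 l t))\<^sup>2)" by (simp add: power2_eq_square power3_eq_cube)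
  finally show ?thesis .
qed

lemma E_square_le:
  assumes n: "0 < n" "n < K"
  shows "(E n)\<^sup>2 \<le> 8 * dt ^ 3 * (W (n - 1) + W n)"
proof -
  let ?D = "\<lambda>l. c 0 l (tm (Suc n)) - 2 * c 0 l (tm n) + c 0 l (tm (n - 1))"
  have Sn: "Suc (n - 1) = n" using n by simp
  have ord: "0 \<le> tm (n - 1)" "tm (n - 1) \<le> tm n" "tm n \<le> tm (Suc n)" "tm (Suc n) \<le> T"
    using tm_Suc[of "n - 1"] tm_Suc[of n] dt_pos tm_0 tm_T[of "Suc n"] n Sn by auto
  have "(E n)\<^sup>2 = (\<Sum>l\<in>S. w l ^ 4 * (norm (?D l))\<^sup>2)"
    unfolding E_def L2_set_def by (simp add: sum_nonneg power_mult_distrib flip: power_mult)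
  also have "\<dots> \<le> (\<Sum>l\<in>S. w l ^ 4 * (8 * dt ^ 3 * integral {tm (n - 1)..tm (Suc n)} (\<lambda>t. (norm (c 2 l t))\<^sup>2)))"
    by (intro sum_mono mult_left_mono second_difference_le n) auto
  also have "\<dots> = 8 * dt ^ 3 * (W (n - 1) + W n)"
  proof -
    have "integral {tm (n - 1)..tm (Suc n)} (\<lambda>t. (norm (c 2 l t))\<^sup>2)
      = integral {tm (n - 1)..tm n} (\<lambda>t. (norm (c 2 l t))\<^sup>2) + integral {tm n..tm (Suc n)} (\<lambda>t. (norm (c 2 l t))\<^sup>2)" for l
      using ord by (intro Henstock_Kurzweil_Integration.integral_combine[symmetric] c2_int) auto
    then show ?thesis unfolding W_def Sn sum.distrib[symmetric] sum_distrib_left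
      by (intro sum.cong refl) (simp only: distrib_left mult_ac)
  qed
  finally show ?thesis .
qed

definition H :: real where "H = (real p)\<^sup>2 * R ^ p"

lemma second_difference_sobolev:
  assumes n: "0 < n" "n < K"
  shows "sobolev L 2 (H * (E n + 2 * (dt * (2 * sqrt Q))\<^sup>2))
    (\<lambda>x. trunc L N (u (tm (Suc n))) x ^ p - 2 * trunc L N (u (tm n)) x ^ p + trunc L N (u (tm (n - 1))) x ^ p)"
  unfolding H_def
proof (rule sobolev_power_second_diff[OF L])
  have in_T: "tm (n - 1) \<in> {0..T}" "tm n \<in> {0..T}" "tm (Suc n) \<in> {0..T}" using tm_in n by auto
  show "wiener L 2 R (trunc L N (u (tm (Suc n))))" "wiener L 2 R (trunc L N (u (tm n)))" "wiener L 2 R (trunc L N (u (tm (n - 1))))"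
    by (intro wiener_2_trunc in_T)+
  have "tm n - tm (n - 1) = dt" using tm_Suc[of "n - 1"] n by simp
  then show "wiener L 2 (dt * (2 * sqrt Q)) (\<lambda>x. trunc L N (u (tm (n - 1))) x - trunc L N (u (tm n)) x)"
    using in_T dt_pos by (intro wiener_trunc_diff) auto
  show "wiener L 2 (dt * (2 * sqrt Q)) (\<lambda>x. trunc L N (u (tm (Suc n))) x - trunc L N (u (tm n)) x)"
    using in_T tm_Suc[of n] dt_pos by (intro wiener_trunc_diff) auto
  have "trunc L N (u (tm (Suc n))) x - 2 * trunc L N (u (tm n)) x + trunc L N (u (tm (n - 1))) x
     = (\<Sum>l\<in>S. (c 0 l (tm (Suc n)) - 2 * c 0 l (tm n) + c 0 l (tm (n - 1))) * fourier_mode L l x)" for x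
    by (simp only: trunc_eq in_T sum_distrib_left sum_subtractf[symmetric] sum.distrib[symmetric] left_diff_distrib distrib_right mult.assoc)
  then show "sobolev L 2 (E n) (\<lambda>x. trunc L N (u (tm (Suc n))) x - 2 * trunc L N (u (tm n)) x + trunc L N (u (tm (n - 1))) x)"
    unfolding E_def using sobolev_trig[OF L, of S 2 "\<lambda>l. c 0 l (tm (Suc n)) - 2 * c 0 l (tm n) + c 0 l (tm (n - 1))"] by simp
qed (rule R_ge_1)

definition P :: "nat \<Rightarrow> nat \<Rightarrow> real" where
  "P n i = norm (proj_xx L N (\<lambda>x. trunc L N (u (tm (Suc n))) x ^ p - 2 * trunc L N (u (tm n)) x ^ p + trunc L N (u (tm (n - 1))) x ^ p) (xg i))"

lemma P_square_sum:
  assumes n: "0 < n" "n < K"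
  shows "(\<Sum>i\<le>2 * N. (P n i)\<^sup>2) / real (2 * N + 1) \<le> (\<kappa> * H)\<^sup>2 * (16 * dt ^ 3 * (W (n - 1) + W n) + 128 * dt ^ 4 * Q\<^sup>2)"
proof -
  let ?D = "(dt * (2 * sqrt Q))\<^sup>2"
  have D: "?D = 4 * dt\<^sup>2 * Q" using Q_nonneg by (simp add: power_mult_distrib)
  have "(\<Sum>i\<le>2 * N. (P n i)\<^sup>2) / real (2 * N + 1) \<le> (\<kappa> * (H * (E n + 2 * ?D)))\<^sup>2"
    unfolding P_def \<kappa>_def by (rule proj_xx_sobolev_bound[OF L second_difference_sobolev[OF n]])
  also have "\<dots> = (\<kappa> * H)\<^sup>2 * (E n + 2 * ?D)\<^sup>2" by (simp add: power_mult_distrib)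
  also have "\<dots> \<le> (\<kappa> * H)\<^sup>2 * (2 * ((E n)\<^sup>2 + (2 * ?D)\<^sup>2))" by (intro mult_left_mono power2_sum_le) simp
  also have "\<dots> \<le> (\<kappa> * H)\<^sup>2 * (2 * (8 * dt ^ 3 * (W (n - 1) + W n) + (2 * ?D)\<^sup>2))"
    by (intro mult_left_mono add_right_mono E_square_le n) auto
  also have "\<dots> = (\<kappa> * H)\<^sup>2 * (16 * dt ^ 3 * (W (n - 1) + W n) + 128 * dt ^ 4 * Q\<^sup>2)"
    unfolding D by (simp add: power_mult_distrib flip: power_mult)
  finally show ?thesis .
qed

text \<open>The first summand collects the two halves of the truncation error of \<open>u^p\<close>
  at both ends of the step; the second is aliasing, where the extrapolation weights
  \<open>3/2\<close> and \<open>1/2\<close> add up to 2 in absolute value.\<close>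

definition G :: real where "G = \<kappa> * (real p * R ^ p * R + 2 * R ^ p)"

lemma NL_bound:
  assumes n: "0 < n" "n < K"
  shows "norm (NL n (xg i)) \<le> G * \<theta> + P n i / 2"
proof -
  let ?X = "trunc L N (u (tm (Suc n)))" and ?Y = "trunc L N (u (tm n))" and ?Z = "trunc L N (u (tm (n - 1)))"
  let ?pr = "\<lambda>g. proj_xx L N g (xg i)" and ?ub = "\<lambda>x. complex_of_real (u (tm (Suc n)) x ^ p)"
    and ?ua = "\<lambda>x. complex_of_real (u (tm n) x ^ p)"
  let ?g = "\<lambda>x. 3 / 2 * ?Y x ^ p - 1 / 2 * ?Z x ^ p" and ?d = "\<lambda>x. ?X x ^ p - 2 * ?Y x ^ p + ?Z x ^ p"
  have in_T: "tm (n - 1) \<in> {0..T}" "tm n \<in> {0..T}" "tm (Suc n) \<in> {0..T}" using tm_in n by auto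
  have ct: "continuous_on UNIV (\<lambda>x. trunc L N (u t) x ^ p)" for t by (intro continuous_intros continuous_on_trunc)
  have cd: "continuous_on UNIV ?d" by (intro continuous_intros continuous_on_trunc)
  have cg: "continuous_on UNIV ?g" by (intro continuous_intros continuous_on_trunc)
  have tr: "norm (?pr (\<lambda>x. of_real (u t x ^ p)) - ?pr (\<lambda>x. trunc L N (u t) x ^ p)) \<le> \<kappa> * (real p * R ^ p * (\<theta> * R))"
    if t: "t \<in> {0..T}" for t
    unfolding \<kappa>_def \<theta>_def by (rule power_truncation_bound[OF L ucont[OF t] R_ge_1 coeff_l1_bound[OF t]])
  \<comment> \<open>Twice the extrapolated value plus the second difference is the sum of the values
    at both ends, so the average exceeds the extrapolation by half the second difference.\<close>
  have "(\<lambda>x. ?X x ^ p + ?Y x ^ p) = (\<lambda>x. ?d x + 2 * ?g x)" by (simp add: fun_eq_iff)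
  then have "?pr (\<lambda>x. ?X x ^ p + ?Y x ^ p) = ?pr (\<lambda>x. ?d x + 2 * ?g x)" by simp
  then have split: "?pr (\<lambda>x. ?X x ^ p) + ?pr (\<lambda>x. ?Y x ^ p) = ?pr ?d + 2 * ?pr ?g"
  proof -
    have "continuous_on UNIV (\<lambda>x. 2 * ?g x)" by (intro continuous_on_mult continuous_on_const cg)
    from proj_xx_add[OF cd this, of L N "xg i"] have "?pr (\<lambda>x. ?d x + 2 * ?g x) = ?pr ?d + 2 * ?pr ?g"
      unfolding proj_xx_mult .
    then show ?thesis using \<open>?pr (\<lambda>x. ?X x ^ p + ?Y x ^ p) = ?pr (\<lambda>x. ?d x + 2 * ?g x)\<close>
      unfolding proj_xx_add[OF ct ct] by (simp only:)
  qed
  have "NL n (xg i) = (?pr ?ub - ?pr (\<lambda>x. ?X x ^ p)) / 2 + (?pr ?ua - ?pr (\<lambda>x. ?Y x ^ p)) / 2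
      + ?pr ?d / 2 + (?pr ?g - interp_xx L N ?g (xg i))"
  proof -
    have "?pr ?d = ?pr (\<lambda>x. ?X x ^ p) + ?pr (\<lambda>x. ?Y x ^ p) - 2 * ?pr ?g" using split by simp
    then show ?thesis unfolding NL_def by (simp add: add_divide_distrib diff_divide_distrib)
  qed
  then have "norm (NL n (xg i)) \<le> norm ((?pr ?ub - ?pr (\<lambda>x. ?X x ^ p)) / 2) + norm ((?pr ?ua - ?pr (\<lambda>x. ?Y x ^ p)) / 2)
      + norm (?pr ?d / 2) + norm (?pr ?g - interp_xx L N ?g (xg i))"
    by (simp only:) (intro order_trans[OF norm_triangle_ineq] add_mono order_refl norm_triangle_ineq)
  also have "\<dots> \<le> \<kappa> * (real p * R ^ p * (\<theta> * R)) / 2 + \<kappa> * (real p * R ^ p * (\<theta> * R)) / 2 + P n i / 2 + \<kappa> * \<theta> * (2 * R ^ p)"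
  proof (intro add_mono)
    show "norm ((?pr ?ub - ?pr (\<lambda>x. ?X x ^ p)) / 2) \<le> \<kappa> * (real p * R ^ p * (\<theta> * R)) / 2"
      "norm ((?pr ?ua - ?pr (\<lambda>x. ?Y x ^ p)) / 2) \<le> \<kappa> * (real p * R ^ p * (\<theta> * R)) / 2"
      using tr[OF in_T(3)] tr[OF in_T(2)] by (simp_all add: norm_divide)
    show "norm (?pr ?d / 2) \<le> P n i / 2" unfolding P_def by (simp add: norm_divide)
    have "wiener L (m + 2) (norm (3 / 2 :: complex) * R ^ p + norm (1 / 2 :: complex) * R ^ p) ?g"
      by (intro wiener_diff wiener_scale wiener_power wiener_trunc in_T)
    then have "wiener L (m + 2) (2 * R ^ p) ?g" by (simp add: norm_divide)
    from aliasing_bound[OF L this, of N "xg i"] show "norm (?pr ?g - interp_xx L N ?g (xg i)) \<le> \<kappa> * \<theta> * (2 * R ^ p)"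
      unfolding \<kappa>_def \<theta>_def .
  qed
  also have "\<dots> = G * \<theta> + P n i / 2" unfolding G_def by (simp add: algebra_simps)
  finally show ?thesis .
qed

text \<open>Defined as the defect, so that the scheme holds by construction and the whole content is
  in the norm bound. The index \<open>n - 1\<close> is meaningful since only
  \<open>n \<ge> 1\<close> is considered.\<close>

definition \<tau>1 :: "nat \<Rightarrow> nat \<Rightarrow> real" where
  "\<tau>1 n i = (Psi_approx L T N dt u (tm (n + 1)) (xg i) - Psi_approx L T N dt u (tm n) (xg i)) / dt
    - (- (discrete_deriv L N ^^ 4) (\<lambda>j. (U_approx L N u (tm (n + 1)) (xg j) + U_approx L N u (tm n) (xg j)) / 2) i
       + (discrete_deriv L N ^^ 2) (\<lambda>j. (U_approx L N u (tm (n + 1)) (xg j) + U_approx L N u (tm n) (xg j)) / 2) i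
       + (discrete_deriv L N ^^ 2) (\<lambda>j. 3 / 2 * U_approx L N u (tm n) (xg j) ^ p - 1 / 2 * U_approx L N u (tm (n - 1)) (xg j) ^ p) i)"

definition \<tau>2 :: "nat \<Rightarrow> nat \<Rightarrow> real" where
  "\<tau>2 n i = ((U_approx L N u (tm (n + 1)) (xg i) - U_approx L N u (tm n) (xg i)) / dt
    - (Psi_approx L T N dt u (tm (n + 1)) (xg i) + Psi_approx L T N dt u (tm n) (xg i)) / 2) / dt"

lemma \<tau>2_le: "n < K \<Longrightarrow> \<bar>\<tau>2 n i\<bar> \<le> 2 * I n i * dt"
  using residual_bounds(1)[of n i] dt_pos unfolding \<tau>2_def
  by (simp add: abs_divide pos_divide_le_eq power2_eq_square mult.assoc)

lemma \<tau>1_le: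
  assumes n: "0 < n" "n < K" and i: "i \<le> 2 * N"
  shows "\<bar>\<tau>1 n i\<bar> \<le> 2 * I n i * dt + G * \<theta> + P n i / 2"
proof -
  let ?\<Psi> = "\<lambda>t. Psi_approx L T N dt u t (xg i)"
  have "\<tau>1 n i = ((?\<Psi> (tm (Suc n)) - ?\<Psi> (tm n)) / dt - (Re (F 2 (xg i) (tm (Suc n))) + Re (F 2 (xg i) (tm n))) / 2) + Re (NL n (xg i))"
    unfolding \<tau>1_def residual1_eq[OF n(2) i, symmetric] by simp
  then have "\<bar>\<tau>1 n i\<bar> \<le> \<bar>(?\<Psi> (tm (Suc n)) - ?\<Psi> (tm n)) / dt - (Re (F 2 (xg i) (tm (Suc n))) + Re (F 2 (xg i) (tm n))) / 2\<bar> + \<bar>Re (NL n (xg i))\<bar>"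
    by linarith
  also have "\<dots> \<le> 2 * I n i * dt + norm (NL n (xg i))"
    by (intro add_mono residual_bounds(2) n abs_Re_le_cmod)
  finally show ?thesis using NL_bound[OF n, of i] by linarith
qed

text \<open>The coefficient of \<open>dt^4\<close> after summation over the steps.
  \<open>24 Q\<close> stands for twice \<open>12 Q\<close>, as the second difference at step
  \<open>n\<close> reaches into the steps \<open>n - 1\<close> and \<open>n\<close>.\<close>

definition C1 :: real where "C1 = 12 * A + (\<kappa> * H)\<^sup>2 * (24 * Q + 96 * T * Q\<^sup>2)"

text \<open>Squaring a sum of three terms costs the factor 3: \<open>3 * 2^2 = 12\<close> for the
  Taylor part, and \<open>3 / 4\<close> times the coefficients 16 and 128 for the half second
  difference.\<close>

lemma \<tau>1_norm_square:
  assumes n: "0 < n" "n < K"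
  shows "(discrete_norm N (\<tau>1 n))\<^sup>2 \<le> 12 * dt ^ 3 * V n + 3 * (G * \<theta>)\<^sup>2
    + (\<kappa> * H)\<^sup>2 * (12 * dt ^ 3 * (W (n - 1) + W n) + 96 * dt ^ 4 * Q\<^sup>2)"
proof -
  have three: "(x + y + z)\<^sup>2 \<le> 3 * x\<^sup>2 + 3 * y\<^sup>2 + 3 * z\<^sup>2" for x y z :: real
  proof -
    have "0 \<le> (x - y)\<^sup>2 + (y - z)\<^sup>2 + (x - z)\<^sup>2" by simp
    then show ?thesis by (simp add: power2_eq_square algebra_simps)
  qed
  have "(\<tau>1 n i)\<^sup>2 \<le> 12 * dt\<^sup>2 * (I n i)\<^sup>2 + 3 * (G * \<theta>)\<^sup>2 + 3 / 4 * (P n i)\<^sup>2" if "i \<le> 2 * N" for i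
  proof -
    have "\<bar>\<tau>1 n i\<bar>\<^sup>2 \<le> (2 * I n i * dt + G * \<theta> + P n i / 2)\<^sup>2" by (intro power_mono \<tau>1_le n that) simp
    also have "\<dots> \<le> 3 * (2 * I n i * dt)\<^sup>2 + 3 * (G * \<theta>)\<^sup>2 + 3 * (P n i / 2)\<^sup>2" by (rule three)
    finally show ?thesis by (simp add: power_mult_distrib power_divide mult_ac)
  qed
  then have "(discrete_norm N (\<tau>1 n))\<^sup>2 \<le> (\<Sum>i\<le>2 * N. 12 * dt\<^sup>2 * (I n i)\<^sup>2 + 3 * (G * \<theta>)\<^sup>2 + 3 / 4 * (P n i)\<^sup>2) / real (2 * N + 1)"
    unfolding discrete_norm_square by (intro divide_right_mono sum_mono) auto
  also have "\<dots> = 12 * dt\<^sup>2 * ((\<Sum>i\<le>2 * N. (I n i)\<^sup>2) / real (2 * N + 1)) + 3 * (G * \<theta>)\<^sup>2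
      + 3 / 4 * ((\<Sum>i\<le>2 * N. (P n i)\<^sup>2) / real (2 * N + 1))"
  proof -
    define M where "M = real (2 * N + 1)"
    have M: "M \<noteq> 0" "real (card {..2 * N}) = M" by (simp_all add: M_def)
    show ?thesis unfolding sum.distrib sum_distrib_left[symmetric] sum_constant M(2) M_def[symmetric]
      using M(1) by (simp add: add_divide_distrib)
  qed
  also have "\<dots> \<le> 12 * dt\<^sup>2 * (dt * V n) + 3 * (G * \<theta>)\<^sup>2
      + 3 / 4 * ((\<kappa> * H)\<^sup>2 * (16 * dt ^ 3 * (W (n - 1) + W n) + 128 * dt ^ 4 * Q\<^sup>2))"
    by (intro add_mono mult_left_mono order_refl I_square_sum P_square_sum n) auto
  also have "\<dots> = 12 * dt ^ 3 * V n + 3 * (G * \<theta>)\<^sup>2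
    + (\<kappa> * H)\<^sup>2 * (12 * dt ^ 3 * (W (n - 1) + W n) + 96 * dt ^ 4 * Q\<^sup>2)"
    by (simp add: power2_eq_square power3_eq_cube algebra_simps)
  finally show ?thesis .
qed

section \<open>Summation over the time steps\<close>

lemma sum_steps_le:
  assumes "\<And>n. n < K \<Longrightarrow> 0 \<le> g n"
  shows "(\<Sum>n = 1..K - 1. g n) \<le> (\<Sum>n<K. g n :: real)" "(\<Sum>n = 1..K - 1. g (n - 1)) \<le> (\<Sum>n<K. g n)"
proof -
  show "(\<Sum>n = 1..K - 1. g n) \<le> (\<Sum>n<K. g n)" by (rule sum_mono2) (use assms K in auto)
  have "(\<Sum>n = 1..K - 1. g (n - 1)) = (\<Sum>n<K - 1. g n)"
    by (rule sum.reindex_bij_witness[of _ Suc "\<lambda>n. n - 1"]) auto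
  also have "\<dots> \<le> (\<Sum>n<K. g n)" by (rule sum_mono2) (use assms in auto)
  finally show "(\<Sum>n = 1..K - 1. g (n - 1)) \<le> (\<Sum>n<K. g n)" .
qed

lemma \<tau>1_time_norm: "(discrete_time_norm N dt K \<tau>1)\<^sup>2 \<le> C1 * dt ^ 4 + 3 * T * (G * \<theta>)\<^sup>2"
proof -
  let ?k = "(\<kappa> * H)\<^sup>2"
  have "(discrete_time_norm N dt K \<tau>1)\<^sup>2 = dt * (\<Sum>n = 1..K - 1. (discrete_norm N (\<tau>1 n))\<^sup>2)"
    unfolding discrete_time_norm_def using dt_pos by (intro real_sqrt_pow2 mult_nonneg_nonneg sum_nonneg) auto
  also have "\<dots> \<le> dt * (\<Sum>n = 1..K - 1. 12 * dt ^ 3 * V n + 3 * (G * \<theta>)\<^sup>2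
    + ?k * (12 * dt ^ 3 * (W (n - 1) + W n) + 96 * dt ^ 4 * Q\<^sup>2))"
    using dt_pos by (intro mult_left_mono sum_mono \<tau>1_norm_square) auto
  also have "\<dots> = 12 * dt ^ 4 * (\<Sum>n = 1..K - 1. V n) + (dt * real (K - 1)) * (3 * (G * \<theta>)\<^sup>2)
      + ?k * (12 * dt ^ 4 * ((\<Sum>n = 1..K - 1. W (n - 1)) + (\<Sum>n = 1..K - 1. W n)) + (dt * real (K - 1)) * (96 * dt ^ 4 * Q\<^sup>2))"
    unfolding distrib_left sum.distrib sum_distrib_left[symmetric] sum_constant
    by (simp add: algebra_simps power_numeral_reduce)
  also have "\<dots> \<le> 12 * dt ^ 4 * A + T * (3 * (G * \<theta>)\<^sup>2) + ?k * (12 * dt ^ 4 * (Q + Q) + T * (96 * dt ^ 4 * Q\<^sup>2))"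
  proof -
    have dK: "dt * real (K - 1) \<le> T"
      using K_dt dt_pos K by (simp add: of_nat_diff algebra_simps)
    have V: "(\<Sum>n = 1..K - 1. V n) \<le> A" by (rule order_trans[OF sum_steps_le(1)[OF V_nonneg] V_sum])
    have W: "(\<Sum>n = 1..K - 1. W (n - 1)) \<le> Q" by (rule order_trans[OF sum_steps_le(2)[OF W_nonneg] W_sum])
    have W': "(\<Sum>n = 1..K - 1. W n) \<le> Q" by (rule order_trans[OF sum_steps_le(1)[OF W_nonneg] W_sum])
    show ?thesis by (intro add_mono mult_left_mono mult_right_mono V W W' dK) (use Q_nonneg in auto)
  qed
  also have "\<dots> = C1 * dt ^ 4 + 3 * T * (G * \<theta>)\<^sup>2" by (simp add: C1_def algebra_simps)
  finally show ?thesis .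
qed

lemma \<tau>2_time_norm: "(discrete_time_norm N dt K \<tau>2)\<^sup>2 \<le> C1 * dt ^ 4"
proof -
  have "(discrete_norm N (\<tau>2 n))\<^sup>2 \<le> 4 * dt ^ 3 * V n" if n: "n < K" for n
  proof -
    have "(\<tau>2 n i)\<^sup>2 \<le> 4 * dt\<^sup>2 * (I n i)\<^sup>2" for i
    proof -
      have "\<bar>\<tau>2 n i\<bar>\<^sup>2 \<le> (2 * I n i * dt)\<^sup>2" by (intro power_mono \<tau>2_le n) simp
      then show ?thesis by (simp add: power_mult_distrib mult_ac)
    qed
    then have "(discrete_norm N (\<tau>2 n))\<^sup>2 \<le> (\<Sum>i\<le>2 * N. 4 * dt\<^sup>2 * (I n i)\<^sup>2) / real (2 * N + 1)"
      unfolding discrete_norm_square by (intro divide_right_mono sum_mono) auto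
    also have "\<dots> = 4 * dt\<^sup>2 * ((\<Sum>i\<le>2 * N. (I n i)\<^sup>2) / real (2 * N + 1))"
      by (simp only: sum_distrib_left[symmetric] times_divide_eq_right)
    also have "\<dots> \<le> 4 * dt\<^sup>2 * (dt * V n)" by (intro mult_left_mono I_square_sum n) simp
    finally show ?thesis by (simp add: power2_eq_square power3_eq_cube)
  qed
  note N2 = this
  have "(discrete_time_norm N dt K \<tau>2)\<^sup>2 = dt * (\<Sum>n = 1..K - 1. (discrete_norm N (\<tau>2 n))\<^sup>2)"
    unfolding discrete_time_norm_def using dt_pos by (intro real_sqrt_pow2 mult_nonneg_nonneg sum_nonneg) auto
  also have "\<dots> \<le> dt * (\<Sum>n = 1..K - 1. 4 * dt ^ 3 * V n)"
    using dt_pos by (intro mult_left_mono sum_mono N2) auto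
  also have "\<dots> = 4 * dt ^ 4 * (\<Sum>n = 1..K - 1. V n)"
    unfolding sum_distrib_left[symmetric] by (simp add: power_numeral_reduce)
  also have "\<dots> \<le> 4 * dt ^ 4 * A"
    by (intro mult_left_mono order_trans[OF sum_steps_le(1)[OF V_nonneg] V_sum]) auto
  also have "\<dots> \<le> C1 * dt ^ 4"
  proof -
    have "4 * A \<le> C1" unfolding C1_def using A0 Q_nonneg T by (intro order_trans[OF _ add_increasing2]) auto
    then have "4 * A * dt ^ 4 \<le> C1 * dt ^ 4" by (rule mult_right_mono) simp
    then show ?thesis by (simp only: mult_ac)
  qed
  finally show ?thesis .
qed

text \<open>Only \<open>L\<close>, \<open>T\<close>, \<open>A\<close>, \<open>B\<close>,
  \<open>p\<close> and \<open>m\<close> occur, directly or through the constants above, so outside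
  the locale this is a function of norms of the solution and fixed parameters.\<close>

definition Cst :: real where "Cst = sqrt C1 + sqrt (3 * T) * G * (2 / L) ^ m"

lemma G_nonneg: "0 \<le> G"
  unfolding G_def \<kappa>_def using R_ge_1 by (intro mult_nonneg_nonneg add_nonneg_nonneg) auto

lemma consistency:
  "discrete_time_norm N dt K \<tau>1 \<le> Cst * (dt\<^sup>2 + (L / (2 * real N + 1)) ^ m)"
  "discrete_time_norm N dt K \<tau>2 \<le> Cst * (dt\<^sup>2 + (L / (2 * real N + 1)) ^ m)"
proof -
  let ?h = "L / (2 * real N + 1)"
  let ?g = "sqrt (3 * T) * G * (2 / L) ^ m"
  \<comment> \<open>Separates the power of the mesh width from the factor \<open>(2 / L)^m\<close>,
    which moves into the constant.\<close>
  have "\<theta> = (2 / L * ?h) ^ m" using L by (simp add: \<theta>_def)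
  then have \<theta>: "\<theta> = (2 / L) ^ m * ?h ^ m" by (simp only: power_mult_distrib)
  have C1: "0 \<le> C1" unfolding C1_def using A0 Q_nonneg T by auto
  have g: "0 \<le> ?g" using G_nonneg T L by simp
  have h: "0 \<le> ?h ^ m" using L by simp
  have dt4: "sqrt (dt ^ 4) = dt\<^sup>2"
  proof -
    have "dt ^ 4 = (dt\<^sup>2)\<^sup>2" by (simp flip: power_mult)
    then show ?thesis by (simp only: real_sqrt_abs abs_power2)
  qed
  have final: "y \<le> Cst * (dt\<^sup>2 + ?h ^ m)" if y: "y\<^sup>2 \<le> C1 * dt ^ 4 + 3 * T * (G * \<theta>)\<^sup>2" for y
  proof -
    have "y \<le> sqrt (y\<^sup>2)" by simp
    also have "\<dots> \<le> sqrt (C1 * dt ^ 4 + 3 * T * (G * \<theta>)\<^sup>2)" by (rule real_sqrt_le_mono[OF y])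
    also have "\<dots> \<le> sqrt (C1 * dt ^ 4) + sqrt (3 * T * (G * \<theta>)\<^sup>2)"
      using C1 T by (intro sqrt_add_le_add_sqrt) auto
    also have "\<dots> = sqrt C1 * dt\<^sup>2 + sqrt (3 * T) * (G * \<theta>)"
    proof -
      have "0 \<le> G * \<theta>" using G_nonneg by (simp add: \<theta>_def)
      then show ?thesis by (simp add: real_sqrt_mult dt4)
    qed
    also have "\<dots> = sqrt C1 * dt\<^sup>2 + ?g * ?h ^ m" unfolding \<theta> by simp
    also have "\<dots> \<le> Cst * dt\<^sup>2 + Cst * ?h ^ m"
      unfolding Cst_def using g C1 h by (intro add_mono mult_right_mono) auto
    finally show ?thesis by (simp add: distrib_left)
  qed
  show "discrete_time_norm N dt K \<tau>1 \<le> Cst * (dt\<^sup>2 + ?h ^ m)" by (rule final[OF \<tau>1_time_norm])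
  have "0 \<le> 3 * T * (G * \<theta>)\<^sup>2" using T by simp
  then show "discrete_time_norm N dt K \<tau>2 \<le> Cst * (dt\<^sup>2 + ?h ^ m)"
    using \<tau>2_time_norm by (intro final) linarith
qed
end

theorem theorem3p1:
  fixes L T :: real and p m :: nat
  assumes "L > 0" and "T > 0" and "p \<ge> 2" and "m \<ge> 1"
  shows "\<exists>M :: real \<Rightarrow> real \<Rightarrow> real \<Rightarrow> real.
    \<forall>(u :: real \<Rightarrow> real \<Rightarrow> real) (u0 :: real \<Rightarrow> real) (v0 :: real \<Rightarrow> real) (N :: nat) (K :: nat).
      boussinesq_solution L T p u0 v0 u \<and>
      u \<in> H_time L T 4 0 \<and> u \<in> Linf_time L T (m + 4) \<and> u \<in> H_time L T 2 4 \<and>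
      K \<ge> 1 \<longrightarrow>
      (let h = L / (2 * real N + 1);
           dt = T / real K;
           D = discrete_deriv L N;
           U = (\<lambda>n i. U_approx L N u (real n * dt) (grid_point L N i));
           \<Psi> = (\<lambda>n i. Psi_approx L T N dt u (real n * dt) (grid_point L N i));
           B = M (H_time_norm L T 4 0 u) (Linf_time_norm L T (m + 4) u) (H_time_norm L T 2 4 u)
       in \<exists>\<tau>1 \<tau>2 :: nat \<Rightarrow> nat \<Rightarrow> real.
            (\<forall>n\<in>{1..K - 1}. \<forall>i\<le>2 * N.
               (\<Psi> (n + 1) i - \<Psi> n i) / dt =
                 - (D ^^ 4) (\<lambda>j. (U (n + 1) j + U n j) / 2) i
                 + (D ^^ 2) (\<lambda>j. (U (n + 1) j + U n j) / 2) i
                 + (D ^^ 2) (\<lambda>j. 3 / 2 * U n j ^ p - 1 / 2 * U (n - 1) j ^ p) i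
                 + \<tau>1 n i \<and>
               (U (n + 1) i - U n i) / dt = (\<Psi> (n + 1) i + \<Psi> n i) / 2 + dt * \<tau>2 n i) \<and>
            discrete_time_norm N dt K \<tau>1 \<le> B * (dt\<^sup>2 + h ^ m) \<and>
            discrete_time_norm N dt K \<tau>2 \<le> B * (dt\<^sup>2 + h ^ m))"
proof -
  let ?A = "\<lambda>a. a\<^sup>2 / L" and ?B = "\<lambda>b. sobolev_const L (m + 4) * b\<^sup>2"
  show ?thesis
  \<comment> \<open>The bound is the locale constant at \<open>A = a^2 / L\<close>, from Bessel's
    inequality for the fourth time derivative, and \<open>B = sobolev_const L (m + 4) * b^2\<close>,
    from the weighted coefficient bound; it is chosen before the solution and the meshes.\<close>
  proof (rule exI[of _ "\<lambda>a b _. spectral_modes.Cst L T (?A a) (?B b) p m"], intro allI impI, elim conjE)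
    fix u :: "real \<Rightarrow> real \<Rightarrow> real" and u0 v0 :: "real \<Rightarrow> real" and N K :: nat
    assume sol: "boussinesq_solution L T p u0 v0 u" and u4: "u \<in> H_time L T 4 0"
      and uinf: "u \<in> Linf_time L T (m + 4)" and K: "1 \<le> K"
    have cont: "continuous_on ({0..T} \<times> UNIV) (case_prod u)"
      using sol by (simp add: boussinesq_solution_def)
    obtain c :: "nat \<Rightarrow> int \<Rightarrow> real \<Rightarrow> complex" where
      c0: "\<And>l t. t \<in> {0..T} \<Longrightarrow> c 0 l t = fourier_coeff L (u t) l" and
      cAE: "\<And>j l. j < 4 \<Longrightarrow> 0 < j \<Longrightarrow> AE t in lebI T. c j l t = fourier_coeff L (tderiv L T j u t) l" and
      cc: "\<And>j l. j < 4 \<Longrightarrow> continuous_on {0..T} (c j l)" and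
      der: "\<And>j l t. j < 3 \<Longrightarrow> t \<in> {0..T} \<Longrightarrow> (c j l has_vector_derivative c (Suc j) l t) (at t within {0..T})" and
      c3: "\<And>l t. t \<in> {0..T} \<Longrightarrow> c 3 l t = c 3 l 0 + integral {0..t} (\<lambda>s. fourier_coeff L (tderiv L T 4 u s) l)"
      using mode_regularity[OF \<open>0 < L\<close> \<open>0 < T\<close> u4 cont] by blast
    let ?r = "\<lambda>l t. fourier_coeff L (tderiv L T 4 u t) l"
    have r1: "integrable (lebI T) (?r l)" for l
      by (intro integrable_fourier_coeff L2_time_D(4)[OF \<open>0 < L\<close> tderiv_spec(1)[OF u4]]) simp
    note r2 = tderiv_coeff_bound[OF \<open>0 < L\<close> u4 order_refl]
    interpret spectral_modes L T "?A (H_time_norm L T 4 0 u)" "?B (Linf_time_norm L T (m + 4) u)" p m N K u c ?r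
    proof
      show "continuous_on UNIV (u t)" if "t \<in> {0..T}" for t
      proof -
        have "continuous_on UNIV (\<lambda>x. case_prod u (t, x))"
          by (rule continuous_on_compose2[OF cont]) (use that in \<open>auto intro!: continuous_intros\<close>)
        then show ?thesis by simp
      qed
      show "integrable (lebI T) (\<lambda>t. (norm (?r l t))\<^sup>2)" for l
        by (rule r2(1)[OF finite.emptyI])
      show "(\<Sum>l\<in>X. integral {0..T} (\<lambda>t. (norm (?r l t))\<^sup>2)) \<le> ?A (H_time_norm L T 4 0 u)" if X: "finite X" for X
      proof -
        have "integral {0..T} (\<lambda>t. (norm (?r l t))\<^sup>2) = (\<integral>t. (norm (?r l t))\<^sup>2 \<partial>lebI T)" for l
          unfolding integral_lebI_indicator(1)[OF r2(1)[OF finite.emptyI] order_refl, symmetric]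
          by (intro Bochner_Integration.integral_cong) auto
        then show ?thesis using r2(2)[OF X] by simp
      qed
      show "(\<Sum>l\<in>X. (1 + \<bar>of_int l\<bar>) ^ (2 * (m + 4)) * (norm (c 0 l t))\<^sup>2) \<le> ?B (Linf_time_norm L T (m + 4) u)"
        if "finite X" "t \<in> {0..T}" for X t
        unfolding c0[OF that(2)] by (rule weighted_coeff_bound_all_times[OF \<open>0 < L\<close> \<open>0 < T\<close> uinf cont that(2,1)])
      show "c 2 l t = - of_real (freq L l ^ 4 + (freq L l)\<^sup>2) * c 0 l t
          - of_real ((freq L l)\<^sup>2) * fourier_coeff L (\<lambda>x. u t x ^ p) l" if "t \<in> {0..T}" for l t
        by (rule equation_modes[OF \<open>0 < L\<close> \<open>0 < T\<close> sol u4 c0 cAE cc that]) auto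
      show "0 \<le> ?A (H_time_norm L T 4 0 u)" using \<open>0 < L\<close> by simp
    qed (rule assms K c0 der c3 r1; assumption)+
    show "let h = L / (2 * real N + 1);
           dt = T / real K;
           D = discrete_deriv L N;
           U = (\<lambda>n i. U_approx L N u (real n * dt) (grid_point L N i));
           \<Psi> = (\<lambda>n i. Psi_approx L T N dt u (real n * dt) (grid_point L N i));
           B = spectral_modes.Cst L T (?A (H_time_norm L T 4 0 u)) (?B (Linf_time_norm L T (m + 4) u)) p m
       in \<exists>\<tau>1 \<tau>2 :: nat \<Rightarrow> nat \<Rightarrow> real.
            (\<forall>n\<in>{1..K - 1}. \<forall>i\<le>2 * N.
               (\<Psi> (n + 1) i - \<Psi> n i) / dt =
                 - (D ^^ 4) (\<lambda>j. (U (n + 1) j + U n j) / 2) i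
                 + (D ^^ 2) (\<lambda>j. (U (n + 1) j + U n j) / 2) i
                 + (D ^^ 2) (\<lambda>j. 3 / 2 * U n j ^ p - 1 / 2 * U (n - 1) j ^ p) i
                 + \<tau>1 n i \<and>
               (U (n + 1) i - U n i) / dt = (\<Psi> (n + 1) i + \<Psi> n i) / 2 + dt * \<tau>2 n i) \<and>
            discrete_time_norm N dt K \<tau>1 \<le> B * (dt\<^sup>2 + h ^ m) \<and>
            discrete_time_norm N dt K \<tau>2 \<le> B * (dt\<^sup>2 + h ^ m)"
      unfolding Let_def dt_def[symmetric] tm_def[symmetric]
    proof (rule exI[of _ \<tau>1], rule exI[of _ \<tau>2], intro conjI ballI allI impI consistency)
      fix n i
      show "(Psi_approx L T N dt u (tm (n + 1)) (xg i) - Psi_approx L T N dt u (tm n) (xg i)) / dt =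
        - (discrete_deriv L N ^^ 4) (\<lambda>j. (U_approx L N u (tm (n + 1)) (xg j) + U_approx L N u (tm n) (xg j)) / 2) i
        + (discrete_deriv L N ^^ 2) (\<lambda>j. (U_approx L N u (tm (n + 1)) (xg j) + U_approx L N u (tm n) (xg j)) / 2) i
        + (discrete_deriv L N ^^ 2) (\<lambda>j. 3 / 2 * U_approx L N u (tm n) (xg j) ^ p - 1 / 2 * U_approx L N u (tm (n - 1)) (xg j) ^ p) i
        + \<tau>1 n i"
        unfolding \<tau>1_def by simp
      show "(U_approx L N u (tm (n + 1)) (xg i) - U_approx L N u (tm n) (xg i)) / dt
        = (Psi_approx L T N dt u (tm (n + 1)) (xg i) + Psi_approx L T N dt u (tm n) (xg i)) / 2 + dt * \<tau>2 n i"
        unfolding \<tau>2_def using dt_pos by simp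
    qed
  qed
qed
end
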